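(* Let $1<p<\infty$ and let $A=T(a)+H$, where $a\in L^1$ and $H$ is a Hankel form. (i) If $A$ is bounded on $H^p$, then $a\in L^\infty$ and $H=H(b)$ for some $b\in L^\infty$. (ii) If $A$ is compact on $H^p$, then $a=0$ and $H=H(b)$ for some $b\in C(\mathbb{T})$.
   Context: $\mathbb{N}_0=\{0,1,2,\dots\}$. $L^p$ is the Lebesgue space of the unit circle $\mathbb{T}$ with normalized Lebesgue measure, $H^p=\{f\in L^p:\hat f_n=0\text{ for }n<0\}$; $\chi_j(z)=z^j$ for $j\in\mathbb{Z}$; $\langle f,g\rangle=\frac1{2\pi}\int_0^{2\pi}f(e^{i\theta})\overline{g(e^{i\theta})}\,d\theta$ whenever $fg\in L^1$. $C(\mathbb{T})$ is the space of continuous functions on $\mathbb{T}$. Forms: let $\mathcal{D}_+=\operatorname{span}\{\chi_j:j\in\mathbb{N}_0\}$. A form is a sesquilinear map $\mathcal{D}_+\times\mathcal{D}_+\to\mathbb{C}$, written $(f,g)\mapsto\langle Bf,g\rangle$ even if not induced by an operator $B$. An operator on $H^p$ is identified with the form $(f,g)\mapsto\langle Af,g\rangle$ it induces; a form is bounded (compact) on $H^p$ if it is induced by a bounded (compact) linear operator on $H^p$. Forms are added pointwise. A form $H$ is a Hankel form if $\langle H\chi_{k+1},\chi_j\rangle=\langle H\chi_k,\chi_{j+1}\rangle$ for all $j,k\in\mathbb{N}_0$. For $a\in L^1$, $T(a)$ and $H(a)$ denote the forms determined by $\langle T(a)\chi_k,\chi_j\rangle=\langle a,\chi_{j-k}\rangle$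 and $\langle H(a)\chi_k,\chi_j\rangle=\langle a,\chi_{1+j+k}\rangle$ for $j,k\in\mathbb{N}_0$. *)

theory Defs
  imports "HOL-Probability.Probability"
begin

text \<open>The space of this measure is the unit circle itself, so functions \<open>complex \<Rightarrow> complex\<close> serve as
  functions on the circle and their values elsewhere play no role.\<close>

definition circle :: "complex measure" where
  "circle = distr (uniform_measure lborel {0..2 * pi}) (restrict_space borel (sphere 0 1)) cis"

definition Lp :: "real \<Rightarrow> (complex \<Rightarrow> complex) set" where
  "Lp p = {f \<in> borel_measurable circle. integrable circle (\<lambda>z. norm (f z) powr p)}"

definition Linf :: "(complex \<Rightarrow> complex) set" where
  "Linf = {f \<in> borel_measurable circle. \<exists>C. AE z in circle. norm (f z) \<le> C}"

definition C_circle :: "(complex \<Rightarrow> complex) set" where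
  "C_circle = {f. continuous_on (sphere 0 1) f}"

definition Lp_norm :: "real \<Rightarrow> (complex \<Rightarrow> complex) \<Rightarrow> real" where
  "Lp_norm p f = (LINT z|circle. norm (f z) powr p) powr (1 / p)"

definition chi :: "int \<Rightarrow> complex \<Rightarrow> complex" where
  "chi j = (\<lambda>z. z powi j)"

definition pairing :: "(complex \<Rightarrow> complex) \<Rightarrow> (complex \<Rightarrow> complex) \<Rightarrow> complex" where
  "pairing f g = (LINT z|circle. f z * cnj (g z))"

abbreviation fourier :: "(complex \<Rightarrow> complex) \<Rightarrow> int \<Rightarrow> complex" where
  "fourier f n \<equiv> pairing f (chi n)"

definition Hp :: "real \<Rightarrow> (complex \<Rightarrow> complex) set" where
  "Hp p = {f \<in> Lp p. \<forall>n<0. fourier f n = 0}"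

text \<open>Elements of \<open>Hp p\<close> are representatives of classes modulo equality almost everywhere. An operator
  therefore acts on representatives, respects these classes, and is linear up to null sets.\<close>

definition linear_operator_Hp ::
    "real \<Rightarrow> ((complex \<Rightarrow> complex) \<Rightarrow> complex \<Rightarrow> complex) \<Rightarrow> bool" where
  "linear_operator_Hp p L \<longleftrightarrow>
     (\<forall>f\<in>Hp p. L f \<in> Hp p) \<and>
     (\<forall>f\<in>Hp p. \<forall>g\<in>Hp p. (AE z in circle. f z = g z) \<longrightarrow> (AE z in circle. L f z = L g z)) \<and>
     (\<forall>f\<in>Hp p. \<forall>g\<in>Hp p. AE z in circle. L (\<lambda>w. f w + g w) z = L f z + L g z) \<and>
     (\<forall>c. \<forall>f\<in>Hp p. AE z in circle. L (\<lambda>w. c * f w) z = c * L f z)"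

definition bounded_operator_Hp ::
    "real \<Rightarrow> ((complex \<Rightarrow> complex) \<Rightarrow> complex \<Rightarrow> complex) \<Rightarrow> bool" where
  "bounded_operator_Hp p L \<longleftrightarrow>
     linear_operator_Hp p L \<and> (\<exists>C. \<forall>f\<in>Hp p. Lp_norm p (L f) \<le> C * Lp_norm p f)"

definition compact_operator_Hp ::
    "real \<Rightarrow> ((complex \<Rightarrow> complex) \<Rightarrow> complex \<Rightarrow> complex) \<Rightarrow> bool" where
  "compact_operator_Hp p L \<longleftrightarrow>
     linear_operator_Hp p L \<and>
     (\<forall>F :: nat \<Rightarrow> complex \<Rightarrow> complex.
        (\<forall>n. F n \<in> Hp p) \<longrightarrow> (\<exists>C. \<forall>n. Lp_norm p (F n) \<le> C) \<longrightarrow>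
        (\<exists>r g. strict_mono r \<and> g \<in> Hp p \<and>
           (\<lambda>n. Lp_norm p (\<lambda>z. L (F (r n)) z - g z)) \<longlonglongrightarrow> 0))"

definition D_plus :: "(complex \<Rightarrow> complex) set" where
  "D_plus = {f. \<exists>(n::nat) c. f = (\<lambda>z. \<Sum>k<n. c k * chi (int k) z)}"

text \<open>Only the values of a form on \<open>D_plus \<times> D_plus\<close> are relevant.\<close>

type_synonym form = "(complex \<Rightarrow> complex) \<Rightarrow> (complex \<Rightarrow> complex) \<Rightarrow> complex"

definition sesquilinear_form :: "form \<Rightarrow> bool" where
  "sesquilinear_form B \<longleftrightarrow>
     (\<forall>f\<in>D_plus. \<forall>g\<in>D_plus. \<forall>h\<in>D_plus. B (\<lambda>z. f z + g z) h = B f h + B g h) \<and>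
     (\<forall>c. \<forall>f\<in>D_plus. \<forall>h\<in>D_plus. B (\<lambda>z. c * f z) h = c * B f h) \<and>
     (\<forall>f\<in>D_plus. \<forall>g\<in>D_plus. \<forall>h\<in>D_plus. B f (\<lambda>z. g z + h z) = B f g + B f h) \<and>
     (\<forall>c. \<forall>f\<in>D_plus. \<forall>h\<in>D_plus. B f (\<lambda>z. c * h z) = cnj c * B f h)"

definition form_eq :: "form \<Rightarrow> form \<Rightarrow> bool" where
  "form_eq B B' \<longleftrightarrow> (\<forall>f\<in>D_plus. \<forall>g\<in>D_plus. B f g = B' f g)"

definition operator_form :: "((complex \<Rightarrow> complex) \<Rightarrow> complex \<Rightarrow> complex) \<Rightarrow> form" where
  "operator_form L = (\<lambda>f g. pairing (L f) g)"

definition bounded_form_Hp :: "real \<Rightarrow> form \<Rightarrow> bool" where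
  "bounded_form_Hp p B \<longleftrightarrow> (\<exists>L. bounded_operator_Hp p L \<and> form_eq B (operator_form L))"

definition compact_form_Hp :: "real \<Rightarrow> form \<Rightarrow> bool" where
  "compact_form_Hp p B \<longleftrightarrow> (\<exists>L. compact_operator_Hp p L \<and> form_eq B (operator_form L))"

definition hankel_form :: "form \<Rightarrow> bool" where
  "hankel_form B \<longleftrightarrow> sesquilinear_form B \<and>
     (\<forall>j k. B (chi (int (k + 1))) (chi (int j)) = B (chi (int k)) (chi (int (j + 1))))"

text \<open>The sesquilinear form with matrix \<open>m\<close>: since the \<open>chi k\<close> are orthonormal, \<open>fourier f k\<close> is the
  coefficient of \<open>chi k\<close> in \<open>f \<in> D_plus\<close>, and the sums are finite for such \<open>f\<close> and \<open>g\<close>.\<close>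

definition matrix_form :: "(nat \<Rightarrow> nat \<Rightarrow> complex) \<Rightarrow> form" where
  "matrix_form m f g =
     (\<Sum>k | fourier f (int k) \<noteq> 0. \<Sum>j | fourier g (int j) \<noteq> 0.
        fourier f (int k) * cnj (fourier g (int j)) * m j k)"

definition toeplitz_of :: "(complex \<Rightarrow> complex) \<Rightarrow> form" where
  "toeplitz_of a = matrix_form (\<lambda>j k. pairing a (chi (int j - int k)))"

definition hankel_of :: "(complex \<Rightarrow> complex) \<Rightarrow> form" where
  "hankel_of a = matrix_form (\<lambda>j k. pairing a (chi (1 + int j + int k)))"

lemma measurable_cis_circle:
  "cis \<in> measurable (uniform_measure lborel {0..2 * pi}) (restrict_space borel (sphere 0 1))"
proof -
  have "cis \<in> borel_measurable borel"
    by (intro borel_measurable_continuous_onI continuous_intros)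
  then have "cis \<in> borel_measurable (uniform_measure lborel {0..2 * pi})"
    by (simp cong: measurable_cong_sets)
  then show ?thesis by (intro measurable_restrict_space2) auto
qed

lemma space_circle [simp]: "space circle = sphere 0 1"
  by (simp add: circle_def space_restrict_space)

lemma sets_circle [measurable_cong]: "sets circle = sets (restrict_space borel (sphere 0 1))"
  by (simp add: circle_def)

lemma prob_space_circle: "prob_space circle"
  unfolding circle_def
  by (intro prob_space.prob_space_distr prob_space_uniform_measure measurable_cis_circle) auto

lemma pairing_eq_integral:
  assumes "(\<lambda>z. f z * cnj (g z)) \<in> borel_measurable circle"
  shows "pairing f g = (1 / (2 * pi)) * (LINT t:{0..2 * pi}|lborel. f (cis t) * cnj (g (cis t)))"
proof -
  let ?h = "\<lambda>t. f (cis t) * cnj (g (cis t))"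
  have meas: "?h \<in> borel_measurable lborel"
    using measurable_compose[OF measurable_cis_circle, of "\<lambda>z. f z * cnj (g z)" borel] assms
    by (simp add: circle_def)
  have dens: "uniform_measure lborel {0..2 * pi}
      = density lborel (\<lambda>t. ennreal (indicator {0..2 * pi} t / (2 * pi)))"
    unfolding uniform_measure_def
    by (intro density_cong) (auto simp: indicator_def divide_ennreal simp flip: ennreal_1)
  have "pairing f g = (LINT t|uniform_measure lborel {0..2 * pi}. ?h t)"
    unfolding pairing_def circle_def
    by (rule integral_distr[OF measurable_cis_circle]) (use assms in \<open>simp add: circle_def\<close>)
  also have "\<dots> = (LINT t|lborel. (indicator {0..2 * pi} t / (2 * pi)) *\<^sub>R ?h t)"
    unfolding dens by (rule integral_density[OF meas]) auto
  also have "\<dots> = (LINT t|lborel. (1 / (2 * pi)) *\<^sub>R (indicator {0..2 * pi} t *\<^sub>R ?h t))"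
    by (intro Bochner_Integration.integral_cong) (auto simp: indicator_def)
  also have "\<dots> = (1 / (2 * pi)) *\<^sub>R (LINT t|lborel. indicator {0..2 * pi} t *\<^sub>R ?h t)"
    by (rule integral_scaleR_right)
  finally show ?thesis
    by (simp add: set_lebesgue_integral_def scaleR_conv_of_real)
qed

lemma continuous_on_chi: "continuous_on (sphere 0 1) (chi j)"
  unfolding chi_def by (intro continuous_intros) auto

lemma borel_measurable_circle_continuous:
  "continuous_on (sphere 0 1) f \<Longrightarrow> f \<in> borel_measurable circle"
  using borel_measurable_continuous_on_restrict[of "sphere 0 1" f]
  by (simp add: circle_def)

lemma integrable_circle_continuous:
  fixes f :: "complex \<Rightarrow> complex"
  assumes "continuous_on (sphere 0 1) f"
  shows "integrable circle f"
proof -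
  interpret prob_space circle by (rule prob_space_circle)
  have "compact (f ` sphere 0 1)"
    by (intro compact_continuous_image assms compact_sphere)
  then obtain C where "\<forall>y\<in>f ` sphere 0 1. norm y \<le> C"
    using compact_imp_bounded bounded_iff by metis
  then show ?thesis
    by (intro integrable_const_bound[where B = C] borel_measurable_circle_continuous assms AE_I2)
       auto
qed

lemma pairing_chi_chi: "pairing (chi j) (chi k) = (if j = k then 1 else 0)"
proof -
  have meas: "(\<lambda>z. chi j z * cnj (chi k z)) \<in> borel_measurable circle"
    by (intro borel_measurable_circle_continuous continuous_intros continuous_on_chi)
  have eq: "chi j (cis t) * cnj (chi k (cis t)) = cis (of_int (j - k) * t)" for t
    by (simp add: chi_def cis_power_int cis_cnj cis_mult algebra_simps)
  have "(LINT t:{0..2 * pi}|lborel. cis (of_int (j - k) * t))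
      = (if j = k then complex_of_real (2 * pi) else 0)"
  proof (cases "j = k")
    case True
    then show ?thesis by (simp add: set_lebesgue_integral_def scaleR_conv_of_real)
  next
    case False
    define n where "n = real_of_int (j - k)"
    have n: "n \<noteq> 0" using False by (simp add: n_def)
    have "((\<lambda>t. cis (n * t) / (\<i> * of_real n)) has_vector_derivative cis (n * t))
        (at t within {0..2 * pi})" for t
    proof -
      have "((\<lambda>t. exp (\<i> * of_real n * of_real t) / (\<i> * of_real n)) has_vector_derivative
           exp (\<i> * of_real n * of_real t)) (at t within {0..2 * pi})"
        using n by (auto intro!: derivative_eq_intros has_vector_derivative_real_field)
      then show ?thesis by (simp add: cis_conv_exp mult.assoc)
    qed
    then have "(LINT t|lborel. indicator {0..2 * pi} t *\<^sub>R cis (n * t))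
        = cis (n * (2 * pi)) / (\<i> * of_real n) - cis (n * 0) / (\<i> * of_real n)"
      by (intro integral_FTC_Icc) (auto intro!: continuous_intros)
    moreover have "cis (n * (2 * pi)) = 1"
      using cis_multiple_2pi[of n] by (simp add: n_def mult_ac)
    ultimately show ?thesis using False by (simp add: set_lebesgue_integral_def n_def)
  qed
  then show ?thesis by (simp add: pairing_eq_integral[OF meas] eq)
qed

lemma continuous_on_D_plus: "f \<in> D_plus \<Longrightarrow> continuous_on (sphere 0 1) f"
  by (auto simp: D_plus_def intro!: continuous_intros continuous_on_chi)

lemma fourier_D_plus:
  "fourier (\<lambda>z. \<Sum>k<n. c k * chi (int k) z) (int j) = (if j < n then c j else 0)"
proof -
  have "fourier (\<lambda>z. \<Sum>k<n. c k * chi (int k) z) (int j)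
      = (LINT z|circle. (\<Sum>k<n. c k * (chi (int k) z * cnj (chi (int j) z))))"
    by (simp add: pairing_def sum_distrib_right mult.assoc)
  also have "\<dots> = (\<Sum>k<n. c k * pairing (chi (int k)) (chi (int j)))"
    by (simp add: pairing_def Bochner_Integration.integral_sum integrable_circle_continuous
          continuous_intros continuous_on_chi)
  finally show ?thesis by (simp add: pairing_chi_chi if_distrib sum.delta' cong: if_cong)
qed

lemma fourier_add_D_plus:
  assumes "f \<in> D_plus" "g \<in> D_plus"
  shows "fourier (\<lambda>z. f z + g z) k = fourier f k + fourier g k"
  unfolding pairing_def distrib_right
  by (intro Bochner_Integration.integral_add integrable_circle_continuous continuous_intros
        continuous_on_D_plus continuous_on_chi assms)

lemma fourier_mult_D_plus: "fourier (\<lambda>z. c * f z) k = c * fourier f k"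
  by (simp add: pairing_def mult.assoc)

lemma fourier_D_plus_eventually_0:
  assumes "f \<in> D_plus"
  obtains n where "\<And>k. k \<ge> n \<Longrightarrow> fourier f (int k) = 0"
proof -
  obtain n :: nat and c where "f = (\<lambda>z. \<Sum>k<n. c k * chi (int k) z)"
    using assms by (auto simp: D_plus_def)
  then show ?thesis by (intro that[of n]) (simp add: fourier_D_plus)
qed

lemma matrix_form_eq_sum:
  assumes "\<And>k. k \<ge> n \<Longrightarrow> fourier f (int k) = 0" "\<And>k. k \<ge> l \<Longrightarrow> fourier g (int k) = 0"
  shows "matrix_form m f g
    = (\<Sum>k<n. \<Sum>j<l. fourier f (int k) * cnj (fourier g (int j)) * m j k)"
proof -
  have sub: "{k. fourier f (int k) \<noteq> 0} \<subseteq> {..<n}" "{k. fourier g (int k) \<noteq> 0} \<subseteq> {..<l}"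
    using assms by (auto simp: not_le [symmetric])
  show ?thesis
    unfolding matrix_form_def
    by (intro sum.mono_neutral_cong_left sub) (auto intro!: sum.neutral)
qed

lemma matrix_form_chi: "matrix_form m (chi (int k)) (chi (int j)) = m j k"
proof -
  have "{i. fourier (chi (int l)) (int i) \<noteq> 0} = {l}" for l
    by (auto simp: pairing_chi_chi)
  then show ?thesis by (simp add: matrix_form_def pairing_chi_chi)
qed

lemma sesquilinear_matrix_form: "sesquilinear_form (matrix_form m)"
proof -
  have common: "\<exists>n. \<forall>k\<ge>n. fourier f (int k) = 0 \<and> fourier g (int k) = 0 \<and> fourier h (int k) = 0"
    if fgh: "f \<in> D_plus" "g \<in> D_plus" "h \<in> D_plus" for f g h
  proof -
    obtain n1 where "\<And>k. k \<ge> n1 \<Longrightarrow> fourier f (int k) = 0"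
      using fgh(1) fourier_D_plus_eventually_0 by blast
    moreover obtain n2 where "\<And>k. k \<ge> n2 \<Longrightarrow> fourier g (int k) = 0"
      using fgh(2) fourier_D_plus_eventually_0 by blast
    moreover obtain n3 where "\<And>k. k \<ge> n3 \<Longrightarrow> fourier h (int k) = 0"
      using fgh(3) fourier_D_plus_eventually_0 by blast
    ultimately show ?thesis by (intro exI[of _ "max n1 (max n2 n3)"]) auto
  qed
  show ?thesis
    unfolding sesquilinear_form_def
  proof (intro conjI ballI allI)
    fix f g h assume fgh: "f \<in> D_plus" "g \<in> D_plus" "h \<in> D_plus"
    obtain n where n: "\<And>k. k \<ge> n \<Longrightarrow> fourier f (int k) = 0"
      "\<And>k. k \<ge> n \<Longrightarrow> fourier g (int k) = 0" "\<And>k. k \<ge> n \<Longrightarrow> fourier h (int k) = 0"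
      using common[OF fgh] by blast
    note add = fourier_add_D_plus[OF fgh(1,2)] fourier_add_D_plus[OF fgh(2,3)]
    have s: "\<And>k. k \<ge> n \<Longrightarrow> fourier (\<lambda>z. f z + g z) (int k) = 0"
      "\<And>k. k \<ge> n \<Longrightarrow> fourier (\<lambda>z. g z + h z) (int k) = 0"
      using n by (simp_all add: add)
    show "matrix_form m (\<lambda>z. f z + g z) h = matrix_form m f h + matrix_form m g h"
      by (simp add: matrix_form_eq_sum[of n _ n] n s)
         (simp add: add distrib_right sum.distrib)
    show "matrix_form m f (\<lambda>z. g z + h z) = matrix_form m f g + matrix_form m f h"
      by (simp add: matrix_form_eq_sum[of n _ n] n s)
         (simp add: add distrib_left distrib_right sum.distrib)
  next
    fix c f h assume fh: "f \<in> D_plus" "h \<in> D_plus"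
    obtain n where n: "\<And>k. k \<ge> n \<Longrightarrow> fourier f (int k) = 0"
      "\<And>k. k \<ge> n \<Longrightarrow> fourier h (int k) = 0"
      using common[OF fh(1,1,2)] by blast
    have s: "\<And>k. k \<ge> n \<Longrightarrow> fourier (\<lambda>z. c * f z) (int k) = 0"
      "\<And>k. k \<ge> n \<Longrightarrow> fourier (\<lambda>z. c * h z) (int k) = 0"
      using n by (simp_all add: fourier_mult_D_plus)
    show "matrix_form m (\<lambda>z. c * f z) h = c * matrix_form m f h"
      by (simp add: matrix_form_eq_sum[of n _ n] n s)
         (simp add: fourier_mult_D_plus sum_distrib_left mult.assoc)
    show "matrix_form m f (\<lambda>z. c * h z) = cnj c * matrix_form m f h"
      by (simp add: matrix_form_eq_sum[of n _ n] n s)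
         (simp add: fourier_mult_D_plus sum_distrib_left mult_ac)
  qed
qed

lemma toeplitz_of_chi:
  "toeplitz_of a (chi (int k)) (chi (int j)) = pairing a (chi (int j - int k))"
  by (simp add: toeplitz_of_def matrix_form_chi)

lemma hankel_of_chi:
  "hankel_of a (chi (int k)) (chi (int j)) = pairing a (chi (1 + int j + int k))"
  by (simp add: hankel_of_def matrix_form_chi)

lemma hankel_form_hankel_of: "hankel_form (hankel_of a)"
  unfolding hankel_form_def hankel_of_chi
  by (simp add: hankel_of_def sesquilinear_matrix_form algebra_simps)

end

theory Submission
  imports Defs "HOL-Complex_Analysis.Complex_Analysis"
begin

text \<open> All estimates are made on polynomials, where the bounded form \<open>A\<close> satisfies
  \<open>norm (A f g) \<le> C * norm f * norm g\<close> with the norms of \<open>Lp p\<close> and of its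
  dual \<open>Lp q\<close>.

  \<^emph>\<open>Separating the two parts.\<close> Replacing \<open>f\<close> and \<open>g\<close> by
  \<open>z ^ n * f\<close> and \<open>z ^ n * g\<close> changes neither their norms nor the value of
  \<open>T(a)\<close>, but moves the entries of the Hankel matrix to infinity, where they vanish by the
  Riemann--Lebesgue lemma. In the limit (\<open>toeplitz_as_shift_limit\<close>) the integral of \<open>a *
  f * cnj g\<close> obeys the bound of \<open>A\<close>. Taking for \<open>f = g\<close> approximations to
  indicator functions gives \<open>norm a \<le> C\<close> almost everywhere
  (\<open>AE_norm_le_of_quadratic\<close>). The difference \<open>H\<close> then obeys a bound of the same
  kind. If \<open>A\<close> is compact, the limit is 0, because high powers of \<open>z\<close> are almost
  orthogonal to any fixed function (\<open>compact_operator_pairing_shift\<close>).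

  \<^emph>\<open>Bounded Hankel forms.\<close> The value \<open>H f g\<close> depends only on the product of
  \<open>g\<close> with the polynomial whose coefficients are conjugate to those of \<open>f\<close>. A
  polynomial \<open>\<phi>\<close> factors on the circle as \<open>f * g\<close>, where the norms of
  \<open>f\<close> in \<open>Lp p\<close> and of \<open>g\<close> in \<open>Lp q\<close> multiply to the
  \<open>L1\<close> norm of \<open>\<phi>\<close>: divide out a Blaschke product and take powers of the
  rest. So \<open>H\<close> is a functional on polynomials bounded for the \<open>L1\<close> norm
  (\<open>moment_functional_le_L1_of_products\<close>). This is the step that makes the argument independent
  of \<open>p\<close>. As in Nehari's theorem, the Hahn--Banach extension to all trigonometric polynomials
  is represented by a bounded function (\<open>bounded_moment_functional_symbol\<close>). Only countably
  many one-dimensional extensions are required, since trigonometric polynomials are polynomials divided by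
  powers of \<open>z\<close>.

  \<^emph>\<open>Compact Hankel forms.\<close> Compactness makes the norm of \<open>H f (z ^ n * g)\<close>
  tend to 0, so the sequence of moments can be cut off at the front to have arbitrarily small norm. Hence
  \<open>H\<close> is approximated by Hankel forms with polynomial symbols, and Fejer means turn the
  approximation into a uniformly convergent series of continuous symbols, as in Hartman's theorem
  (\<open>vanishing_tail_continuous_symbol\<close>). \<close>

section \<open>Integration on the circle\<close>

lemma borel_measurable_circle_continuous_real:
  fixes f :: "complex \<Rightarrow> real"
  assumes "continuous_on (sphere 0 1) f"
  shows "f \<in> borel_measurable circle"
  using borel_measurable_continuous_on_restrict[OF assms] by (simp add: circle_def)

lemma integrable_circle_continuous_real:
  fixes f :: "complex \<Rightarrow> real"
  assumes "continuous_on (sphere 0 1) f"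
  shows "integrable circle f"
proof -
  have "integrable circle (\<lambda>z. complex_of_real (f z))"
    by (intro integrable_circle_continuous continuous_intros assms)
  then show ?thesis by (simp add: complex_of_real_integrable_eq)
qed

lemma integrable_circle_bounded:
  fixes f :: "complex \<Rightarrow> 'a :: {banach, second_countable_topology}"
  assumes "f \<in> borel_measurable circle" "AE z in circle. norm (f z) \<le> C"
  shows "integrable circle f"
proof -
  interpret prob_space circle by (rule prob_space_circle)
  show ?thesis using assms by (intro integrable_const_bound[where B = C])
qed

lemma integrable_mult_bounded:
  fixes f g :: "complex \<Rightarrow> complex"
  assumes "integrable circle f" "g \<in> borel_measurable circle"
    "AE z in circle. norm (g z) \<le> C"
  shows "integrable circle (\<lambda>z. f z * g z)"
proof (rule Bochner_Integration.integrable_bound)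
  show "integrable circle (\<lambda>z. C * norm (f z))"
    using assms(1) by simp
  show "(\<lambda>z. f z * g z) \<in> borel_measurable circle"
    using assms by measurable
  show "AE z in circle. norm (f z * g z) \<le> norm (C * norm (f z))"
    using assms(3)
  proof eventually_elim
    case (elim z)
    then have "0 \<le> C" using norm_ge_zero[of "g z"] by linarith
    with elim show ?case by (simp add: norm_mult mult.commute[of C] mult_left_mono)
  qed
qed

lemma integrable_mult_continuous:
  fixes f g :: "complex \<Rightarrow> complex"
  assumes "integrable circle f" "continuous_on (sphere 0 1) g"
  shows "integrable circle (\<lambda>z. f z * g z)"
proof -
  have "compact (g ` sphere 0 1)"
    by (intro compact_continuous_image assms compact_sphere)
  then obtain C where C: "\<forall>y\<in>g ` sphere 0 1. norm y \<le> C"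
    using compact_imp_bounded bounded_iff by metis
  then show ?thesis
    by (intro integrable_mult_bounded[of _ _ C] assms borel_measurable_circle_continuous AE_I2) auto
qed

lemma integral_circle_cong:
  fixes f g :: "complex \<Rightarrow> 'a :: {banach, second_countable_topology}"
  assumes "\<And>z. norm z = 1 \<Longrightarrow> f z = g z"
  shows "(LINT z|circle. f z) = (LINT z|circle. g z)"
  by (rule Bochner_Integration.integral_cong) (use assms in auto)

lemma integral_circle_power:
  "(LINT z|circle. z ^ i * cnj (z ^ j)) = (if i = j then 1 else 0)"
  using pairing_chi_chi[of "int i" "int j"] by (simp add: pairing_def chi_def)

lemma chi_of_nat: "chi (int n) z = z ^ n"
  by (simp add: chi_def)

lemma chi_mult_on_circle: "norm z = 1 \<Longrightarrow> chi i z * chi j z = chi (i + j) z"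
  unfolding chi_def by (subst power_int_add) auto

lemma cnj_chi_on_circle: 
  assumes "norm z = 1" shows "cnj (chi i z) = chi (- i) z"
proof -
  have "cnj z * z = 1"
    using assms by (simp add: mult.commute complex_norm_square[symmetric])
  then have "cnj z = inverse z"
    by (metis inverse_unique mult.commute)
  then show ?thesis by (simp add: chi_def power_int_def)
qed

lemma norm_chi_on_circle: "norm z = 1 \<Longrightarrow> norm (chi i z) = 1"
  by (simp add: chi_def norm_power_int)

text \<open>Complex conjugation preserves arc length: in the coordinate \<open>t\<close> on \<open>[0, 2 *
  pi]\<close> it is the reflection \<open>t \<mapsto> 2 * pi - t\<close>.\<close>

lemma integral_circle_cnj:
  fixes f :: "complex \<Rightarrow> complex"
  assumes "continuous_on (sphere 0 1) f"
  shows "(LINT z|circle. f (cnj z)) = (LINT z|circle. f z)"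
proof -
  have circle_lborel: "(LINT z|circle. g z)
      = (1 / (2 * pi)) * (LINT t:{0..2 * pi}|lborel. g (cis t))"
    if "continuous_on (sphere 0 1) g" for g :: "complex \<Rightarrow> complex"
    using pairing_eq_integral[of g "\<lambda>_. 1"] borel_measurable_circle_continuous[OF that]
    by (simp add: pairing_def)
  have c: "continuous_on (sphere 0 1) (\<lambda>z. f (cnj z))"
    by (rule continuous_on_compose2[OF assms]) (auto intro: continuous_intros)
  have "(LINT t:{0..2 * pi}|lborel. f (cis t))
      = (LINT t|lborel. indicator {0..2 * pi} t *\<^sub>R f (cis t))"
    by (simp add: set_lebesgue_integral_def)
  also have "\<dots> = (LINT t|lborel. indicator {0..2 * pi} (2 * pi + (-1) * t)
        *\<^sub>R f (cis (2 * pi + (-1) * t)))"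
    by (subst lborel_integral_real_affine[where c = "-1" and t = "2 * pi"]) auto
  also have "\<dots> = (LINT t:{0..2 * pi}|lborel. f (cnj (cis t)))"
    unfolding set_lebesgue_integral_def
  proof (rule Bochner_Integration.integral_cong)
    fix t :: real
    have "cis (2 * pi + (-1) * t) = cnj (cis t)"
      by (simp add: complex_eq_iff cos_diff sin_diff)
    then show "indicator {0..2 * pi} (2 * pi + (-1) * t) *\<^sub>R f (cis (2 * pi + (-1) * t))
        = indicator {0..2 * pi} t *\<^sub>R f (cnj (cis t))"
      by (auto simp: indicator_def)
  qed simp
  finally show ?thesis by (simp add: circle_lborel[OF assms] circle_lborel[OF c])
qed

lemma integral_circle_cnj_real:
  fixes f :: "complex \<Rightarrow> real"
  assumes "continuous_on (sphere 0 1) f"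
  shows "(LINT z|circle. f (cnj z)) = (LINT z|circle. f z)"
proof -
  have "(LINT z|circle. complex_of_real (f (cnj z))) = (LINT z|circle. complex_of_real (f z))"
    by (intro integral_circle_cnj[of "\<lambda>z. complex_of_real (f z)"] continuous_intros assms)
  then show ?thesis by simp
qed

section \<open>Lebesgue norms\<close>

lemma Lp_norm_nonneg: "0 \<le> Lp_norm p f"
  by (simp add: Lp_norm_def)

lemma Lp_norm_cong:
  assumes "\<And>z. norm z = 1 \<Longrightarrow> norm (f z) = norm (g z)"
  shows "Lp_norm p f = Lp_norm p g"
proof -
  have "(LINT z|circle. norm (f z) powr p) = (LINT z|circle. norm (g z) powr p)"
    by (rule integral_circle_cong) (simp add: assms)
  then show ?thesis by (simp add: Lp_norm_def)
qed

lemma Lp_norm_powr: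
  assumes "p > 0" shows "Lp_norm p f powr p = (LINT z|circle. norm (f z) powr p)"
  using assms by (simp add: Lp_norm_def powr_powr integral_nonneg_AE)

lemma Lp_norm_scale:
  assumes "p > 0" shows "Lp_norm p (\<lambda>z. c * f z) = norm c * Lp_norm p f"
  using assms by (simp add: Lp_norm_def norm_mult powr_mult powr_powr integral_nonneg_AE)

lemma Lp_norm_zero_AE:
  assumes "p > 0" "f \<in> Lp p" "Lp_norm p f = 0"
  shows "AE z in circle. f z = 0"
proof -
  have "(LINT z|circle. norm (f z) powr p) = 0"
    using assms by (simp add: Lp_norm_def)
  then have "AE z in circle. norm (f z) powr p = 0"
    using assms by (subst (asm) integral_nonneg_eq_0_iff_AE) (auto simp: Lp_def)
  then show ?thesis by eventually_elim simp
qed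

lemma continuous_in_Lp:
  assumes "continuous_on (sphere 0 1) f" "p > 0"
  shows "f \<in> Lp p"
  unfolding Lp_def
proof (intro CollectI conjI)
  show "integrable circle (\<lambda>z. norm (f z) powr p)"
    by (intro integrable_circle_continuous_real continuous_on_powr' continuous_intros assms(1))
       (use assms(2) in auto)
qed (intro borel_measurable_circle_continuous assms)

text \<open>Normalising both factors reduces the inequality to Young's inequality \<open>a * b \<le> a powr
  p / p + b powr q / q\<close>, integrated over the circle.\<close>

lemma Holder:
  assumes pq: "1 < p" "1 < q" "1 / p + 1 / q = 1" and f: "f \<in> Lp p" and g: "g \<in> Lp q"
  shows "integrable circle (\<lambda>z. f z * g z)"
    and "(LINT z|circle. norm (f z * g z)) \<le> Lp_norm p f * Lp_norm q g"
proof -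
  have [measurable]: "f \<in> borel_measurable circle" "g \<in> borel_measurable circle"
    and int: "integrable circle (\<lambda>z. norm (f z) powr p)" "integrable circle (\<lambda>z. norm (g z) powr q)"
    using f g by (auto simp: Lp_def)
  have young: "norm (f z) * norm (g z) \<le> norm (f z) powr p / p + norm (g z) powr q / q" for z
    using Youngs_inequality[OF pq] by simp
  show I: "integrable circle (\<lambda>z. f z * g z)"
    by (rule Bochner_Integration.integrable_bound
        [where f = "\<lambda>z. norm (f z) powr p / p + norm (g z) powr q / q"])
       (use int young pq in \<open>auto simp: norm_mult\<close>)
  define F G where "F = Lp_norm p f" and "G = Lp_norm q g"
  consider "F = 0" | "G = 0" | "F > 0" "G > 0"
    using Lp_norm_nonneg[of p f] Lp_norm_nonneg[of q g] unfolding F_def G_def by linarith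
  then show "(LINT z|circle. norm (f z * g z)) \<le> Lp_norm p f * Lp_norm q g"
  proof cases
    case 1
    then have "AE z in circle. norm (f z * g z) = 0"
      using Lp_norm_zero_AE[of p f] f pq by (auto simp: F_def)
    then have "(LINT z|circle. norm (f z * g z)) = 0"
      by (rule integral_eq_zero_AE)
    then show ?thesis by (simp add: Lp_norm_nonneg)
  next
    case 2
    then have "AE z in circle. norm (f z * g z) = 0"
      using Lp_norm_zero_AE[of q g] g pq by (auto simp: G_def)
    then have "(LINT z|circle. norm (f z * g z)) = 0"
      by (rule integral_eq_zero_AE)
    then show ?thesis by (simp add: Lp_norm_nonneg)
  next
    case 3
    have "(LINT z|circle. norm (f z * g z)) / (F * G)
        = (LINT z|circle. (norm (f z) / F) * (norm (g z) / G))"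
      by (simp add: norm_mult)
    also have "\<dots> \<le> (LINT z|circle. (norm (f z) powr p / F powr p) / p + (norm (g z) powr q / G powr q) / q)"
    proof (rule integral_mono)
      show "integrable circle (\<lambda>z. (norm (f z) / F) * (norm (g z) / G))"
        using integrable_norm[OF I] by (simp add: norm_mult)
      fix z
      show "(norm (f z) / F) * (norm (g z) / G)
          \<le> (norm (f z) powr p / F powr p) / p + (norm (g z) powr q / G powr q) / q"
        using Youngs_inequality[OF pq, of "norm (f z) / F" "norm (g z) / G"] 3
        by (simp add: powr_divide)
    qed (use int in auto)
    also have "\<dots> = 1 / p + 1 / q"
      using int 3 pq by (simp add: F_def G_def flip: Lp_norm_powr)
    finally show ?thesis using 3 pq by (simp add: F_def G_def field_simps)
  qed
qed

lemma norm_pairing_le: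
  assumes pq: "1 < p" "1 < q" "1 / p + 1 / q = 1" and f: "f \<in> Lp p" and g: "g \<in> Lp q"
  shows "norm (pairing f g) \<le> Lp_norm p f * Lp_norm q g"
proof -
  have g': "(\<lambda>z. cnj (g z)) \<in> Lp q"
    using g borel_measurable_continuous_onI[of cnj] continuous_on_cnj[OF continuous_on_id]
    by (auto simp: Lp_def intro: measurable_compose)
  have "norm (pairing f g) \<le> (LINT z|circle. norm (f z * cnj (g z)))"
    unfolding pairing_def by (rule integral_norm_bound)
  also have "\<dots> \<le> Lp_norm p f * Lp_norm q (\<lambda>z. cnj (g z))"
    by (rule Holder[OF pq f g'])
  also have "Lp_norm q (\<lambda>z. cnj (g z)) = Lp_norm q g"
    by (rule Lp_norm_cong) simp
  finally show ?thesis .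
qed

lemma Lp_integrable:
  assumes "1 \<le> p" "f \<in> Lp p"
  shows "integrable circle f"
proof (rule Bochner_Integration.integrable_bound)
  interpret prob_space circle by (rule prob_space_circle)
  show "integrable circle (\<lambda>z. 1 + norm (f z) powr p)"
    using assms by (auto simp: Lp_def)
  show "f \<in> borel_measurable circle" using assms by (auto simp: Lp_def)
  have "x \<le> 1 + x powr p" if "0 \<le> x" for x :: real
  proof (cases "x \<le> 1")
    case False
    then have "x powr 1 \<le> x powr p" using assms by (intro powr_mono) auto
    with False show ?thesis by simp
  qed (simp add: add_increasing2)
  then show "AE z in circle. norm (f z) \<le> norm (1 + norm (f z) powr p)"
    by simp
qed

section \<open>Polynomials and moment functionals\<close>

text \<open>A Hankel form depends on its two arguments only through a product of polynomials. This
  functional of the product carries all the information, and the norm that suits it is that of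
  \<open>L1\<close>.\<close>

definition moment_functional :: "(nat \<Rightarrow> complex) \<Rightarrow> complex poly \<Rightarrow> complex" where
  "moment_functional h q = (\<Sum>k\<le>degree q. coeff q k * h k)"

lemma moment_functional_eq_sum:
  assumes "\<And>k. k \<ge> n \<Longrightarrow> coeff q k = 0"
  shows "moment_functional h q = (\<Sum>k<n. coeff q k * h k)"
proof -
  have "(\<Sum>k\<le>degree q. coeff q k * h k) = (\<Sum>k\<le>degree q + n. coeff q k * h k)"
    by (rule sum.mono_neutral_left) (auto simp: coeff_eq_0)
  also have "\<dots> = (\<Sum>k<n. coeff q k * h k)"
    by (rule sum.mono_neutral_right) (auto simp: assms)
  finally show ?thesis by (simp add: moment_functional_def)
qed

lemma moment_functional_0 [simp]: "moment_functional h 0 = 0"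
  by (simp add: moment_functional_def)

lemma moment_functional_pCons:
  "moment_functional h (pCons c q) = c * h 0 + moment_functional (\<lambda>k. h (Suc k)) q"
proof -
  have "moment_functional h (pCons c q) = (\<Sum>k<Suc (Suc (degree q)). coeff (pCons c q) k * h k)"
    by (rule moment_functional_eq_sum) (auto simp: coeff_pCons coeff_eq_0 split: nat.splits)
  also have "\<dots> = c * h 0 + (\<Sum>k<Suc (degree q). coeff q k * h (Suc k))"
    by (subst sum.lessThan_Suc_shift) simp
  finally show ?thesis by (simp add: moment_functional_def lessThan_Suc_atMost)
qed

lemma moment_functional_add:
  "moment_functional h (q + r) = moment_functional h q + moment_functional h r"
proof -
  let ?n = "Suc (max (degree q) (degree r))"
  have "moment_functional h s = (\<Sum>k<?n. coeff s k * h k)" if "s \<in> {q, r, q + r}" for s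
    using that by (intro moment_functional_eq_sum) (auto simp: coeff_eq_0)
  then show ?thesis by (simp add: distrib_right sum.distrib del: sum.lessThan_Suc)
qed

lemma moment_functional_smult:
  "moment_functional h (smult c q) = c * moment_functional h q"
  by (cases "c = 0") (simp_all add: moment_functional_def sum_distrib_left mult.assoc)

lemma moment_functional_diff:
  "moment_functional h (q - r) = moment_functional h q - moment_functional h r"
  using moment_functional_add[of h "q - r" r] by simp

lemma moment_functional_linear_arg:
  "moment_functional (\<lambda>k. a * h k + b * g k) q = a * moment_functional h q + b * moment_functional g q"
  by (simp add: moment_functional_def sum_distrib_left algebra_simps sum.distrib)

lemma moment_functional_mult:
  "moment_functional h (f * g) = moment_functional (\<lambda>i. moment_functional (\<lambda>j. h (i + j)) g) f"
proof (induction f arbitrary: h)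
  case (pCons a f)
  have "moment_functional h (pCons a f * g)
      = a * moment_functional h g + moment_functional (\<lambda>k. h (Suc k)) (f * g)"
    by (simp add: moment_functional_add moment_functional_smult moment_functional_pCons)
  also have "moment_functional (\<lambda>k. h (Suc k)) (f * g)
      = moment_functional (\<lambda>i. moment_functional (\<lambda>j. h (Suc i + j)) g) f"
    by (simp add: pCons.IH)
  finally show ?case by (simp add: moment_functional_pCons)
qed simp

lemma moment_functional_integral:
  assumes "integrable circle \<beta>"
  shows "moment_functional (\<lambda>k. LINT z|circle. \<beta> z * z ^ k) q = (LINT z|circle. \<beta> z * poly q z)"
proof -
  have "(LINT z|circle. \<beta> z * poly q z)
      = (LINT z|circle. (\<Sum>k\<le>degree q. coeff q k * (\<beta> z * z ^ k)))"
    by (simp add: poly_altdef sum_distrib_left mult_ac)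
  also have "\<dots> = (\<Sum>k\<le>degree q. coeff q k * (LINT z|circle. \<beta> z * z ^ k))"
  proof (subst Bochner_Integration.integral_sum)
    show "integrable circle (\<lambda>z. coeff q k * (\<beta> z * z ^ k))" for k
      by (intro integrable_mult_right integrable_mult_continuous assms continuous_intros)
  qed simp
  finally show ?thesis by (simp add: moment_functional_def)
qed

section \<open>Extending moment functionals to negative frequencies\<close>

text \<open>The one-dimensional step of the Hahn-Banach theorem: admissible values at the new vector
  \<open>e\<close> are those between all \<open>u x - p (x - e)\<close> and all \<open>p (y + e) - u
  y\<close>, and subadditivity of \<open>p\<close> says that the former never exceed the latter.\<close>

lemma hahn_banach_step:
  fixes G :: "complex poly set" and u p :: "complex poly \<Rightarrow> real"
  assumes G0: "0 \<in> G" and Gadd: "\<And>x y. x \<in> G \<Longrightarrow> y \<in> G \<Longrightarrow> x + y \<in> G"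
    and Gscale: "\<And>t x. x \<in> G \<Longrightarrow> smult (complex_of_real t) x \<in> G"
    and uadd: "\<And>x y. u (x + y) = u x + u y"
    and uscale: "\<And>t x. u (smult (complex_of_real t) x) = t * u x"
    and padd: "\<And>x y. p (x + y) \<le> p x + p y"
    and pscale: "\<And>t x. p (smult (complex_of_real t) x) = \<bar>t\<bar> * p x"
    and le: "\<And>x. x \<in> G \<Longrightarrow> u x \<le> p x"
  shows "\<exists>v. \<forall>x\<in>G. \<forall>t. u x + t * v \<le> p (x + smult (complex_of_real t) e)"
proof -
  have sep: "u x - p (x - e) \<le> p (y + e) - u y" if "x \<in> G" "y \<in> G" for x y
  proof -
    have "u x + u y \<le> p ((x - e) + (y + e))"
      using le[OF Gadd[OF that]] by (simp add: uadd)
    also have "\<dots> \<le> p (x - e) + p (y + e)" by (rule padd)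
    finally show ?thesis by simp
  qed
  define v where "v = (SUP x\<in>G. u x - p (x - e))"
  have bdd: "bdd_above ((\<lambda>x. u x - p (x - e)) ` G)"
    using sep[OF _ G0] by (intro bdd_aboveI2)
  have lower: "u x - p (x - e) \<le> v" if "x \<in> G" for x
    unfolding v_def by (rule cSUP_upper[OF that bdd])
  have upper: "v \<le> p (y + e) - u y" if "y \<in> G" for y
    unfolding v_def by (rule cSUP_least) (use G0 sep that in auto)
  have "u x + t * v \<le> p (x + smult (complex_of_real t) e)" if x: "x \<in> G" for x t
  proof -
    define x' where "x' = smult (complex_of_real (1 / \<bar>t\<bar>)) x"
    have x': "x' \<in> G" unfolding x'_def by (rule Gscale[OF x])
    have x_eq: "x = smult (complex_of_real \<bar>t\<bar>) x'" if "t \<noteq> 0"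
      using that by (simp add: x'_def)
    consider "t = 0" | "t > 0" | "t < 0" by linarith
    then show ?thesis
    proof cases
      case 2
      have "u x + t * v = t * (u x' + v)"
        using x_eq uscale[of "\<bar>t\<bar>" x'] 2 by (simp add: algebra_simps)
      also have "\<dots> \<le> t * p (x' + e)"
        using upper[OF x'] 2 by simp
      also have "\<dots> = p (smult (complex_of_real t) (x' + e))"
        using 2 by (simp add: pscale del: smult_add_right smult_diff_right)
      also have "smult (complex_of_real t) (x' + e) = x + smult (complex_of_real t) e"
        using x_eq 2 by (simp add: smult_add_right)
      finally show ?thesis .
    next
      case 3
      have "u x + t * v = \<bar>t\<bar> * (u x' - v)"
        using x_eq uscale[of "\<bar>t\<bar>" x'] 3 by (simp add: algebra_simps)
      also have "\<dots> \<le> \<bar>t\<bar> * p (x' - e)"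
        using lower[OF x'] 3 by (intro mult_left_mono) auto
      also have "\<dots> = p (smult (complex_of_real \<bar>t\<bar>) (x' - e))"
        by (simp add: pscale del: smult_add_right smult_diff_right)
      also have "smult (complex_of_real \<bar>t\<bar>) (x' - e) = x + smult (complex_of_real t) e"
        using x_eq 3 by (simp add: smult_diff_right)
      finally show ?thesis .
    qed (use le[OF x] in simp)
  qed
  then show ?thesis by blast
qed

abbreviation L1_norm :: "complex poly \<Rightarrow> real" where
  "L1_norm q \<equiv> (LINT z|circle. norm (poly q z))"

lemma integrable_norm_poly: "integrable circle (\<lambda>z. norm (poly q z))"
  by (intro integrable_circle_continuous_real continuous_intros)

lemma L1_norm_add: "L1_norm (x + y) \<le> L1_norm x + L1_norm y"
proof -
  have "L1_norm (x + y) \<le> (LINT z|circle. norm (poly x z) + norm (poly y z))"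
    by (rule integral_mono)
       (auto intro!: integrable_circle_continuous_real continuous_intros norm_triangle_ineq)
  then show ?thesis by (simp add: integrable_norm_poly)
qed

lemma L1_norm_smult: "L1_norm (smult c x) = norm c * L1_norm x"
  by (simp add: norm_mult)

lemma L1_norm_pCons_0: "L1_norm (pCons 0 m) = L1_norm m"
  by (rule integral_circle_cong) (simp add: norm_mult)

text \<open>Multiplication by \<open>z\<close> preserves the \<open>L1\<close> norm, so a functional on
  polynomials may be regarded as one on \<open>z\<close> times the polynomials; a norm-preserving extension
  to all polynomials then supplies a moment of one degree lower. The complex extension is assembled from two
  real ones, in the directions \<open>1\<close> and \<open>\<i>\<close>.\<close>

lemma moment_functional_extend_down:
  assumes bound: "\<And>q. norm (moment_functional h q) \<le> C * L1_norm q" and C: "0 \<le> C"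
  shows "\<exists>v. \<forall>q. norm (moment_functional (case_nat v h) q) \<le> C * L1_norm q"
proof -
  define p where "p = (\<lambda>q. C * L1_norm q)"
  define u where "u = (\<lambda>v q. Re (moment_functional (case_nat (complex_of_real v) h) q))"
  have padd: "p (x + y) \<le> p x + p y" for x y
    using mult_left_mono[OF L1_norm_add C] by (simp add: p_def distrib_left)
  have pscale: "p (smult (complex_of_real t) x) = \<bar>t\<bar> * p x" for t x
    by (simp add: p_def L1_norm_smult del: poly_smult)
  have uadd: "u v (x + y) = u v x + u v y" for v x y
    by (simp add: u_def moment_functional_add)
  have uscale: "u v (smult (complex_of_real t) x) = t * u v x" for v t x
    by (simp add: u_def moment_functional_smult)
  have u_pCons: "u v (pCons c m) = Re c * v + Re (moment_functional h m)" for v c m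
    by (simp add: u_def moment_functional_pCons)
  have "\<exists>v1. \<forall>x\<in>range (pCons 0). \<forall>t. u 0 x + t * v1 \<le> p (x + smult (complex_of_real t) 1)"
  proof (rule hahn_banach_step[OF _ _ _ uadd uscale padd pscale])
    show "0 \<in> range (pCons (0::complex))" by (metis pCons_0_0 rangeI)
    show "x + y \<in> range (pCons 0)" if "x \<in> range (pCons 0)" "y \<in> range (pCons 0)"
      for x y :: "complex poly"
      using that by auto
    show "smult (complex_of_real t) x \<in> range (pCons 0)" if "x \<in> range (pCons 0)" for t x
      using that by auto
    show "u 0 x \<le> p x" if x: "x \<in> range (pCons 0)" for x
    proof -
      obtain m where m: "x = pCons 0 m" using x by blast
      have "u 0 x \<le> norm (moment_functional h m)"
        unfolding m u_pCons using complex_Re_le_cmod by simp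
      also have "\<dots> \<le> p x"
        unfolding p_def m L1_norm_pCons_0 by (rule bound)
      finally show ?thesis .
    qed
  qed
  then obtain v1 where v1: "\<And>m t. u 0 (pCons 0 m) + t * v1
      \<le> p (pCons 0 m + smult (complex_of_real t) 1)"
    by blast
  define G where "G = {pCons (complex_of_real t) m |t m. True}"
  have "\<exists>v2. \<forall>x\<in>G. \<forall>t. u v1 x + t * v2 \<le> p (x + smult (complex_of_real t) [:\<i>:])"
  proof (rule hahn_banach_step[OF _ _ _ uadd uscale padd pscale])
    show "0 \<in> G" unfolding G_def by (metis (mono_tags, lifting) mem_Collect_eq of_real_0 pCons_0_0)
    show "x + y \<in> G" if xy: "x \<in> G" "y \<in> G" for x y
    proof -
      obtain s m where "x = pCons (complex_of_real s) m"
        using xy(1) unfolding G_def by blast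
      moreover obtain t n where "y = pCons (complex_of_real t) n"
        using xy(2) unfolding G_def by blast
      ultimately have "x + y = pCons (complex_of_real (s + t)) (m + n)" by simp
      then show ?thesis unfolding G_def by blast
    qed
    show "smult (complex_of_real t) x \<in> G" if x: "x \<in> G" for t x
    proof -
      obtain s m where "x = pCons (complex_of_real s) m"
        using x unfolding G_def by blast
      then have "smult (complex_of_real t) x
          = pCons (complex_of_real (t * s)) (smult (complex_of_real t) m)" by simp
      then show ?thesis unfolding G_def by blast
    qed
    show "u v1 x \<le> p x" if x: "x \<in> G" for x
    proof -
      obtain s m where x_eq: "x = pCons (complex_of_real s) m"
        using x unfolding G_def by blast
      have "u v1 x = u 0 (pCons 0 m) + s * v1"
        by (simp add: x_eq u_pCons)
      also have "\<dots> \<le> p (pCons 0 m + smult (complex_of_real s) 1)" by (rule v1)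
      also have "pCons 0 m + smult (complex_of_real s) 1 = x"
        by (simp add: x_eq one_pCons)
      finally show ?thesis .
    qed
  qed
  then obtain v2 where v2: "\<And>m s t. u v1 (pCons (complex_of_real s) m) + t * v2
      \<le> p (pCons (complex_of_real s) m + smult (complex_of_real t) [:\<i>:])"
    unfolding G_def by blast
  \<comment> \<open>This choice gives \<open>Re (c * v) = Re c * v1 + Im c * v2\<close>.\<close>
  define v where "v = Complex v1 (- v2)"
  have re: "Re (moment_functional (case_nat v h) q) \<le> p q" for q
  proof -
    obtain c m where q: "q = pCons c m" by (rule pCons_cases)
    have "Re (moment_functional (case_nat v h) q) = u v1 (pCons (complex_of_real (Re c)) m) + Im c * v2"
      by (simp add: q u_pCons moment_functional_pCons v_def)
    also have "\<dots> \<le> p (pCons (complex_of_real (Re c)) m + smult (complex_of_real (Im c)) [:\<i>:])"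
      by (rule v2)
    also have "pCons (complex_of_real (Re c)) m + smult (complex_of_real (Im c)) [:\<i>:] = q"
      by (simp add: q complex_eq_iff)
    finally show ?thesis .
  qed
  have "norm (moment_functional (case_nat v h) q) \<le> p q" for q
  proof -
    \<comment> \<open>Rotating the argument makes the value real and nonnegative, so the bound on real parts suffices.\<close>
    define w where "w = cnj (sgn (moment_functional (case_nat v h) q))"
    have w: "w * moment_functional (case_nat v h) q = norm (moment_functional (case_nat v h) q)"
    proof -
      define x where "x = moment_functional (case_nat v h) q"
      have "cnj (sgn x) * x = norm x"
      proof (cases "x = 0")
        case False
        then show ?thesis
          by (simp add: sgn_eq complex_norm_square[symmetric] mult.commute[of "cnj x"] power2_eq_square)
      qed simp
      then show ?thesis by (simp add: w_def x_def)
    qed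
    have w1: "norm w \<le> 1" by (simp add: w_def norm_sgn)
    have "norm (moment_functional (case_nat v h) q) = Re (moment_functional (case_nat v h) (smult w q))"
      by (simp add: moment_functional_smult w)
    also have "\<dots> \<le> p (smult w q)" by (rule re)
    also have "\<dots> = norm w * p q"
      by (simp add: p_def L1_norm_smult del: poly_smult)
    also have "\<dots> \<le> p q"
      using w1 C by (simp add: p_def mult_left_le_one_le)
    finally show ?thesis .
  qed
  then show ?thesis unfolding p_def by blast
qed

text \<open>Every trigonometric polynomial is a polynomial divided by some power \<open>z ^ N\<close>, and
  the division preserves the \<open>L1\<close> norm. So this is the boundedness, with constant
  \<open>C\<close>, of the functional on trigonometric polynomials that takes \<open>chi k\<close> to
  \<open>g k\<close>.\<close>

definition L1_bounded :: "(int \<Rightarrow> complex) \<Rightarrow> real \<Rightarrow> bool" where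
  "L1_bounded g C \<longleftrightarrow>
     (\<forall>N q. norm (moment_functional (\<lambda>k. g (int k - int N)) q) \<le> C * L1_norm q)"

lemma moment_functional_extend_two_sided:
  assumes bound: "\<And>q. norm (moment_functional h q) \<le> C * L1_norm q" and C: "0 \<le> C"
  obtains g where "L1_bounded g C" "\<And>k. g (int k) = h k"
proof -
  define P where "P = (\<lambda>h. \<forall>q. norm (moment_functional h q) \<le> C * L1_norm q)"
  have "\<exists>s. \<forall>n. (P (s n) \<and> (n = 0 \<longrightarrow> s n = h)) \<and> (\<exists>v. s (Suc n) = case_nat v (s n))"
  proof (rule dependent_nat_choice)
    show "\<exists>x. P x \<and> (0 = (0::nat) \<longrightarrow> x = h)" using bound by (auto simp: P_def)
    show "\<exists>y. (P y \<and> (Suc n = 0 \<longrightarrow> y = h)) \<and> (\<exists>v. y = case_nat v x)"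
      if "P x \<and> (n = 0 \<longrightarrow> x = h)" for x n
      using moment_functional_extend_down[of x C] that C unfolding P_def by blast
  qed
  \<comment> \<open>\<open>s N\<close> lists the moments from index \<open>- N\<close> on.\<close>
  then obtain s where s: "\<And>n. P (s n)" "s 0 = h" "\<And>n. \<exists>v. s (Suc n) = case_nat v (s n)"
    by blast
  define g where "g = (\<lambda>k. if 0 \<le> k then h (nat k) else s (nat (- k)) 0)"
  have g: "s N k = g (int k - int N)" for N k
  proof (induction N arbitrary: k)
    case 0
    then show ?case by (simp add: g_def s)
  next
    case (Suc N)
    obtain v where v: "s (Suc N) = case_nat v (s N)" using s(3) by blast
    show ?case
    proof (cases k)
      case 0
      have "nat (int (Suc N)) = Suc N" by simp
      then show ?thesis by (simp add: 0 g_def del: of_nat_Suc)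
    next
      case (Suc k')
      then show ?thesis using Suc.IH[of k'] by (simp add: v)
    qed
  qed
  show ?thesis
  proof
    show "L1_bounded g C"
      using s(1) by (simp add: L1_bounded_def P_def flip: g)
    show "g (int k) = h k" for k by (simp add: g_def)
  qed
qed

text \<open>On the unit circle this polynomial is \<open>z ^ degree f\<close> times the conjugate of
  \<open>f\<close>.\<close>

definition circle_conj :: "complex poly \<Rightarrow> complex poly" where
  "circle_conj f = map_poly cnj (reflect_poly f)"

lemma poly_circle_conj:
  assumes "norm z = 1"
  shows "poly (circle_conj f) z = z ^ degree f * cnj (poly f z)"
proof -
  have z: "cnj z \<noteq> 0" "inverse (cnj z) = z"
    using assms cnj_chi_on_circle[OF assms, of 1] by (auto simp: chi_def power_int_minus)
  then have "poly (reflect_poly f) (cnj z) = cnj z ^ degree f * poly f z"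
    using poly_reflect_poly_nz[of "cnj z" f] by simp
  then show ?thesis
    by (simp add: circle_conj_def)
qed

lemma L1_norm_mult_circle_conj:
  "L1_norm (f * circle_conj f) = (LINT z|circle. (norm (poly f z))\<^sup>2)"
  by (rule integral_circle_cong)
     (simp add: poly_circle_conj norm_mult norm_power power2_eq_square)

lemma L1_bounded_quadratic:
  assumes "L1_bounded g C"
  shows "norm (moment_functional (\<lambda>k. g (int k - int (degree f))) (f * circle_conj f))
    \<le> C * (LINT z|circle. (norm (poly f z))\<^sup>2)"
  using assms unfolding L1_bounded_def by (metis L1_norm_mult_circle_conj)

lemma moment_functional_mult_circle_conj:
  "moment_functional (\<lambda>k. g (int k - int (degree f))) (f * circle_conj f)
    = (\<Sum>i\<le>degree f. \<Sum>j\<le>degree f. coeff f i * cnj (coeff f j) * g (int i - int j))"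
proof -
  have c: "coeff (circle_conj f) j = (if j \<le> degree f then cnj (coeff f (degree f - j)) else 0)" for j
    by (simp add: circle_conj_def coeff_map_poly coeff_reflect_poly)
  have "moment_functional (\<lambda>j. g (int (i + j) - int (degree f))) (circle_conj f)
      = (\<Sum>j\<le>degree f. cnj (coeff f j) * g (int i - int j))" for i
  proof -
    have "moment_functional (\<lambda>j. g (int (i + j) - int (degree f))) (circle_conj f)
        = (\<Sum>j<Suc (degree f). coeff (circle_conj f) j * g (int (i + j) - int (degree f)))"
      by (rule moment_functional_eq_sum) (simp add: c)
    also have "\<dots> = (\<Sum>j\<le>degree f. cnj (coeff f j) * g (int i - int j))"
      by (rule sum.reindex_bij_witness[of _ "\<lambda>j. degree f - j" "\<lambda>j. degree f - j"])
         (auto simp: c algebra_simps of_nat_diff)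
    finally show ?thesis .
  qed
  then show ?thesis
    unfolding moment_functional_mult by (simp add: moment_functional_def sum_distrib_left mult.assoc)
qed

section \<open>The Riesz--Fischer theorem\<close>

lemma integral_norm_trig_square:
  assumes "finite K"
  shows "(LINT z|circle. (norm (\<Sum>k\<in>K. c k * chi k z))\<^sup>2) = (\<Sum>k\<in>K. (norm (c k))\<^sup>2)"
proof -
  have "complex_of_real (LINT z|circle. (norm (\<Sum>k\<in>K. c k * chi k z))\<^sup>2)
      = (LINT z|circle. complex_of_real ((norm (\<Sum>k\<in>K. c k * chi k z))\<^sup>2))"
    by (rule integral_complex_of_real[symmetric])
  also have "\<dots> = (LINT z|circle. (\<Sum>k\<in>K. \<Sum>j\<in>K. c k * cnj (c j) * (chi k z * cnj (chi j z))))"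
    unfolding complex_norm_square cnj_sum sum_product by (simp add: mult_ac)
  also have "\<dots> = (\<Sum>k\<in>K. \<Sum>j\<in>K. c k * cnj (c j) * pairing (chi k) (chi j))"
    by (simp add: pairing_def Bochner_Integration.integral_sum integrable_circle_continuous
          continuous_intros continuous_on_chi)
  also have "\<dots> = (\<Sum>k\<in>K. c k * cnj (c k))"
    using assms by (simp add: pairing_chi_chi if_distrib[of "\<lambda>x. _ * x"] sum.delta' cong: if_cong)
  also have "\<dots> = complex_of_real (\<Sum>k\<in>K. (norm (c k))\<^sup>2)"
    unfolding of_real_sum complex_norm_square ..
  finally show ?thesis by (simp only: of_real_eq_iff)
qed

lemma integral_norm_poly_square:
  assumes "\<And>k. k \<ge> n \<Longrightarrow> coeff f k = 0"
  shows "(LINT z|circle. (norm (poly f z))\<^sup>2) = (\<Sum>k<n. (norm (coeff f k))\<^sup>2)"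
proof -
  have "poly f z = (\<Sum>k\<in>int ` {..<n}. coeff f (nat k) * chi k z)" for z
  proof -
    have "poly f z = (\<Sum>k\<le>degree f + n. coeff f k * z ^ k)"
      unfolding poly_altdef by (rule sum.mono_neutral_left) (auto simp: coeff_eq_0)
    also have "\<dots> = (\<Sum>k<n. coeff f k * z ^ k)"
      by (rule sum.mono_neutral_right) (auto simp: assms)
    finally show ?thesis by (simp add: sum.reindex chi_of_nat)
  qed
  then show ?thesis
    using integral_norm_trig_square[of "int ` {..<n}" "\<lambda>k. coeff f (nat k)"]
    by (simp only: sum.reindex[OF inj_on_of_nat] finite_imageI finite_lessThan o_def nat_int)
qed

lemma integral_norm_le_L2:
  fixes f :: "complex \<Rightarrow> complex"
  assumes "continuous_on (sphere 0 1) f"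
  shows "(LINT z|circle. norm (f z)) \<le> sqrt (LINT z|circle. (norm (f z))\<^sup>2)"
proof -
  interpret prob_space circle by (rule prob_space_circle)
  have "(LINT z|circle. norm (f z * 1)) \<le> Lp_norm 2 f * Lp_norm 2 (\<lambda>_. 1)"
    by (rule Holder) (auto intro!: continuous_in_Lp assms)
  moreover have "Lp_norm 2 (\<lambda>_. 1) = 1"
    using prob_space by (simp add: Lp_norm_def)
  moreover have "Lp_norm 2 f = sqrt (LINT z|circle. (norm (f z))\<^sup>2)"
    by (simp add: Lp_norm_def powr_half_sqrt flip: powr_numeral)
  ultimately show ?thesis by simp
qed

lemma AE_summable_norm:
  fixes d :: "nat \<Rightarrow> complex \<Rightarrow> complex"
  assumes int: "\<And>j. integrable circle (d j)" and s: "summable (\<lambda>j. LINT z|circle. norm (d j z))"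
  shows "AE z in circle. summable (\<lambda>j. norm (d j z))"
proof -
  have [measurable]: "\<And>j. d j \<in> borel_measurable circle" using int by auto
  have "(\<integral>\<^sup>+z. (\<Sum>j. ennreal (norm (d j z))) \<partial>circle)
      = (\<Sum>j. \<integral>\<^sup>+z. ennreal (norm (d j z)) \<partial>circle)"
    by (rule nn_integral_suminf) measurable
  also have "\<dots> = (\<Sum>j. ennreal (LINT z|circle. norm (d j z)))"
    by (intro arg_cong[where f = suminf] ext nn_integral_eq_integral integrable_norm int) auto
  also have "\<dots> \<noteq> \<infinity>"
    using s by (simp add: ennreal_suminf_neq_top integral_nonneg_AE)
  finally have "AE z in circle. (\<Sum>j. ennreal (norm (d j z))) \<noteq> \<infinity>"
    by (intro nn_integral_PInf_AE) auto
  then show ?thesis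
    by eventually_elim (auto intro!: summable_suminf_not_top simp: top_unique)
qed

text \<open>Square-summability makes the symmetric partial sums Cauchy in \<open>L2\<close>, hence in
  \<open>L1\<close>. Along indices \<open>N j\<close> whose increments have \<open>L1\<close> norm at most
  \<open>2 ^ (- j)\<close> they converge almost everywhere, absolutely.\<close>

lemma Riesz_Fischer:
  fixes c :: "int \<Rightarrow> complex"
  assumes bound: "\<And>n::nat. (\<Sum>k\<in>{- int n..int n}. (norm (c k))\<^sup>2) \<le> B"
  obtains \<beta> where "integrable circle \<beta>" "\<And>k. fourier \<beta> k = c k"
proof -
  define K where "K = (\<lambda>n::nat. {- int n..int n})"
  define S where "S = (\<lambda>n. \<Sum>k\<in>K n. (norm (c k))\<^sup>2)"
  define f where "f = (\<lambda>n z. \<Sum>k\<in>K n. c k * chi k z)"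
  have fin: "finite (K n)" for n by (simp add: K_def)
  have K_mono: "K m \<subseteq> K n" if "m \<le> n" for m n using that by (auto simp: K_def)
  have S_mono: "S m \<le> S n" if "m \<le> n" for m n
    unfolding S_def by (rule sum_mono2) (use fin K_mono that in auto)
  have "norm (S n) \<le> B" for n
    using bound[of n] unfolding S_def K_def by (simp add: sum_nonneg)
  then have "convergent S"
    using S_mono by (intro Bseq_mono_convergent BseqI'[of _ B]) blast+
  then have "Cauchy S" by (rule convergent_Cauchy)
  then have "\<exists>M. \<forall>m\<ge>M. \<forall>n\<ge>M. norm (S m - S n) < (1 / 4) ^ j" for j :: nat
    by (rule CauchyD) simp
  then obtain M where M: "\<And>j m n. m \<ge> M j \<Longrightarrow> n \<ge> M j \<Longrightarrow> norm (S m - S n) < (1 / 4) ^ j"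
    by metis
  \<comment> \<open>A monotone and unbounded sequence that dominates \<open>M\<close>.\<close>
  define N where "N = (\<lambda>j::nat. j + (\<Sum>i\<le>j. M i))"
  have N_ge: "M j \<le> N j" "j \<le> N j" for j
    using member_le_sum[of j "{..j}" M] by (auto simp: N_def)
  have N_Suc: "N j \<le> N (Suc j)" for j by (simp add: N_def)
  have N_mono: "N i \<le> N j" if "i \<le> j" for i j
    by (rule lift_Suc_mono_le[of N, OF N_Suc that])
  have f_cont: "continuous_on (sphere 0 1) (f n)" for n
    unfolding f_def by (intro continuous_intros continuous_on_chi)
  have f_int: "integrable circle (f n)" for n
    by (rule integrable_circle_continuous[OF f_cont])
  define d where "d = (\<lambda>j z. f (N (Suc j)) z - f (N j) z)"
  have d_cont: "continuous_on (sphere 0 1) (d j)" for j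
    unfolding d_def by (intro continuous_intros f_cont)
  have d_int: "integrable circle (d j)" for j
    by (rule integrable_circle_continuous[OF d_cont])
  have d_norm: "(LINT z|circle. norm (d j z)) \<le> (1 / 2) ^ j" for j
  proof -
    define K' where "K' = K (N (Suc j)) - K (N j)"
    have sub: "K (N j) \<subseteq> K (N (Suc j))" by (rule K_mono[OF N_Suc])
    have "(LINT z|circle. (norm (d j z))\<^sup>2) = (LINT z|circle. (norm (\<Sum>k\<in>K'. c k * chi k z))\<^sup>2)"
      by (simp add: d_def f_def K'_def sum_diff[OF fin sub])
    also have "\<dots> = (\<Sum>k\<in>K'. (norm (c k))\<^sup>2)"
      by (rule integral_norm_trig_square) (simp add: K'_def fin)
    also have "\<dots> = S (N (Suc j)) - S (N j)"
      by (simp add: K'_def S_def sum_diff[OF fin sub])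
    also have "\<dots> \<le> (1 / 4) ^ j"
      using M[of j "N (Suc j)" "N j"] N_ge[of j] N_Suc[of j] by simp
    finally have "sqrt (LINT z|circle. (norm (d j z))\<^sup>2) \<le> sqrt ((1 / 4) ^ j)"
      by (rule real_sqrt_le_mono)
    also have "\<dots> = (1 / 2) ^ j"
      by (simp add: real_sqrt_power real_sqrt_divide)
    finally show ?thesis
      using integral_norm_le_L2[OF d_cont[of j]] by linarith
  qed
  have d_summable: "summable (\<lambda>j. LINT z|circle. norm (d j z))"
    by (rule summable_comparison_test'[where g = "\<lambda>j. (1 / 2) ^ j" and N = 0])
       (use d_norm in \<open>auto simp: integral_nonneg_AE summable_geometric\<close>)
  have AE_d: "AE z in circle. summable (\<lambda>j. norm (d j z))"
    by (rule AE_summable_norm[OF d_int d_summable])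
  define \<beta> where "\<beta> = (\<lambda>z. f (N 0) z + (\<Sum>j. d j z))"
  have sum_int: "integrable circle (\<lambda>z. \<Sum>j. d j z)"
    by (rule integrable_suminf[OF d_int AE_d d_summable])
  show ?thesis
  proof
    show "integrable circle \<beta>" unfolding \<beta>_def by (intro Bochner_Integration.integrable_add f_int sum_int)
    fix k :: int
    define a where "a = (\<lambda>j. fourier (f (N j)) k)"
    have ck: "continuous_on (sphere 0 1) (\<lambda>z. cnj (chi k z))"
      by (intro continuous_intros continuous_on_chi)
    have nk: "norm (cnj (chi k z)) = 1" if "norm z = 1" for z
      using norm_chi_on_circle[OF that] by simp
    have fk: "fourier (f n) k = (if k \<in> K n then c k else 0)" for n
    proof -
      have "fourier (f n) k = (\<Sum>i\<in>K n. c i * pairing (chi i) (chi k))"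
        unfolding f_def pairing_def sum_distrib_right mult.assoc
        by (subst Bochner_Integration.integral_sum)
           (auto intro!: integrable_circle_continuous continuous_intros continuous_on_chi)
      then show ?thesis
        using fin by (simp add: pairing_chi_chi if_distrib[of "\<lambda>x. _ * x"] sum.delta' cong: if_cong)
    qed
    have "a \<longlonglongrightarrow> c k"
    proof (rule tendsto_eventually)
      have "k \<in> K (N j)" if "j \<ge> nat \<bar>k\<bar>" for j
        using N_ge(2)[of j] that by (auto simp: K_def)
      then show "eventually (\<lambda>j. a j = c k) sequentially"
        unfolding a_def fk eventually_sequentially by auto
    qed
    then have tel: "(\<lambda>j. a (Suc j) - a j) sums (c k - a 0)"
      by (rule telescope_sums)
    have dk: "(LINT z|circle. d j z * cnj (chi k z)) = a (Suc j) - a j" for j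
      unfolding d_def left_diff_distrib a_def pairing_def
      by (intro Bochner_Integration.integral_diff integrable_mult_continuous f_int ck)
    have norm_eq: "(LINT z|circle. norm (d j z * cnj (chi k z))) = (LINT z|circle. norm (d j z))" for j
      by (rule integral_circle_cong) (simp add: norm_mult norm_chi_on_circle)
    have s1: "integrable circle (\<lambda>z. d j z * cnj (chi k z))" for j
      by (intro integrable_mult_continuous d_int ck)
    have s2: "AE z in circle. summable (\<lambda>j. norm (d j z * cnj (chi k z)))"
      using AE_d AE_space by eventually_elim (simp add: norm_mult norm_chi_on_circle)
    have s3: "summable (\<lambda>j. LINT z|circle. norm (d j z * cnj (chi k z)))"
      unfolding norm_eq by (rule d_summable)
    have "(LINT z|circle. (\<Sum>j. d j z) * cnj (chi k z))
        = (LINT z|circle. (\<Sum>j. d j z * cnj (chi k z)))"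
    proof (rule integral_cong_AE
        [OF borel_measurable_integrable[OF integrable_mult_continuous[OF sum_int ck]]
            borel_measurable_integrable[OF integrable_suminf[OF s1 s2 s3]]])
      show "AE z in circle. (\<Sum>j. d j z) * cnj (chi k z) = (\<Sum>j. d j z * cnj (chi k z))"
        using AE_d
      proof eventually_elim
        case (elim z)
        then show ?case by (rule suminf_mult2[OF summable_norm_cancel])
      qed
    qed
    also have "\<dots> = (\<Sum>j. LINT z|circle. d j z * cnj (chi k z))"
      by (rule integral_suminf[OF s1 s2 s3])
    also have "\<dots> = c k - a 0"
      unfolding dk by (rule sums_unique[OF tel, symmetric])
    finally show "fourier \<beta> k = c k"
      unfolding \<beta>_def pairing_def distrib_right
      by (subst Bochner_Integration.integral_add)
         (auto intro!: integrable_mult_continuous f_int sum_int ck simp: a_def pairing_def)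
  qed
qed

section \<open>Density of trigonometric polynomials\<close>

text \<open>Powers of \<open>z\<close> with negative exponents multiply as expected only away from 0.
  Imposing the identity on the circle alone makes the class closed under sums and products.\<close>

definition trig_poly :: "(complex \<Rightarrow> complex) \<Rightarrow> bool" where
  "trig_poly t \<longleftrightarrow> (\<exists>N f. \<forall>z. norm z = 1 \<longrightarrow> t z = chi (- int N) z * poly f z)"

lemma trig_poly_const: "trig_poly (\<lambda>_. c)"
  unfolding trig_poly_def by (intro exI[of _ 0] exI[of _ "[:c:]"]) (simp add: chi_def)

lemma trig_poly_add:
  assumes "trig_poly s" "trig_poly t"
  shows "trig_poly (\<lambda>z. s z + t z)"
proof -
  obtain M f where s: "\<And>z. norm z = 1 \<Longrightarrow> s z = chi (- int M) z * poly f z"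
    using assms(1) unfolding trig_poly_def by blast
  obtain N g where t: "\<And>z. norm z = 1 \<Longrightarrow> t z = chi (- int N) z * poly g z"
    using assms(2) unfolding trig_poly_def by blast
  have "s z + t z = chi (- int (M + N)) z * poly (monom 1 N * f + monom 1 M * g) z"
    if z: "norm z = 1" for z
  proof -
    have e: "chi (- int (M + N)) z * z ^ N = chi (- int M) z"
      "chi (- int (M + N)) z * z ^ M = chi (- int N) z"
      unfolding chi_of_nat[symmetric] chi_mult_on_circle[OF z] by simp_all
    show ?thesis
      by (simp add: s[OF z] t[OF z] poly_monom distrib_left e mult.assoc[symmetric] del: of_nat_add)
  qed
  then show ?thesis unfolding trig_poly_def by blast
qed

lemma trig_poly_mult:
  assumes "trig_poly s" "trig_poly t"
  shows "trig_poly (\<lambda>z. s z * t z)"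
proof -
  obtain M f where s: "\<And>z. norm z = 1 \<Longrightarrow> s z = chi (- int M) z * poly f z"
    using assms(1) unfolding trig_poly_def by blast
  obtain N g where t: "\<And>z. norm z = 1 \<Longrightarrow> t z = chi (- int N) z * poly g z"
    using assms(2) unfolding trig_poly_def by blast
  have "s z * t z = chi (- int (M + N)) z * poly (f * g) z" if z: "norm z = 1" for z
  proof -
    have e: "chi (- int (M + N)) z = chi (- int M) z * chi (- int N) z"
      unfolding chi_mult_on_circle[OF z] by simp
    show ?thesis unfolding e by (simp add: s[OF z] t[OF z])
  qed
  then show ?thesis unfolding trig_poly_def by blast
qed

lemma trig_poly_continuous:
  assumes "trig_poly t" shows "continuous_on (sphere 0 1) t"
proof -
  obtain N f where t: "\<And>z. norm z = 1 \<Longrightarrow> t z = chi (- int N) z * poly f z"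
    using assms unfolding trig_poly_def by blast
  have "continuous_on (sphere 0 1) (\<lambda>z. chi (- int N) z * poly f z)"
    by (intro continuous_intros continuous_on_chi)
  then show ?thesis
    by (rule continuous_on_eq) (simp add: t)
qed

lemma trig_poly_approx:
  fixes \<phi> :: "complex \<Rightarrow> real"
  assumes "continuous_on (sphere 0 1) \<phi>" "e > 0"
  shows "\<exists>t. trig_poly t \<and> (\<forall>z. norm z = 1 \<longrightarrow> norm (complex_of_real (\<phi> z) - t z) < e)"
proof -
  have inv: "chi (- 1) z * z = 1" if "norm z = 1" for z
    using chi_mult_on_circle[OF that, of "-1" 1] by (simp add: chi_def)
  have Re_Im: "cnj z = chi (-1) z" if "norm z = 1" for z
    using cnj_chi_on_circle[OF that, of 1] by (simp add: chi_def)
  have Re: "trig_poly (\<lambda>z. complex_of_real (Re z))"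
    unfolding trig_poly_def
  proof (intro exI allI impI)
    fix z :: complex assume z: "norm z = 1"
    have "complex_of_real (Re z) = (z + cnj z) / 2" by (simp add: complex_eq_iff)
    also have "\<dots> = chi (- int 1) z * poly [:1/2, 0, 1/2:] z"
      using inv[OF z] by (simp add: Re_Im[OF z] algebra_simps)
    finally show "complex_of_real (Re z) = chi (- int 1) z * poly [:1/2, 0, 1/2:] z" .
  qed
  have Im: "trig_poly (\<lambda>z. complex_of_real (Im z))"
    unfolding trig_poly_def
  proof (intro exI allI impI)
    fix z :: complex assume z: "norm z = 1"
    have "complex_of_real (Im z) = (z - cnj z) * (- \<i> / 2)" by (simp add: complex_eq_iff)
    also have "\<dots> = chi (- int 1) z * poly [:\<i>/2, 0, - \<i>/2:] z"
      using inv[OF z] by (simp add: Re_Im[OF z] algebra_simps)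
    finally show "complex_of_real (Im z) = chi (- int 1) z * poly [:\<i>/2, 0, - \<i>/2:] z" .
  qed
  have "\<exists>g. trig_poly (\<lambda>z. complex_of_real (g z)) \<and> (\<forall>z\<in>sphere 0 1. \<bar>\<phi> z - g z\<bar> < e)"
  proof (rule Stone_Weierstrass_HOL[where P = "\<lambda>g. trig_poly (\<lambda>z. complex_of_real (g z))"])
    show "continuous_on (sphere 0 1) f" if "trig_poly (\<lambda>z. complex_of_real (f z))" for f
      using continuous_on_Re[OF trig_poly_continuous[OF that]] by simp
    show "\<exists>f. trig_poly (\<lambda>z. complex_of_real (f z)) \<and> f x \<noteq> f y"
      if "x \<in> sphere 0 1 \<and> y \<in> sphere 0 1 \<and> x \<noteq> y" for x y
      using that Re Im by (metis complex_eq_iff)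
  qed (use assms trig_poly_const trig_poly_add trig_poly_mult in auto)
  then obtain g where "trig_poly (\<lambda>z. complex_of_real (g z))" "\<forall>z\<in>sphere 0 1. \<bar>\<phi> z - g z\<bar> < e"
    by blast
  then show ?thesis
    by (intro exI[of _ "\<lambda>z. complex_of_real (g z)"])
       (auto simp: norm_of_real simp flip: of_real_diff)
qed

lemma trig_poly_tendsto_indicator:
  assumes K: "compact K"
  obtains t where "\<And>n. trig_poly (t n)" "\<And>n z. norm z = 1 \<Longrightarrow> norm (t n z) \<le> 2"
    "\<And>z. norm z = 1 \<Longrightarrow> (\<lambda>n. t n z) \<longlonglongrightarrow> indicator K z"
proof -
  define \<phi> :: "nat \<Rightarrow> complex \<Rightarrow> real" where
    "\<phi> = (\<lambda>n z. if K = {} then 0 else max 0 (1 - real n * infdist z K))"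
  have "continuous_on (sphere 0 1) (\<phi> n)" for n
    unfolding \<phi>_def by (cases "K = {}") (auto intro!: continuous_intros)
  then have "\<forall>n. \<exists>t. trig_poly t \<and>
      (\<forall>z. norm z = 1 \<longrightarrow> norm (complex_of_real (\<phi> n z) - t z) < 1 / real (Suc n))"
    by (intro allI trig_poly_approx) auto
  then obtain t where t: "\<And>n. trig_poly (t n)"
    "\<And>n z. norm z = 1 \<Longrightarrow> norm (complex_of_real (\<phi> n z) - t n z) < 1 / real (Suc n)"
    by metis
  have \<phi>01: "0 \<le> \<phi> n z" "\<phi> n z \<le> 1" for n z
    by (auto simp: \<phi>_def infdist_nonneg)
  have \<phi>_lim: "(\<lambda>n. \<phi> n z) \<longlonglongrightarrow> indicator K z" for z
  proof (cases "z \<in> K")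
    case True
    then have "\<phi> n z = 1" for n by (auto simp: \<phi>_def)
    with True show ?thesis by simp
  next
    case False
    show ?thesis
    proof (cases "K = {}")
      case nonempty: False
      then have pos: "infdist z K > 0"
        using False infdist_pos_not_in_closed[of K z] compact_imp_closed[OF K] by simp
      obtain n0 :: nat where n0: "real n0 * infdist z K > 1"
        using reals_Archimedean3[OF pos] by blast
      have "\<phi> n z = 0" if "n \<ge> n0" for n
      proof -
        have "real n0 * infdist z K \<le> real n * infdist z K"
          using that pos by (intro mult_right_mono) auto
        then show ?thesis using n0 nonempty by (simp add: \<phi>_def)
      qed
      then have "eventually (\<lambda>n. \<phi> n z = 0) sequentially"
        unfolding eventually_sequentially by blast
      then show ?thesis using False by (simp add: tendsto_eventually)
    qed (simp add: \<phi>_def)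
  qed
  show ?thesis
  proof
    show "trig_poly (t n)" for n by (rule t)
    fix z :: complex assume z: "norm z = 1"
    show "norm (t n z) \<le> 2" for n
    proof -
      have "norm (t n z) \<le> norm (complex_of_real (\<phi> n z)) + norm (complex_of_real (\<phi> n z) - t n z)"
        by (metis norm_minus_commute norm_triangle_sub)
      moreover have "norm (complex_of_real (\<phi> n z) - t n z) < 1"
        by (rule order.strict_trans2[OF t(2)[OF z]]) simp
      ultimately show ?thesis using \<phi>01[of n z] by simp
    qed
    have inv: "(\<lambda>n. 1 / real (Suc n)) \<longlonglongrightarrow> 0"
      using LIMSEQ_inverse_real_of_nat by (simp only: inverse_eq_divide)
    have lim0: "(\<lambda>n. complex_of_real (\<phi> n z) - t n z) \<longlonglongrightarrow> 0"
      by (rule Lim_null_comparison[OF _ inv]) (use t(2)[OF z] in \<open>auto intro: always_eventually less_imp_le\<close>)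
    have ind: "complex_of_real (indicator K z) = indicator K z"
      by (simp add: indicator_def)
    show "(\<lambda>n. t n z) \<longlonglongrightarrow> indicator K z"
      using tendsto_diff[OF tendsto_of_real[OF \<phi>_lim[of z]] lim0] by (simp add: ind)
  qed
qed

lemma sets_circle_borel: "A \<in> sets circle \<longleftrightarrow> A \<subseteq> sphere 0 1 \<and> A \<in> sets borel"
  unfolding sets_circle by (rule sets_restrict_space_iff) simp

text \<open>Inner regularity, in the form of compact sets increasing to \<open>E\<close> up to a null
  set.\<close>

lemma compact_inner_sequence:
  assumes E: "E \<in> sets circle"
  obtains U where "\<And>n. compact (U n)" "\<And>n. U n \<subseteq> E"
    "AE z in circle. (\<lambda>n. indicator (U n) z :: real) \<longlonglongrightarrow> indicator E z"
proof -
  interpret prob_space circle by (rule prob_space_circle)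
  have E': "E \<subseteq> sphere 0 1" "E \<in> sets borel" using E by (auto simp: sets_circle_borel)
  define M where "M = distr circle borel (\<lambda>z. z)"
  have id: "(\<lambda>z. z) \<in> measurable circle borel"
    by (rule borel_measurable_circle_continuous[OF continuous_on_id])
  have em: "emeasure M A = emeasure circle A" if "A \<subseteq> sphere 0 1" "A \<in> sets borel" for A
    using that id unfolding M_def by (subst emeasure_distr) (auto intro!: arg_cong[where f = "emeasure circle"])
  have "\<exists>K. K \<subseteq> E \<and> compact K \<and> measure circle (E - K) < 1 / real (Suc n)" for n
  proof -
    have fin: "emeasure M (space M) \<noteq> \<infinity>"
      unfolding M_def using emeasure_space_1 by (simp add: emeasure_distr id)
    have "emeasure M E = (SUP K \<in> {K. K \<subseteq> E \<and> compact K}. emeasure M K)"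
      by (rule inner_regular[OF _ fin E'(2)]) (simp add: M_def)
    moreover have "emeasure M E \<noteq> \<infinity>" by (simp add: em[OF E'])
    moreover have "{} \<in> {K. K \<subseteq> E \<and> compact K}" by simp
    then have "{K. K \<subseteq> E \<and> compact K} \<noteq> {}" by (metis empty_iff)
    ultimately have "\<exists>K\<in>{K. K \<subseteq> E \<and> compact K}. emeasure M E < emeasure M K + ennreal (1 / real (Suc n))"
      by (intro SUP_approx_ennreal) simp_all
    then obtain K where K: "K \<subseteq> E" "compact K" "emeasure M E < emeasure M K + ennreal (1 / real (Suc n))"
      by auto
    have K': "K \<subseteq> sphere 0 1" "K \<in> sets borel"
      using K E' by (auto intro: borel_compact)
    then have Kc: "K \<in> sets circle" by (simp add: sets_circle_borel)
    have "ennreal (measure circle E) < ennreal (measure circle K) + ennreal (1 / real (Suc n))"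
      using K(3) unfolding em[OF E'] em[OF K'] by (simp add: emeasure_eq_measure)
    also have "\<dots> = ennreal (measure circle K + 1 / real (Suc n))"
      by (rule ennreal_plus[symmetric]) auto
    finally have "measure circle E < measure circle K + 1 / real (Suc n)"
      by (simp add: ennreal_less_iff del: ennreal_plus)
    then have "measure circle (E - K) < 1 / real (Suc n)"
      using finite_measure_Diff[OF E Kc K(1)] by simp
    with K show ?thesis by blast
  qed
  then obtain K where K: "\<And>n. K n \<subseteq> E" "\<And>n. compact (K n)"
    "\<And>n. measure circle (E - K n) < 1 / real (Suc n)"
    by metis
  have Kc: "K n \<in> sets circle" for n
    using K(1,2)[of n] E' by (auto simp: sets_circle_borel intro: borel_compact)
  \<comment> \<open>Unions make the sequence increasing; without this it need not converge almost everywhere.\<close>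
  define U where "U = (\<lambda>n. \<Union>i\<le>n. K i)"
  have R: "E - (\<Union>i. K i) \<in> sets circle" using E Kc by auto
  have "measure circle (E - (\<Union>i. K i)) \<le> 1 / real (Suc n)" for n
  proof -
    have "measure circle (E - (\<Union>i. K i)) \<le> measure circle (E - K n)"
      by (rule finite_measure_mono) (use E Kc in auto)
    then show ?thesis using K(3)[of n] by linarith
  qed
  then have "\<exists>N. \<forall>n\<ge>N. measure circle (E - (\<Union>i. K i)) \<le> 1 / real (Suc n)"
    by blast
  moreover have "(\<lambda>n. 1 / real (Suc n)) \<longlonglongrightarrow> 0"
    using LIMSEQ_inverse_real_of_nat by (simp only: inverse_eq_divide)
  ultimately have "measure circle (E - (\<Union>i. K i)) \<le> 0"
    by (intro LIMSEQ_le_const[where X = "\<lambda>n. 1 / real (Suc n)"])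
  then have "measure circle (E - (\<Union>i. K i)) = 0"
    using measure_nonneg[of circle "E - (\<Union>i. K i)"] by linarith
  then have "E - (\<Union>i. K i) \<in> null_sets circle"
    using R by (simp add: null_setsI emeasure_eq_measure)
  then have AE: "AE z in circle. z \<notin> E - (\<Union>i. K i)" by (rule AE_not_in)
  show ?thesis
  proof
    show "compact (U n)" for n unfolding U_def by (intro compact_UN) (auto simp: K)
    show "U n \<subseteq> E" for n using K(1) by (auto simp: U_def)
    show "AE z in circle. (\<lambda>n. indicator (U n) z :: real) \<longlonglongrightarrow> indicator E z"
      using AE
    proof eventually_elim
      case (elim z)
      show ?case
      proof (cases "z \<in> E")
        case True
        then obtain i where i: "z \<in> K i" using elim by auto
        then have "z \<in> U n" if "n \<ge> i" for n using that by (auto simp: U_def)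
        then have "\<forall>n\<ge>i. (indicator (U n) z :: real) = indicator E z"
          using True by simp
        then show ?thesis
          by (intro tendsto_eventually) (auto simp: eventually_sequentially)
      next
        case False
        then have "z \<notin> U n" for n using K(1) by (auto simp: U_def)
        then show ?thesis using False by simp
      qed
    qed
  qed
qed

lemma powr_add_le:
  fixes x y r :: real
  assumes "0 \<le> x" "0 \<le> y" "0 < r"
  shows "(x + y) powr r \<le> 2 powr r * (x powr r + y powr r)"
proof -
  have "(x + y) powr r \<le> (2 * max x y) powr r"
    using assms by (intro powr_mono2) auto
  also have "\<dots> = 2 powr r * max x y powr r"
    using assms by (simp add: powr_mult)
  also have "max x y powr r \<le> x powr r + y powr r"
    by (simp add: max_def)
  finally show ?thesis by simp
qed

lemma Lp_add:
  assumes r: "0 < r" and F: "F \<in> Lp r" and G: "G \<in> Lp r"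
  shows "(\<lambda>z. F z + G z) \<in> Lp r"
    and "(LINT z|circle. norm (F z + G z) powr r)
      \<le> 2 powr r * ((LINT z|circle. norm (F z) powr r) + (LINT z|circle. norm (G z) powr r))"
proof -
  have [measurable]: "F \<in> borel_measurable circle" "G \<in> borel_measurable circle"
    and int: "integrable circle (\<lambda>z. norm (F z) powr r)" "integrable circle (\<lambda>z. norm (G z) powr r)"
    using F G by (auto simp: Lp_def)
  have le: "norm (F z + G z) powr r \<le> 2 powr r * (norm (F z) powr r + norm (G z) powr r)" for z
  proof -
    have "norm (F z + G z) powr r \<le> (norm (F z) + norm (G z)) powr r"
      using r by (intro powr_mono2 norm_triangle_ineq) auto
    also have "\<dots> \<le> 2 powr r * (norm (F z) powr r + norm (G z) powr r)"
      by (rule powr_add_le) (use r in auto)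
    finally show ?thesis .
  qed
  have I: "integrable circle (\<lambda>z. norm (F z + G z) powr r)"
    by (rule Bochner_Integration.integrable_bound
        [where f = "\<lambda>z. 2 powr r * (norm (F z) powr r + norm (G z) powr r)"])
       (use int le in auto)
  then show "(\<lambda>z. F z + G z) \<in> Lp r" by (simp add: Lp_def)
  have "(LINT z|circle. norm (F z + G z) powr r)
      \<le> (LINT z|circle. 2 powr r * (norm (F z) powr r + norm (G z) powr r))"
    by (rule integral_mono[OF I]) (use int le in auto)
  then show "(LINT z|circle. norm (F z + G z) powr r)
      \<le> 2 powr r * ((LINT z|circle. norm (F z) powr r) + (LINT z|circle. norm (G z) powr r))"
    using int by simp
qed

lemma Lp_scale:
  assumes "F \<in> Lp r" shows "(\<lambda>z. c * F z) \<in> Lp r"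
  using assms by (auto simp: Lp_def norm_mult powr_mult)

lemma bounded_in_Lp:
  assumes "F \<in> borel_measurable circle" "AE z in circle. norm (F z) \<le> C" "0 < r"
  shows "F \<in> Lp r"
proof -
  have "AE z in circle. norm (norm (F z) powr r) \<le> C powr r"
    using assms(2) by eventually_elim (use assms(3) in \<open>simp add: powr_mono2\<close>)
  then have "integrable circle (\<lambda>z. norm (F z) powr r)"
    by (intro integrable_circle_bounded) (use assms(1) in measurable)
  then show ?thesis using assms(1) by (simp add: Lp_def)
qed

lemma Lp_diff:
  assumes "0 < r" "F \<in> Lp r" "G \<in> Lp r"
  shows "(\<lambda>z. F z - G z) \<in> Lp r"
  using Lp_add(1)[OF assms(1,2) Lp_scale[OF assms(3), of "-1"]] by simp

text \<open>Closure of the trigonometric polynomials in \<open>Lp r\<close>.\<close>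

definition trig_approximable :: "real \<Rightarrow> (complex \<Rightarrow> complex) \<Rightarrow> bool" where
  "trig_approximable r F \<longleftrightarrow> F \<in> Lp r \<and>
     (\<forall>e>0. \<exists>t. trig_poly t \<and> (LINT z|circle. norm (F z - t z) powr r) < e)"

lemma trig_poly_Lp: "trig_poly t \<Longrightarrow> 0 < r \<Longrightarrow> t \<in> Lp r"
  by (intro continuous_in_Lp trig_poly_continuous)

lemma trig_approximable_closed:
  assumes r: "0 < r" and F: "F \<in> Lp r"
    and G: "\<And>n. trig_approximable r (G n)"
    and lim: "(\<lambda>n. LINT z|circle. norm (F z - G n z) powr r) \<longlonglongrightarrow> 0"
  shows "trig_approximable r F"
  unfolding trig_approximable_def
proof (intro conjI allI impI F)
  fix e :: real assume e: "e > 0"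
  define d where "d = e / (2 * 2 powr r)"
  have d: "d > 0" using e by (simp add: d_def)
  obtain n where n: "(LINT z|circle. norm (F z - G n z) powr r) < d"
    using order_tendstoD(2)[OF lim d] by (auto simp: eventually_sequentially)
  obtain t where t: "trig_poly t" "(LINT z|circle. norm (G n z - t z) powr r) < d"
    using G d unfolding trig_approximable_def by blast
  have Gn: "G n \<in> Lp r" using G by (simp add: trig_approximable_def)
  have "(LINT z|circle. norm (F z - t z) powr r)
      = (LINT z|circle. norm ((F z - G n z) + (G n z - t z)) powr r)" by simp
  also have "\<dots> \<le> 2 powr r * ((LINT z|circle. norm (F z - G n z) powr r)
      + (LINT z|circle. norm (G n z - t z) powr r))"
    by (intro Lp_add r Lp_diff F Gn trig_poly_Lp t)
  also have "\<dots> < 2 powr r * (d + d)"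
    using n t by (intro mult_strict_left_mono) auto
  also have "\<dots> = e" by (simp add: d_def)
  finally show "\<exists>t. trig_poly t \<and> (LINT z|circle. norm (F z - t z) powr r) < e"
    using t(1) by blast
qed

lemma trig_approximable_trig_poly:
  assumes "trig_poly t" "0 < r" shows "trig_approximable r t"
  unfolding trig_approximable_def using assms by (auto intro!: trig_poly_Lp exI[of _ t])

lemma trig_approximable_add:
  assumes r: "0 < r" and F: "trig_approximable r F" and G: "trig_approximable r G"
  shows "trig_approximable r (\<lambda>z. F z + G z)"
  unfolding trig_approximable_def
proof (intro conjI allI impI)
  have FG: "F \<in> Lp r" "G \<in> Lp r" using F G by (auto simp: trig_approximable_def)
  show "(\<lambda>z. F z + G z) \<in> Lp r" by (rule Lp_add(1)[OF r FG])
  fix e :: real assume e: "e > 0"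
  define d where "d = e / (2 * 2 powr r)"
  have d: "d > 0" using e by (simp add: d_def)
  obtain s where s: "trig_poly s" "(LINT z|circle. norm (F z - s z) powr r) < d"
    using F d unfolding trig_approximable_def by blast
  obtain t where t: "trig_poly t" "(LINT z|circle. norm (G z - t z) powr r) < d"
    using G d unfolding trig_approximable_def by blast
  have "(LINT z|circle. norm (F z + G z - (s z + t z)) powr r)
      = (LINT z|circle. norm ((F z - s z) + (G z - t z)) powr r)" by (simp add: algebra_simps)
  also have "\<dots> \<le> 2 powr r * ((LINT z|circle. norm (F z - s z) powr r)
      + (LINT z|circle. norm (G z - t z) powr r))"
    by (intro Lp_add r Lp_diff FG trig_poly_Lp s t)
  also have "\<dots> < 2 powr r * (d + d)"
    using s t by (intro mult_strict_left_mono) auto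
  also have "\<dots> = e" by (simp add: d_def)
  finally show "\<exists>t. trig_poly t \<and> (LINT z|circle. norm (F z + G z - t z) powr r) < e"
    using trig_poly_add[OF s(1) t(1)] by blast
qed

lemma Lp_dominated_convergence:
  fixes G :: "nat \<Rightarrow> complex \<Rightarrow> complex"
  assumes r: "0 < r" and F: "F \<in> borel_measurable circle"
    and G: "\<And>n. G n \<in> borel_measurable circle"
    and w: "integrable circle w" and bound: "\<And>n. AE z in circle. norm (F z - G n z) powr r \<le> w z"
    and lim: "AE z in circle. (\<lambda>n. G n z) \<longlonglongrightarrow> F z"
  shows "(\<lambda>n. LINT z|circle. norm (F z - G n z) powr r) \<longlonglongrightarrow> 0"
proof -
  have "(\<lambda>n. LINT z|circle. norm (F z - G n z) powr r) \<longlonglongrightarrow> (LINT z|circle. 0)"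
  proof (rule integral_dominated_convergence[OF _ _ w])
    show "AE z in circle. (\<lambda>n. norm (F z - G n z) powr r) \<longlonglongrightarrow> 0"
      using lim
    proof eventually_elim
      case (elim z)
      have "(\<lambda>n. norm (F z - G n z)) \<longlonglongrightarrow> 0"
        using tendsto_norm[OF tendsto_diff[OF tendsto_const[of "F z"] elim]] by simp
      then show ?case using r by (intro tendsto_zero_powrI[where b = r]) auto
    qed
  qed (use F G bound in auto)
  then show ?thesis by simp
qed

lemma trig_approximable_indicator:
  assumes r: "0 < r" and E: "E \<in> sets circle"
  shows "trig_approximable r (\<lambda>z. c * indicator E z)"
proof -
  have meas: "(\<lambda>z. c * indicator A z) \<in> borel_measurable circle" if "A \<in> sets circle" for A
    using that by measurable
  have Lp: "(\<lambda>z. c * indicator A z) \<in> Lp r" if "A \<in> sets circle" for A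
    by (rule bounded_in_Lp[OF meas[OF that] _ r, of "norm c"]) (auto simp: norm_mult indicator_def)
  have const: "integrable circle (\<lambda>_. x)" for x :: real
    by (rule integrable_circle_continuous_real) simp
  have compact: "trig_approximable r (\<lambda>z. c * indicator K z)" if K: "compact K" "K \<subseteq> sphere 0 1" for K
  proof -
    have Kc: "K \<in> sets circle" using K by (auto simp: sets_circle_borel intro: borel_compact)
    obtain t where t: "\<And>n. trig_poly (t n)" "\<And>n z. norm z = 1 \<Longrightarrow> norm (t n z) \<le> 2"
      "\<And>z. norm z = 1 \<Longrightarrow> (\<lambda>n. t n z) \<longlonglongrightarrow> indicator K z"
      by (rule trig_poly_tendsto_indicator[OF K(1)]) auto
    have tc: "trig_poly (\<lambda>z. c * t n z)" for n
      by (intro trig_poly_mult trig_poly_const t)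
    show ?thesis
    proof (rule trig_approximable_closed[OF r Lp[OF Kc] trig_approximable_trig_poly[OF tc r]])
      show "(\<lambda>n. LINT z|circle. norm (c * indicator K z - c * t n z) powr r) \<longlonglongrightarrow> 0"
      proof (rule Lp_dominated_convergence[OF r meas[OF Kc] _ const])
        show "(\<lambda>z. c * t n z) \<in> borel_measurable circle" for n
          by (intro borel_measurable_circle_continuous trig_poly_continuous tc)
        show "AE z in circle. norm (c * indicator K z - c * t n z) powr r \<le> (norm c * 3) powr r" for n
        proof (rule AE_I2)
          fix z assume "z \<in> space circle"
          then have "norm (indicator K z - t n z) \<le> 3"
            using t(2)[of z n] norm_triangle_ineq4[of "indicator K z" "t n z"]
            by (auto simp: indicator_def split: if_splits)
          then have "norm (c * indicator K z - c * t n z) \<le> norm c * 3"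
            by (simp add: norm_mult mult_left_mono flip: right_diff_distrib)
          then show "norm (c * indicator K z - c * t n z) powr r \<le> (norm c * 3) powr r"
            using r by (intro powr_mono2) auto
        qed
        show "AE z in circle. (\<lambda>n. c * t n z) \<longlonglongrightarrow> c * indicator K z"
          by (rule AE_I2) (auto intro!: tendsto_mult t)
      qed
    qed
  qed
  obtain U where U: "\<And>n. compact (U n)" "\<And>n. U n \<subseteq> E"
    "AE z in circle. (\<lambda>n. indicator (U n) z :: real) \<longlonglongrightarrow> indicator E z"
    by (rule compact_inner_sequence[OF E]) auto
  have Us: "U n \<subseteq> sphere 0 1" for n using U(2)[of n] E by (auto simp: sets_circle_borel)
  have Uc: "U n \<in> sets circle" for n
    using U(1)[of n] Us[of n] by (auto simp: sets_circle_borel intro: borel_compact)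
  show ?thesis
  proof (rule trig_approximable_closed[OF r Lp[OF E] compact[OF U(1) Us]])
    show "(\<lambda>n. LINT z|circle. norm (c * indicator E z - c * indicator (U n) z) powr r) \<longlonglongrightarrow> 0"
    proof (rule Lp_dominated_convergence[OF r meas[OF E] meas[OF Uc] const])
      show "AE z in circle. norm (c * indicator E z - c * indicator (U n) z) powr r \<le> norm c powr r" for n
        using r by (intro AE_I2 powr_mono2) (auto simp: indicator_def)
      show "AE z in circle. (\<lambda>n. c * indicator (U n) z) \<longlonglongrightarrow> c * indicator E z"
        using U(3)
      proof eventually_elim
        case (elim z)
        have "complex_of_real (indicator A z) = indicator A z" for A
          by (simp add: indicator_def)
        then show ?case
          using tendsto_mult[OF tendsto_const tendsto_of_real[OF elim], of c] by simp
      qed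
    qed
  qed
qed

theorem trig_poly_dense_Lp:
  assumes r: "0 < r" and F: "F \<in> Lp r"
  shows "trig_approximable r F"
proof -
  have Fm [measurable]: "F \<in> borel_measurable circle"
    and int: "integrable circle (\<lambda>z. norm (F z) powr r)"
    using F unfolding Lp_def by blast+
  obtain S where *: "(\<forall>i. simple_function circle (S i)) \<and>
      (\<forall>z\<in>space circle. (\<lambda>i. S i z) \<longlonglongrightarrow> F z) \<and>
      (\<forall>i. \<forall>z\<in>space circle. dist (S i z) 0 \<le> 2 * dist (F z) 0)"
    using borel_measurable_implies_sequence_metric[OF Fm, of 0] ..
  then have S: "\<And>i. simple_function circle (S i)"
    "\<And>z. z \<in> space circle \<Longrightarrow> (\<lambda>i. S i z) \<longlonglongrightarrow> F z"
    "\<And>i z. z \<in> space circle \<Longrightarrow> norm (S i z) \<le> 2 * norm (F z)"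
    by simp_all
  have Sm [measurable]: "S i \<in> borel_measurable circle" for i
    by (rule borel_measurable_simple_function[OF S(1)])
  have S_Lp: "S i \<in> Lp r" for i
    unfolding Lp_def
  proof (intro CollectI conjI Sm)
    show "integrable circle (\<lambda>z. norm (S i z) powr r)"
    proof (rule Bochner_Integration.integrable_bound)
      show "integrable circle (\<lambda>z. 2 powr r * norm (F z) powr r)" using int by simp
      show "AE z in circle. norm (norm (S i z) powr r) \<le> norm (2 powr r * norm (F z) powr r)"
      proof (rule AE_I2)
        fix z assume "z \<in> space circle"
        then have "norm (S i z) powr r \<le> (2 * norm (F z)) powr r"
          using S(3)[of z i] r by (intro powr_mono2) auto
        then show "norm (norm (S i z) powr r) \<le> norm (2 powr r * norm (F z) powr r)"
          by (simp add: powr_mult)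
      qed
    qed measurable
  qed
  have S_approx: "trig_approximable r (S i)" for i
  proof -
    have fin: "finite (S i ` space circle)" using S(1) by (simp add: simple_function_def)
    have "trig_approximable r (\<lambda>z. \<Sum>y\<in>Y. y * indicator (S i -` {y} \<inter> space circle) z)"
      if "finite Y" for Y
      using that
    proof (induction)
      case empty
      show ?case using trig_approximable_trig_poly[OF trig_poly_const[of 0] r] by simp
    next
      case (insert y Y)
      have "S i -` {y} \<inter> space circle \<in> sets circle" by measurable
      from trig_approximable_add[OF r trig_approximable_indicator[OF r this, of y] insert.IH]
      show ?case by (simp only: sum.insert[OF insert.hyps])
    qed
    from this[OF fin] have A: "trig_approximable r
        (\<lambda>z. \<Sum>y\<in>S i ` space circle. y * indicator (S i -` {y} \<inter> space circle) z)" .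
    show ?thesis
    proof (rule trig_approximable_closed[OF r S_Lp A])
      have "(LINT z|circle. norm (S i z - (\<Sum>y\<in>S i ` space circle.
          y * indicator (S i -` {y} \<inter> space circle) z)) powr r) = (LINT z|circle. 0)"
      proof (rule Bochner_Integration.integral_cong)
        fix z assume z: "z \<in> space circle"
        have "S i z = (\<Sum>y\<in>S i ` space circle. indicator (S i -` {y} \<inter> space circle) z *\<^sub>R y)"
          by (rule simple_function_indicator_representation_banach[OF S(1) z])
        also have "\<dots> = (\<Sum>y\<in>S i ` space circle. y * indicator (S i -` {y} \<inter> space circle) z)"
          by (intro sum.cong) (auto simp: indicator_def)
        finally have "S i z - (\<Sum>y\<in>S i ` space circle.
            y * indicator (S i -` {y} \<inter> space circle) z) = 0"
          by (simp only: right_minus_eq)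
        then show "norm (S i z - (\<Sum>y\<in>S i ` space circle.
            y * indicator (S i -` {y} \<inter> space circle) z)) powr r = 0"
          by (simp only: norm_zero powr_0)
      qed simp
      then show "(\<lambda>n::nat. LINT z|circle. norm (S i z - (\<Sum>y\<in>S i ` space circle.
          y * indicator (S i -` {y} \<inter> space circle) z)) powr r) \<longlonglongrightarrow> 0" by simp
    qed
  qed
  show ?thesis
  proof (rule trig_approximable_closed[OF r F S_approx Lp_dominated_convergence[OF r Fm Sm]])
    show "integrable circle (\<lambda>z. (3 * norm (F z)) powr r)"
      using int by (simp add: powr_mult)
    show "AE z in circle. norm (F z - S i z) powr r \<le> (3 * norm (F z)) powr r" for i
    proof (rule AE_I2)
      fix z assume "z \<in> space circle"
      then have "norm (F z - S i z) \<le> 3 * norm (F z)"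
        using S(3)[of z i] norm_triangle_ineq4[of "F z" "S i z"] by simp
      then show "norm (F z - S i z) powr r \<le> (3 * norm (F z)) powr r"
        using r by (intro powr_mono2) auto
    qed
    show "AE z in circle. (\<lambda>i. S i z) \<longlonglongrightarrow> F z"
      by (rule AE_I2) (rule S)
  qed
qed

section \<open>Consequences of density\<close>

lemma integral_poly: "(LINT z|circle. poly q z) = coeff q 0"
proof -
  have moments: "(LINT z|circle. 1 * z ^ k) = (if k = 0 then 1 else 0)" for k
    using integral_circle_power[of k 0] by simp
  have "(LINT z|circle. 1 * poly q z) = moment_functional (\<lambda>k. LINT z|circle. 1 * z ^ k) q"
    by (rule moment_functional_integral[symmetric]) (rule integrable_circle_continuous, simp)
  then show ?thesis
    unfolding moments
    by (simp add: moment_functional_def if_distrib[of "\<lambda>x. _ * x"] cong: if_cong)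
qed

text \<open>No frequency of \<open>t\<close> exceeds \<open>degree f\<close>, and none of \<open>z ^ n *
  g\<close> is below \<open>n\<close>.\<close>

lemma pairing_trig_poly_shift:
  assumes t: "\<And>z. norm z = 1 \<Longrightarrow> t z = chi (- int N) z * poly f z" and n: "n > degree f"
  shows "pairing t (poly (monom 1 n * g)) = 0"
proof -
  define r where "r = monom 1 (N + n - degree f) * circle_conj f * g"
  have "pairing t (poly (monom 1 n * g)) = (LINT z|circle. cnj (poly r z))"
    unfolding pairing_def
  proof (rule integral_circle_cong)
    fix z :: complex assume z: "norm z = 1"
    have "poly r z * z ^ degree f = z ^ (N + n - degree f) * z ^ degree f * (z ^ degree f * cnj (poly f z)) * poly g z"
      using z by (simp add: r_def poly_monom poly_circle_conj)
    also have "z ^ (N + n - degree f) * z ^ degree f = z ^ N * z ^ n"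
      using n by (simp flip: power_add)
    finally have "poly r z = z ^ N * (cnj (poly f z) * (z ^ n * poly g z))"
      using z by (auto simp: mult_ac)
    moreover have "cnj (z ^ N) = chi (- int N) z"
      using cnj_chi_on_circle[OF z, of "int N"] by (simp add: chi_of_nat)
    ultimately show "t z * cnj (poly (monom 1 n * g) z) = cnj (poly r z)"
      by (simp add: t[OF z] poly_monom)
  qed
  also have "\<dots> = cnj (LINT z|circle. poly r z)"
    by (rule Bochner_Integration.integral_cnj)
  also have "\<dots> = 0"
    using n by (simp only: integral_poly) (simp add: r_def coeff_mult coeff_monom)
  finally show ?thesis .
qed

text \<open>A function that is nearly a trigonometric polynomial in \<open>Lp p\<close> is nearly orthogonal
  to all multiples of a high power of \<open>z\<close>, uniformly on the unit ball of the dual norm.\<close>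

lemma pairing_shift_small:
  assumes pq: "1 < p" "1 < q" "1 / p + 1 / q = 1" and G: "G \<in> Lp p" and e: "e > 0"
  shows "\<exists>n0. \<forall>n\<ge>n0. \<forall>g. norm (pairing G (poly (monom 1 n * g))) \<le> e * Lp_norm q (poly g)"
proof -
  have p: "0 < p" using pq by simp
  have "trig_approximable p G" by (rule trig_poly_dense_Lp[OF p G])
  then obtain t where t: "trig_poly t" "(LINT z|circle. norm (G z - t z) powr p) < e powr p"
    using e unfolding trig_approximable_def by (metis powr_gt_zero less_irrefl)
  obtain N f where f: "\<And>z. norm z = 1 \<Longrightarrow> t z = chi (- int N) z * poly f z"
    using t(1) unfolding trig_poly_def by blast
  have Gt: "(\<lambda>z. G z - t z) \<in> Lp p" by (intro Lp_diff p G trig_poly_Lp t)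
  have small: "Lp_norm p (\<lambda>z. G z - t z) \<le> e"
  proof -
    have "Lp_norm p (\<lambda>z. G z - t z) \<le> (e powr p) powr (1 / p)"
      unfolding Lp_norm_def using t(2) p by (intro powr_mono2) (auto simp: integral_nonneg_AE)
    also have "\<dots> = e" using e p by (simp add: powr_powr)
    finally show ?thesis .
  qed
  show ?thesis
  proof (intro exI[of _ "Suc (degree f)"] allI impI)
    fix n and g :: "complex poly" assume n: "n \<ge> Suc (degree f)"
    let ?g = "poly (monom 1 n * g)"
    have g: "?g \<in> Lp q" using pq by (intro continuous_in_Lp continuous_intros) auto
    have c: "continuous_on (sphere 0 1) (\<lambda>z. cnj (?g z))" by (intro continuous_intros)
    have "pairing G ?g = (LINT z|circle. (G z - t z) * cnj (?g z) + t z * cnj (?g z))"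
      unfolding pairing_def by (simp add: algebra_simps)
    also have "\<dots> = pairing (\<lambda>z. G z - t z) ?g + pairing t ?g"
      unfolding pairing_def using pq(1)
      by (intro Bochner_Integration.integral_add integrable_mult_continuous c
          Lp_integrable[OF _ Gt] integrable_circle_continuous trig_poly_continuous t) auto
    also have "pairing t ?g = 0" by (rule pairing_trig_poly_shift[OF f]) (use n in auto)
    finally have "norm (pairing G ?g) \<le> Lp_norm p (\<lambda>z. G z - t z) * Lp_norm q ?g"
      using norm_pairing_le[OF pq Gt g] by (simp del: poly_mult)
    also have "Lp_norm q ?g = Lp_norm q (poly g)"
      by (rule Lp_norm_cong) (simp add: poly_monom norm_mult norm_power)
    also have "Lp_norm p (\<lambda>z. G z - t z) * Lp_norm q (poly g) \<le> e * Lp_norm q (poly g)"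
      using small by (intro mult_right_mono Lp_norm_nonneg)
    finally show "norm (pairing G ?g) \<le> e * Lp_norm q (poly g)" .
  qed
qed

lemma Riemann_Lebesgue:
  assumes F: "integrable circle F"
  shows "(\<lambda>n. fourier F (int n)) \<longlonglongrightarrow> 0"
proof (rule LIMSEQ_I)
  fix e :: real assume e: "e > 0"
  have "F \<in> Lp 1" using F by (auto simp: Lp_def borel_measurable_integrable intro: integrable_norm)
  then have "trig_approximable 1 F" by (intro trig_poly_dense_Lp) auto
  then obtain t where t: "trig_poly t" "(LINT z|circle. norm (F z - t z)) < e"
    using e unfolding trig_approximable_def by auto
  obtain N f where f: "\<And>z. norm z = 1 \<Longrightarrow> t z = chi (- int N) z * poly f z"
    using t(1) unfolding trig_poly_def by blast
  have ti: "integrable circle t" by (intro integrable_circle_continuous trig_poly_continuous t)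
  have "norm (fourier F (int n) - 0) < e" if n: "n \<ge> Suc (degree f)" for n
  proof -
    have c: "continuous_on (sphere 0 1) (\<lambda>z. cnj (chi (int n) z))"
      by (intro continuous_intros continuous_on_chi)
    have "pairing t (poly (monom 1 n * 1)) = 0"
      by (rule pairing_trig_poly_shift[OF f]) (use n in auto)
    then have t0: "pairing t (chi (int n)) = 0"
      by (simp add: pairing_def chi_of_nat poly_monom)
    have "fourier F (int n) = (LINT z|circle. (F z - t z) * cnj (chi (int n) z) + t z * cnj (chi (int n) z))"
      unfolding pairing_def by (simp add: algebra_simps)
    also have "\<dots> = pairing (\<lambda>z. F z - t z) (chi (int n)) + pairing t (chi (int n))"
      unfolding pairing_def
      by (intro Bochner_Integration.integral_add integrable_mult_continuous c F ti
          Bochner_Integration.integrable_diff)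
    finally have "norm (fourier F (int n)) = norm (pairing (\<lambda>z. F z - t z) (chi (int n)))"
      by (simp add: t0)
    also have "\<dots> \<le> (LINT z|circle. norm ((F z - t z) * cnj (chi (int n) z)))"
      unfolding pairing_def by (rule integral_norm_bound)
    also have "\<dots> = (LINT z|circle. norm (F z - t z))"
      by (rule integral_circle_cong) (simp add: norm_mult norm_chi_on_circle)
    finally show ?thesis using t(2) by simp
  qed
  then show "\<exists>n0. \<forall>n\<ge>n0. norm (fourier F (int n) - 0) < e" by blast
qed

text \<open>Squared moduli of polynomials approximate indicators of compact sets \<open>K\<close>, and in
  the limit the two norms multiply to \<open>measure K powr (1 / p + 1 / q) = measure K\<close>. So averages
  of \<open>a\<close> over arbitrary sets have modulus at most \<open>C\<close>.\<close>

lemma AE_norm_le_of_quadratic: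
  assumes pq: "1 < p" "1 < q" "1 / p + 1 / q = 1" and a: "integrable circle a"
    and bound: "\<And>f. norm (LINT z|circle. a z * complex_of_real ((norm (poly f z))\<^sup>2))
      \<le> C * (Lp_norm p (poly f) * Lp_norm q (poly f))"
  shows "AE z in circle. norm (a z) \<le> C"
proof -
  interpret prob_space circle by (rule prob_space_circle)
  have [measurable]: "a \<in> borel_measurable circle" using a by auto
  have compact: "norm (LINT z|circle. a z * indicator K z) \<le> C * measure circle K"
    if K: "compact K" "K \<subseteq> sphere 0 1" for K
  proof -
    have Kc [measurable]: "K \<in> sets circle"
      using K by (auto simp: sets_circle_borel intro: borel_compact)
    obtain t where t: "\<And>n. trig_poly (t n)" "\<And>n z. norm z = 1 \<Longrightarrow> norm (t n z) \<le> 2"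
      "\<And>z. norm z = 1 \<Longrightarrow> (\<lambda>n. t n z) \<longlonglongrightarrow> indicator K z"
      by (rule trig_poly_tendsto_indicator[OF K(1)]) auto
    have "\<exists>f. \<forall>z. norm z = 1 \<longrightarrow> norm (poly f z) = norm (t n z)" for n
      using t(1)[of n] unfolding trig_poly_def
      by (metis norm_mult norm_chi_on_circle mult.left_neutral)
    then obtain f where f: "\<And>n z. norm z = 1 \<Longrightarrow> norm (poly (f n) z) = norm (t n z)"
      by metis
    have f2: "norm (poly (f n) z) \<le> 2" if "norm z = 1" for n z
      using f[OF that] t(2)[OF that] by simp
    have f_lim: "(\<lambda>n. norm (poly (f n) z)) \<longlonglongrightarrow> indicator K z" if z: "norm z = 1" for z
    proof -
      have "norm (indicator K z :: complex) = indicator K z" by (simp add: indicator_def)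
      then show ?thesis using tendsto_norm[OF t(3)[OF z]] by (simp add: f[OF z])
    qed
    have L: "(\<lambda>n. Lp_norm r (poly (f n))) \<longlonglongrightarrow> measure circle K powr (1 / r)" if r: "r > 0" for r
    proof -
      have "(\<lambda>n. LINT z|circle. norm (poly (f n) z) powr r) \<longlonglongrightarrow> (LINT z|circle. indicator K z)"
      proof (rule integral_dominated_convergence)
        show "integrable circle (\<lambda>_. 2 powr r :: real)"
          by (rule integrable_circle_continuous_real) simp
        show "AE z in circle. (\<lambda>n. norm (poly (f n) z) powr r) \<longlonglongrightarrow> indicator K z"
        proof (rule AE_I2)
          fix z assume "z \<in> space circle"
          then have "(\<lambda>n. norm (poly (f n) z) powr r) \<longlonglongrightarrow> indicator K z powr r"
            using r by (intro tendsto_powr2 f_lim) auto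
          then show "(\<lambda>n. norm (poly (f n) z) powr r) \<longlonglongrightarrow> indicator K z"
            by (cases "z \<in> K") auto
        qed
        show "AE z in circle. norm (norm (poly (f n) z) powr r) \<le> 2 powr r" for n
          using f2 r by (intro AE_I2) (auto intro!: powr_mono2)
        show "(\<lambda>z. norm (poly (f n) z) powr r) \<in> borel_measurable circle" for n
          using r by (intro borel_measurable_circle_continuous_real continuous_on_powr' continuous_intros) auto
      qed measurable
      also have "(LINT z|circle. indicator K z) = measure circle K"
        using Kc K(2) by (simp add: Int_absorb2)
      finally show ?thesis
        unfolding Lp_norm_def using r by (intro tendsto_powr2) (auto simp: integral_nonneg_AE)
    qed
    have A: "(\<lambda>n. LINT z|circle. a z * complex_of_real ((norm (poly (f n) z))\<^sup>2))
        \<longlonglongrightarrow> (LINT z|circle. a z * indicator K z)"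
    proof (rule integral_dominated_convergence)
      show "integrable circle (\<lambda>z. 4 * norm (a z))" using a by simp
      show "AE z in circle. (\<lambda>n. a z * complex_of_real ((norm (poly (f n) z))\<^sup>2))
          \<longlonglongrightarrow> a z * indicator K z"
      proof (rule AE_I2)
        fix z assume "z \<in> space circle"
        then have "(\<lambda>n. a z * complex_of_real ((norm (poly (f n) z))\<^sup>2))
            \<longlonglongrightarrow> a z * complex_of_real ((indicator K z)\<^sup>2)"
          by (intro tendsto_intros f_lim) auto
        then show "(\<lambda>n. a z * complex_of_real ((norm (poly (f n) z))\<^sup>2)) \<longlonglongrightarrow> a z * indicator K z"
          by (cases "z \<in> K") auto
      qed
      show "AE z in circle. norm (a z * complex_of_real ((norm (poly (f n) z))\<^sup>2)) \<le> 4 * norm (a z)" for n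
      proof (rule AE_I2)
        fix z assume "z \<in> space circle"
        then have "(norm (poly (f n) z))\<^sup>2 \<le> 2\<^sup>2" using f2 by (intro power_mono) auto
        then show "norm (a z * complex_of_real ((norm (poly (f n) z))\<^sup>2)) \<le> 4 * norm (a z)"
          by (simp add: norm_mult norm_power mult.commute[of 4] mult_left_mono)
      qed
      show "(\<lambda>z. a z * complex_of_real ((norm (poly (f n) z))\<^sup>2)) \<in> borel_measurable circle" for n
        by (intro borel_measurable_times borel_measurable_circle_continuous[of "\<lambda>z. complex_of_real ((norm (poly (f n) z))\<^sup>2)"]
            continuous_intros) measurable
    qed measurable
    have "norm (LINT z|circle. a z * indicator K z)
        \<le> C * (measure circle K powr (1 / p) * measure circle K powr (1 / q))"
    proof (rule LIMSEQ_le[OF tendsto_norm[OF A] tendsto_mult[OF tendsto_const tendsto_mult[OF L L]]])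
      show "\<exists>N. \<forall>n\<ge>N. norm (LINT z|circle. a z * complex_of_real ((norm (poly (f n) z))\<^sup>2))
          \<le> C * (Lp_norm p (poly (f n)) * Lp_norm q (poly (f n)))"
        using bound by blast
    qed (use pq in auto)
    also have "measure circle K powr (1 / p) * measure circle K powr (1 / q) = measure circle K"
      using pq by (simp flip: powr_add)
    finally show ?thesis .
  qed
  have all: "norm (LINT z|circle. a z * indicator E z) \<le> C * measure circle E"
    if E [measurable]: "E \<in> sets circle" for E
  proof -
    obtain U where U: "\<And>n. compact (U n)" "\<And>n. U n \<subseteq> E"
      "AE z in circle. (\<lambda>n. indicator (U n) z :: real) \<longlonglongrightarrow> indicator E z"
      by (rule compact_inner_sequence[OF E]) auto
    have Us: "U n \<subseteq> sphere 0 1" for n using U(2)[of n] E by (auto simp: sets_circle_borel)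
    have Uc [measurable]: "U n \<in> sets circle" for n
      using U(1)[of n] Us[of n] by (auto simp: sets_circle_borel intro: borel_compact)
    have "(\<lambda>n. LINT z|circle. indicator (U n) z :: real) \<longlonglongrightarrow> (LINT z|circle. indicator E z)"
    proof (rule integral_dominated_convergence[OF _ _ _ U(3)])
      show "integrable circle (\<lambda>_. 1 :: real)" by simp
    qed auto
    then have m: "(\<lambda>n. measure circle (U n)) \<longlonglongrightarrow> measure circle E"
      using E Us by (simp add: Int_absorb2 sets_circle_borel)
    have A: "(\<lambda>n. LINT z|circle. a z * indicator (U n) z) \<longlonglongrightarrow> (LINT z|circle. a z * indicator E z)"
    proof (rule integral_dominated_convergence)
      show "integrable circle (\<lambda>z. norm (a z))" using a by simp
      show "AE z in circle. (\<lambda>n. a z * indicator (U n) z) \<longlonglongrightarrow> a z * indicator E z"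
        using U(3)
      proof eventually_elim
        case (elim z)
        have "complex_of_real (indicator A z) = indicator A z" for A
          by (simp add: indicator_def)
        then show ?case
          using tendsto_mult[OF tendsto_const tendsto_of_real[OF elim], of "a z"] by simp
      qed
      show "AE z in circle. norm (a z * indicator (U n) z) \<le> norm (a z)" for n
        by (rule AE_I2) (simp add: indicator_def)
    qed measurable
    show ?thesis
      by (rule LIMSEQ_le[OF tendsto_norm[OF A] tendsto_mult[OF tendsto_const m]])
         (use compact[OF U(1) Us] in blast)
  qed
  have "AE z in circle. a z \<in> cball 0 C"
  proof (rule averaging_theorem[OF a closed_cball])
    fix E assume E: "E \<in> sets circle" "measure circle E > 0"
    have "set_lebesgue_integral circle E a = (LINT z|circle. a z * indicator E z)"
      unfolding set_lebesgue_integral_def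
      by (rule Bochner_Integration.integral_cong) (auto simp: indicator_def)
    then have "norm (set_lebesgue_integral circle E a) \<le> C * measure circle E"
      using all[OF E(1)] by simp
    then show "(1 / measure circle E) *\<^sub>R set_lebesgue_integral circle E a \<in> cball 0 C"
      using E(2) by (simp add: field_simps)
  qed
  then show ?thesis by simp
qed

section \<open>Nehari's theorem for bounded moment functionals\<close>

lemma L1_norm_monom: "L1_norm (monom c m) = norm c"
proof -
  interpret prob_space circle by (rule prob_space_circle)
  have "L1_norm (monom c m) = (LINT z|circle. norm c)"
    by (rule integral_circle_cong) (simp add: poly_monom norm_mult norm_power)
  then show ?thesis using prob_space by simp
qed

lemma moment_functional_monom: "moment_functional h (monom c m) = c * h m"
proof -
  have "moment_functional h (monom c m) = (\<Sum>k<Suc m. coeff (monom c m) k * h k)"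
    by (rule moment_functional_eq_sum) auto
  also have "\<dots> = c * h m"
    by (simp add: sum.neutral)
  finally show ?thesis .
qed

lemma L1_bounded_norm_le:
  assumes "L1_bounded g C" shows "norm (g k) \<le> C"
proof -
  have "norm (moment_functional (\<lambda>i. g (int i - int (nat (- k)))) (monom 1 (nat k)))
      \<le> C * L1_norm (monom 1 (nat k))"
    using assms unfolding L1_bounded_def by blast
  then show ?thesis by (simp only: moment_functional_monom L1_norm_monom) (cases "0 \<le> k"; simp)
qed

lemma L1_bounded_nonneg: "L1_bounded g C \<Longrightarrow> 0 \<le> C"
  using L1_bounded_norm_le[of g C 0] norm_ge_zero order_trans by blast

text \<open>Testing against the polynomial whose coefficients are the conjugates of the \<open>g k\<close>:
  its \<open>L1\<close> norm is at most its \<open>L2\<close> norm.\<close>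

lemma L1_bounded_square_sum:
  assumes g: "L1_bounded g C"
  shows "(\<Sum>k\<in>{- int n..int n}. (norm (g k))\<^sup>2) \<le> C\<^sup>2"
proof -
  define S where "S = (\<Sum>k\<in>{- int n..int n}. (norm (g k))\<^sup>2)"
  define q where "q = (\<Sum>i<2 * n + 1. monom (cnj (g (int i - int n))) i)"
  have coeff: "coeff q k = (if k < 2 * n + 1 then cnj (g (int k - int n)) else 0)" for k
    by (auto simp: q_def coeff_sum)
  have S_eq: "S = (\<Sum>i<2 * n + 1. (norm (g (int i - int n)))\<^sup>2)"
    unfolding S_def
    by (rule sum.reindex_bij_witness[of _ "\<lambda>i. int i - int n" "\<lambda>k. nat (k + int n)"]) auto
  have "moment_functional (\<lambda>k. g (int k - int n)) q = (\<Sum>i<2 * n + 1. cnj (g (int i - int n)) * g (int i - int n))"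
    by (subst moment_functional_eq_sum[of "2 * n + 1"]) (auto simp: coeff)
  also have "\<dots> = complex_of_real S"
    unfolding S_eq of_real_sum complex_norm_square by (simp add: mult.commute)
  finally have mf: "moment_functional (\<lambda>k. g (int k - int n)) q = complex_of_real S" .
  have "(LINT z|circle. (norm (poly q z))\<^sup>2) = (\<Sum>k<2 * n + 1. (norm (coeff q k))\<^sup>2)"
    by (rule integral_norm_poly_square) (simp add: coeff)
  also have "\<dots> = S" by (simp add: S_eq coeff)
  finally have "L1_norm q \<le> sqrt S"
    using integral_norm_le_L2[of "poly q"] by (simp add: continuous_intros)
  moreover have "norm (complex_of_real S) \<le> C * L1_norm q"
    using g unfolding L1_bounded_def mf[symmetric] by blast
  moreover have S0: "0 \<le> S" by (simp add: S_def sum_nonneg)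
  ultimately have "S \<le> C * sqrt S"
    using L1_bounded_nonneg[OF g] by (smt (verit) mult_left_mono norm_of_real)
  then have mult: "sqrt S * sqrt S \<le> C * sqrt S" using S0 by simp
  have "sqrt S \<le> C"
  proof (cases "S = 0")
    case True
    then show ?thesis using L1_bounded_nonneg[OF g] by simp
  next
    case False
    then have "sqrt S > 0" using S0 by simp
    then show ?thesis using mult mult_right_le_imp_le by blast
  qed
  then have "S \<le> C\<^sup>2" by (rule sqrt_le_D)
  then show ?thesis by (simp add: S_def)
qed

text \<open>After a norm-preserving extension to all trigonometric polynomials the moments are
  square-summable, so they come from an integrable function; boundedness on the trigonometric polynomials
  \<open>\<bar>f\<bar>\<^sup>2\<close> then bounds that function.\<close>

theorem bounded_moment_functional_symbol:
  assumes bound: "\<And>q. norm (moment_functional h q) \<le> C * L1_norm q" and C: "0 \<le> C"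
  obtains \<beta> where "integrable circle \<beta>" "AE z in circle. norm (\<beta> z) \<le> C"
    "\<And>k. (LINT z|circle. \<beta> z * z ^ k) = h k"
proof -
  obtain g where g: "L1_bounded g C" "\<And>k. g (int k) = h k"
    by (rule moment_functional_extend_two_sided[OF bound C]) auto
  have "(\<Sum>k\<in>{- int n..int n}. (norm (g (- k)))\<^sup>2) \<le> C\<^sup>2" for n
  proof -
    have "(\<Sum>k\<in>{- int n..int n}. (norm (g (- k)))\<^sup>2) = (\<Sum>k\<in>{- int n..int n}. (norm (g k))\<^sup>2)"
      by (rule sum.reindex_bij_witness[of _ uminus uminus]) auto
    then show ?thesis using L1_bounded_square_sum[OF g(1), of n] by simp
  qed
  then obtain \<beta> where \<beta>: "integrable circle \<beta>" "\<And>k. fourier \<beta> k = g (- k)"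
    by (rule Riesz_Fischer[of "\<lambda>k. g (- k)"]) auto
  have moment: "(LINT z|circle. \<beta> z * chi k z) = g k" for k
  proof -
    have "(LINT z|circle. \<beta> z * chi k z) = fourier \<beta> (- k)"
      unfolding pairing_def by (rule integral_circle_cong) (simp add: cnj_chi_on_circle)
    then show ?thesis by (simp add: \<beta>)
  qed
  have "AE z in circle. norm (\<beta> z) \<le> C"
  proof (rule AE_norm_le_of_quadratic[where p = 2 and q = 2])
    fix f :: "complex poly"
    define d where "d = degree f"
    have c: "integrable circle (\<lambda>z. \<beta> z * chi (- int d) z)"
      by (intro integrable_mult_continuous \<beta> continuous_on_chi)
    have "(LINT z|circle. \<beta> z * complex_of_real ((norm (poly f z))\<^sup>2))
        = (LINT z|circle. (\<beta> z * chi (- int d) z) * poly (f * circle_conj f) z)"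
    proof (rule integral_circle_cong)
      fix z :: complex assume z: "norm z = 1"
      have "chi (- int d) z * z ^ d = 1"
        using chi_mult_on_circle[OF z, of "- int d" "int d"] by (simp add: chi_of_nat) (simp add: chi_def)
      then have "chi (- int d) z * poly (f * circle_conj f) z = poly f z * cnj (poly f z)"
        by (simp add: poly_circle_conj[OF z] d_def mult_ac)
      then show "\<beta> z * complex_of_real ((norm (poly f z))\<^sup>2)
          = (\<beta> z * chi (- int d) z) * poly (f * circle_conj f) z"
        unfolding complex_norm_square by (simp only: mult.assoc)
    qed
    also have "\<dots> = moment_functional (\<lambda>k. LINT z|circle. (\<beta> z * chi (- int d) z) * z ^ k) (f * circle_conj f)"
      by (rule moment_functional_integral[OF c, symmetric])
    also have "\<dots> = moment_functional (\<lambda>k. g (int k - int d)) (f * circle_conj f)"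
    proof -
      have "(LINT z|circle. (\<beta> z * chi (- int d) z) * z ^ k) = (LINT z|circle. \<beta> z * chi (int k - int d) z)" for k
        unfolding chi_of_nat[symmetric] mult.assoc
        by (rule integral_circle_cong) (simp add: chi_mult_on_circle)
      then show ?thesis by (simp add: moment)
    qed
    finally have "norm (LINT z|circle. \<beta> z * complex_of_real ((norm (poly f z))\<^sup>2))
        \<le> C * (LINT z|circle. (norm (poly f z))\<^sup>2)"
      using L1_bounded_quadratic[OF g(1), of f] by (simp add: d_def)
    also have "(LINT z|circle. (norm (poly f z))\<^sup>2) = Lp_norm 2 (poly f) * Lp_norm 2 (poly f)"
      by (simp add: Lp_norm_def integral_nonneg_AE flip: powr_add)
    finally show "norm (LINT z|circle. \<beta> z * complex_of_real ((norm (poly f z))\<^sup>2))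
        \<le> C * (Lp_norm 2 (poly f) * Lp_norm 2 (poly f))" .
  qed (use \<beta> in auto)
  moreover have "(LINT z|circle. \<beta> z * z ^ k) = h k" for k
    using moment[of "int k"] by (simp add: chi_of_nat g)
  ultimately show ?thesis using that \<beta>(1) by blast
qed

section \<open>Continuous symbols\<close>

lemma moment_trig_sum:
  assumes "finite I"
  shows "(LINT z|circle. (\<Sum>i\<in>I. c i * chi (m i) z) * z ^ k)
    = (\<Sum>i\<in>I. if m i = - int k then c i else 0)"
proof -
  have "(LINT z|circle. (\<Sum>i\<in>I. c i * chi (m i) z) * z ^ k)
      = (LINT z|circle. (\<Sum>i\<in>I. c i * (chi (m i) z * cnj (chi (- int k) z))))"
    by (rule integral_circle_cong)
       (simp add: cnj_chi_on_circle chi_of_nat sum_distrib_right mult.assoc)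
  also have "\<dots> = (\<Sum>i\<in>I. c i * pairing (chi (m i)) (chi (- int k)))"
    by (simp add: pairing_def Bochner_Integration.integral_sum integrable_circle_continuous
          continuous_intros continuous_on_chi)
  finally show ?thesis by (simp add: pairing_chi_chi if_distrib[of "\<lambda>x. _ * x"] cong: if_cong)
qed

text \<open>The Fejer means of the symbol. They inherit the bound \<open>C\<close> because the Fejer kernel
  is the squared modulus of a polynomial and has integral 1.\<close>

definition fejer_mean :: "nat \<Rightarrow> (int \<Rightarrow> complex) \<Rightarrow> complex \<Rightarrow> complex" where
  "fejer_mean N D w = (\<Sum>(i, j)\<in>{..<N} \<times> {..<N}. (D (int i - int j) / of_nat N) * chi (int j - int i) w)"

lemma norm_fejer_mean_le:
  assumes D: "L1_bounded D C" and w: "norm w = 1" and N: "N > 0"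
  shows "norm (fejer_mean N D w) \<le> C"
proof -
  define f where "f = (\<Sum>i<N. monom (cnj w ^ i) i)"
  have coeff: "coeff f k = (if k < N then cnj w ^ k else 0)" for k
    by (simp add: f_def coeff_sum)
  have deg: "degree f = N - 1"
  proof (rule antisym)
    show "degree f \<le> N - 1" by (rule degree_le) (auto simp: coeff)
    show "N - 1 \<le> degree f" by (rule le_degree) (use N w in \<open>auto simp: coeff\<close>)
  qed
  have Suc: "{..degree f} = {..<N}" using N by (auto simp: deg)
  have "moment_functional (\<lambda>k. D (int k - int (degree f))) (f * circle_conj f)
      = (\<Sum>i<N. \<Sum>j<N. coeff f i * cnj (coeff f j) * D (int i - int j))"
    unfolding moment_functional_mult_circle_conj Suc ..
  also have "\<dots> = (\<Sum>i<N. \<Sum>j<N. D (int i - int j) * chi (int j - int i) w)"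
  proof (intro sum.cong refl)
    fix i j assume "i \<in> {..<N}" "j \<in> {..<N}"
    moreover have "cnj w ^ i * w ^ j = chi (int j - int i) w"
      using cnj_chi_on_circle[OF w, of "int i"] chi_mult_on_circle[OF w, of "- int i" "int j"]
      by (simp add: chi_of_nat)
    ultimately show "coeff f i * cnj (coeff f j) * D (int i - int j) = D (int i - int j) * chi (int j - int i) w"
      by (simp add: coeff mult_ac)
  qed
  also have "\<dots> = of_nat N * fejer_mean N D w"
    using N by (simp add: fejer_mean_def sum.cartesian_product[symmetric] sum_distrib_left)
  finally have eq: "of_nat N * fejer_mean N D w
      = moment_functional (\<lambda>k. D (int k - int (degree f))) (f * circle_conj f)" ..
  have "(LINT z|circle. (norm (poly f z))\<^sup>2) = (\<Sum>k<N. (norm (coeff f k))\<^sup>2)"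
    by (rule integral_norm_poly_square) (simp add: coeff)
  also have "\<dots> = real N" using w by (simp add: coeff norm_power)
  finally have "norm (of_nat N * fejer_mean N D w) \<le> C * real N"
    using L1_bounded_quadratic[OF D, of f] by (simp add: eq)
  then show ?thesis using N by (simp add: norm_mult)
qed

lemma continuous_fejer_mean: "continuous_on (sphere 0 1) (fejer_mean N D)"
  unfolding fejer_mean_def case_prod_unfold by (intro continuous_intros continuous_on_chi)

lemma moment_fejer_mean:
  assumes N: "N > 0"
  shows "(LINT z|circle. fejer_mean N D z * z ^ k) = of_nat (N - k) / of_nat N * D (int k)"
proof -
  have "(LINT z|circle. fejer_mean N D z * z ^ k)
      = (\<Sum>(i, j)\<in>{..<N} \<times> {..<N}. if int j - int i = - int k then D (int i - int j) / of_nat N else 0)"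
    unfolding fejer_mean_def case_prod_unfold by (rule moment_trig_sum) simp
  also have "\<dots> = (\<Sum>x\<in>(\<lambda>j. (j + k, j)) ` {..<N - k}. D (int k) / of_nat N)"
    by (rule sum.mono_neutral_cong_right) (auto simp: image_iff intro!: bexI)
  also have "\<dots> = of_nat (card ((\<lambda>j. (j + k, j)) ` {..<N - k})) * (D (int k) / of_nat N)"
    by simp
  also have "card ((\<lambda>j. (j + k, j)) ` {..<N - k}) = N - k"
    by (subst card_image) (auto simp: inj_on_def)
  finally show ?thesis by simp
qed

text \<open>A Fejer mean of high order changes the finitely many nonzero moments \<open>D k\<close> with
  \<open>k \<ge> 0\<close> by factors close to 1, and a small trigonometric polynomial corrects
  them.\<close>

lemma continuous_symbol_of_finite:
  assumes D: "L1_bounded D C" and fin: "\<And>k. k \<ge> n \<Longrightarrow> D (int k) = 0" and \<delta>: "\<delta> > 0"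
  obtains w where "continuous_on (sphere 0 1) w" "\<And>z. norm z = 1 \<Longrightarrow> norm (w z) \<le> C + \<delta>"
    "\<And>k. (LINT z|circle. w z * z ^ k) = D (int k)"
proof -
  define B where "B = (\<Sum>k<n. real k * norm (D (int k)))"
  \<comment> \<open>The correction below has size at most \<open>B / N\<close>.\<close>
  obtain N0 :: nat where N0: "B / \<delta> < real N0" using reals_Archimedean2 by blast
  define N where "N = max (max N0 n) 1"
  have N: "N > 0" "N \<ge> n" "real N \<ge> real N0" by (auto simp: N_def)
  have "B / \<delta> \<le> real N" using N0 N by linarith
  then have B: "B / real N \<le> \<delta>" using \<delta> N by (simp add: field_simps)
  define c where "c = (\<lambda>z. \<Sum>k<n. (of_nat k / of_nat N * D (int k)) * chi (- int k) z)"
  have c_cont: "continuous_on (sphere 0 1) c"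
    unfolding c_def by (intro continuous_intros continuous_on_chi)
  have c_norm: "norm (c z) \<le> \<delta>" if z: "norm z = 1" for z
  proof -
    have "norm (c z) \<le> (\<Sum>k<n. norm ((of_nat k / of_nat N * D (int k)) * chi (- int k) z))"
      unfolding c_def by (rule norm_sum)
    also have "\<dots> = B / real N"
      by (simp add: B_def norm_mult norm_divide norm_chi_on_circle[OF z] sum_divide_distrib)
    finally show ?thesis using B by simp
  qed
  define w where "w = (\<lambda>z. fejer_mean N D z + c z)"
  show ?thesis
  proof
    show "continuous_on (sphere 0 1) w"
      unfolding w_def by (intro continuous_intros continuous_fejer_mean c_cont)
    show "norm (w z) \<le> C + \<delta>" if z: "norm z = 1" for z
      unfolding w_def
      by (rule norm_triangle_le) (use norm_fejer_mean_le[OF D z N(1)] c_norm[OF z] in linarith)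
    fix k
    have "(LINT z|circle. w z * z ^ k)
        = (LINT z|circle. fejer_mean N D z * z ^ k) + (LINT z|circle. c z * z ^ k)"
      unfolding w_def distrib_right
      by (intro Bochner_Integration.integral_add integrable_circle_continuous continuous_intros
          continuous_fejer_mean c_cont)
    also have "(LINT z|circle. c z * z ^ k) = (if k < n then of_nat k / of_nat N * D (int k) else 0)"
      unfolding c_def by (subst moment_trig_sum) auto
    also have "(LINT z|circle. fejer_mean N D z * z ^ k) = of_nat (N - k) / of_nat N * D (int k)"
      by (rule moment_fejer_mean[OF N(1)])
    also have "of_nat (N - k) / of_nat N * D (int k) + (if k < n then of_nat k / of_nat N * D (int k) else 0)
        = D (int k)"
    proof (cases "k < n")
      case True
      then have "of_nat (N - k) = (of_nat N - of_nat k :: complex)" using N by (simp add: of_nat_diff)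
      then show ?thesis using True N by (simp add: field_simps)
    qed (simp add: fin)
    finally show "(LINT z|circle. w z * z ^ k) = D (int k)" .
  qed
qed

lemma L1_bounded_shift:
  assumes "L1_bounded g C" shows "L1_bounded (\<lambda>k. g (k - int n)) C"
  unfolding L1_bounded_def
proof (intro allI)
  fix N q
  have "(\<lambda>k. g (int k - int N - int n)) = (\<lambda>k. g (int k - int (N + n)))"
    by (simp add: algebra_simps)
  then show "norm (moment_functional (\<lambda>k. g (int k - int N - int n)) q) \<le> C * L1_norm q"
    using assms unfolding L1_bounded_def by metis
qed

lemma L1_bounded_diff:
  assumes "L1_bounded f C" "L1_bounded g C'" shows "L1_bounded (\<lambda>k. f k - g k) (C + C')"
  unfolding L1_bounded_def
proof (intro allI)
  fix N q
  have "moment_functional (\<lambda>k. f (int k - int N) - g (int k - int N)) q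
      = moment_functional (\<lambda>k. f (int k - int N)) q - moment_functional (\<lambda>k. g (int k - int N)) q"
    using moment_functional_linear_arg[of 1 "\<lambda>k. f (int k - int N)" "-1" "\<lambda>k. g (int k - int N)" q]
    by simp
  then have "norm (moment_functional (\<lambda>k. f (int k - int N) - g (int k - int N)) q)
      \<le> norm (moment_functional (\<lambda>k. f (int k - int N)) q) + norm (moment_functional (\<lambda>k. g (int k - int N)) q)"
    by (simp add: norm_triangle_ineq4)
  also have "\<dots> \<le> C * L1_norm q + C' * L1_norm q"
    using assms unfolding L1_bounded_def by (intro add_mono) auto
  finally show "norm (moment_functional (\<lambda>k. f (int k - int N) - g (int k - int N)) q) \<le> (C + C') * L1_norm q"
    by (simp add: distrib_right)
qed

text \<open>For each \<open>j\<close>, cutting \<open>h\<close> off before a late index and extending the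
  remainder downwards yields a two-sided \<open>G j\<close> of norm at most \<open>2 ^ (- j)\<close> that
  agrees with \<open>h\<close> from some index on. Consecutive differences have finitely many nonzero
  nonnegative moments, hence continuous symbols \<open>w j\<close> of comparable size. Since \<open>G
  j\<close> tends to 0, the moments of \<open>(\<Sum>j. w j)\<close> telescope to \<open>- G 0\<close>, and
  \<open>h - G 0\<close> belongs to a trigonometric polynomial.\<close>

theorem vanishing_tail_continuous_symbol:
  assumes tail: "\<And>e. e > 0 \<Longrightarrow> \<exists>n. \<forall>q. norm (moment_functional (\<lambda>k. h (n + k)) q) \<le> e * L1_norm q"
  obtains \<beta> where "continuous_on (sphere 0 1) \<beta>" "\<And>k. (LINT z|circle. \<beta> z * z ^ k) = h k"
proof -
  define e :: "nat \<Rightarrow> real" where "e = (\<lambda>j. (1 / 2) ^ j)"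
  have e_pos: "e j > 0" and e_Suc: "e (Suc j) = e j / 2" for j by (auto simp: e_def)
  have "\<exists>G n. L1_bounded G (e j) \<and> (\<forall>k\<ge>n. G (int k) = h k)" for j
  proof -
    obtain n where n: "\<And>q. norm (moment_functional (\<lambda>k. h (n + k)) q) \<le> e j * L1_norm q"
      using tail[OF e_pos] by blast
    obtain g where g: "L1_bounded g (e j)" "\<And>k. g (int k) = h (n + k)"
      by (rule moment_functional_extend_two_sided[OF n less_imp_le[OF e_pos]]) auto
    have "g (int k - int n) = h k" if "k \<ge> n" for k
      using g(2)[of "k - n"] that by (simp add: of_nat_diff)
    then show ?thesis using L1_bounded_shift[OF g(1), of n] by blast
  qed
  then obtain G n where G: "\<And>j. L1_bounded (G j) (e j)" "\<And>j k. k \<ge> n j \<Longrightarrow> G j (int k) = h k"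
    by metis
  have "\<exists>w. continuous_on (sphere 0 1) w \<and> (\<forall>z. norm z = 1 \<longrightarrow> norm (w z) \<le> 3 * e j)
      \<and> (\<forall>k. (LINT z|circle. w z * z ^ k) = G (Suc j) (int k) - G j (int k))" for j
  proof -
    obtain w where w: "continuous_on (sphere 0 1) w"
      "\<And>z. norm z = 1 \<Longrightarrow> norm (w z) \<le> (e (Suc j) + e j) + e j"
      "\<And>k. (LINT z|circle. w z * z ^ k) = G (Suc j) (int k) - G j (int k)"
    proof (rule continuous_symbol_of_finite[OF L1_bounded_diff[OF G(1)[of "Suc j"] G(1)[of j]] _ e_pos[of j]])
      show "G (Suc j) (int k) - G j (int k) = 0" if "k \<ge> max (n j) (n (Suc j))" for k
        using that by (simp add: G)
    qed auto
    moreover have "(e (Suc j) + e j) + e j \<le> 3 * e j" using e_pos[of j] by (simp add: e_Suc)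
    ultimately show ?thesis by (meson order_trans)
  qed
  then obtain w where w: "\<And>j. continuous_on (sphere 0 1) (w j)"
    "\<And>j z. norm z = 1 \<Longrightarrow> norm (w j z) \<le> 3 * e j"
    "\<And>j k. (LINT z|circle. w j z * z ^ k) = G (Suc j) (int k) - G j (int k)"
    by metis
  have e_sum: "summable (\<lambda>j. 3 * e j)"
    unfolding e_def by (intro summable_mult summable_geometric) simp
  define W where "W = (\<lambda>z. \<Sum>j. w j z)"
  have W_cont: "continuous_on (sphere 0 1) W"
  proof (rule uniform_limit_theorem)
    show "uniform_limit (sphere 0 1) (\<lambda>m z. \<Sum>j<m. w j z) W sequentially"
      unfolding W_def by (rule Weierstrass_m_test[OF _ e_sum]) (simp add: w)
    show "\<forall>\<^sub>F m in sequentially. continuous_on (sphere 0 1) (\<lambda>z. \<Sum>j<m. w j z)"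
      by (intro always_eventually allI continuous_intros w)
  qed simp
  have W_moment: "(LINT z|circle. W z * z ^ k) = - G 0 (int k)" for k
  proof -
    have norm_sum: "summable (\<lambda>j. norm (w j z * z ^ k))" if z: "norm z = 1" for z
      by (rule summable_comparison_test'[OF e_sum, of 0]) (simp add: w z norm_mult norm_power)
    have le: "(LINT z|circle. norm (w j z * z ^ k)) \<le> 3 * e j" for j
    proof -
      interpret prob_space circle by (rule prob_space_circle)
      have "(LINT z|circle. norm (w j z * z ^ k)) \<le> (LINT z|circle. 3 * e j)"
        by (rule integral_mono)
           (auto intro!: integrable_circle_continuous_real continuous_intros w
             simp: norm_mult norm_power)
      then show ?thesis using prob_space by simp
    qed
    have s: "summable (\<lambda>j. LINT z|circle. norm (w j z * z ^ k))"
      by (rule summable_comparison_test'[OF e_sum, of 0]) (use le in \<open>simp add: integral_nonneg_AE\<close>)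
    have "(LINT z|circle. W z * z ^ k) = (LINT z|circle. (\<Sum>j. w j z * z ^ k))"
    proof (rule integral_circle_cong)
      fix z :: complex assume z: "norm z = 1"
      have "summable (\<lambda>j. norm (w j z))"
        by (rule summable_comparison_test'[OF e_sum, of 0]) (simp add: w z)
      then show "W z * z ^ k = (\<Sum>j. w j z * z ^ k)"
        unfolding W_def by (rule suminf_mult2[OF summable_norm_cancel])
    qed
    also have "\<dots> = (\<Sum>j. LINT z|circle. w j z * z ^ k)"
      by (rule integral_suminf[OF _ _ s])
         (auto intro!: integrable_circle_continuous continuous_intros w norm_sum)
    also have "\<dots> = 0 - G 0 (int k)"
    proof -
      have "(\<lambda>j. G j (int k)) \<longlonglongrightarrow> 0"
      proof (rule Lim_null_comparison[OF always_eventually])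
        show "\<forall>j. norm (G j (int k)) \<le> e j" using L1_bounded_norm_le[OF G(1)] by blast
        show "e \<longlonglongrightarrow> 0" unfolding e_def by (rule LIMSEQ_realpow_zero) auto
      qed
      from sums_unique[OF telescope_sums[OF this], symmetric] show ?thesis by (simp only: w)
    qed
    finally show ?thesis by simp
  qed
  define P where "P = (\<lambda>z. \<Sum>k<n 0. (h k - G 0 (int k)) * chi (- int k) z)"
  have P_cont: "continuous_on (sphere 0 1) P"
    unfolding P_def by (intro continuous_intros continuous_on_chi)
  have P_moment: "(LINT z|circle. P z * z ^ k) = h k - G 0 (int k)" for k
  proof -
    have "(LINT z|circle. P z * z ^ k) = (if k < n 0 then h k - G 0 (int k) else 0)"
      unfolding P_def by (subst moment_trig_sum) auto
    then show ?thesis by (simp add: G)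
  qed
  show ?thesis
  proof
    show "continuous_on (sphere 0 1) (\<lambda>z. P z - W z)" by (intro continuous_intros P_cont W_cont)
    fix k
    have "(LINT z|circle. (P z - W z) * z ^ k) = (LINT z|circle. P z * z ^ k) - (LINT z|circle. W z * z ^ k)"
      unfolding left_diff_distrib
      by (intro Bochner_Integration.integral_diff integrable_circle_continuous continuous_intros
          P_cont W_cont)
    then show "(LINT z|circle. (P z - W z) * z ^ k) = h k" by (simp add: P_moment W_moment)
  qed
qed

section \<open>Factorization of polynomials on the circle\<close>

text \<open>Each root \<open>\<alpha>\<close> in the disc contributes the Blaschke factor \<open>(z -
  \<alpha>) / (1 - cnj \<alpha> * z)\<close> to \<open>B\<close>, which is unimodular on the circle, and its
  denominator to \<open>F\<close>. When no roots remain in the disc, the rest is nonzero on a slightly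
  larger disc.\<close>

lemma blaschke_factorization:
  fixes \<phi> :: "complex poly"
  assumes "\<And>z. norm z = 1 \<Longrightarrow> poly \<phi> z \<noteq> 0"
  shows "\<exists>R B F. R > 1 \<and> B holomorphic_on ball 0 R \<and> F holomorphic_on ball 0 R \<and>
    (\<forall>z\<in>ball 0 R. F z \<noteq> 0 \<and> poly \<phi> z = B z * F z) \<and> (\<forall>z. norm z = 1 \<longrightarrow> norm (B z) = 1)"
  using assms
proof (induction "degree \<phi>" arbitrary: \<phi> rule: less_induct)
  case less
  have \<phi>0: "\<phi> \<noteq> 0" using less.prems[of 1] by auto
  show ?case
  proof (cases "\<exists>\<alpha>. norm \<alpha> < 1 \<and> poly \<phi> \<alpha> = 0")
    case False
    define R where "R = Min (insert 2 (norm ` {z. poly \<phi> z = 0}))"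
    have fin: "finite (insert 2 (norm ` {z. poly \<phi> z = 0}))"
      using poly_roots_finite[OF \<phi>0] by simp
    have "norm z > 1" if "poly \<phi> z = 0" for z
      using False less.prems[of z] that by (metis linorder_neqE_linordered_idom)
    then have "R > 1" unfolding R_def by (subst Min_gr_iff[OF fin]) auto
    moreover have "poly \<phi> z \<noteq> 0" if "z \<in> ball 0 R" for z
    proof
      assume "poly \<phi> z = 0"
      then have "R \<le> norm z" unfolding R_def by (intro Min_le[OF fin]) auto
      then show False using that by simp
    qed
    moreover have "poly \<phi> holomorphic_on ball 0 R" "(\<lambda>_. 1 :: complex) holomorphic_on ball 0 R"
      by (intro holomorphic_intros)+
    ultimately show ?thesis
      by (intro exI[of _ R] exI[of _ "\<lambda>_. 1"] exI[of _ "poly \<phi>"]) auto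
  next
    case True
    then obtain \<alpha> where \<alpha>: "norm \<alpha> < 1" "poly \<phi> \<alpha> = 0" by blast
    then obtain \<psi> where \<psi>: "\<phi> = [:-\<alpha>, 1:] * \<psi>" by (metis poly_eq_0_iff_dvd dvdE)
    have "\<psi> \<noteq> 0" using \<phi>0 \<psi> by auto
    then have deg: "degree \<psi> < degree \<phi>" unfolding \<psi> by (subst degree_mult_eq) auto
    have "poly \<psi> z \<noteq> 0" if "norm z = 1" for z using less.prems[OF that] by (auto simp: \<psi>)
    from less.hyps[OF deg this] obtain R B F where IH: "R > 1" "B holomorphic_on ball 0 R"
      "F holomorphic_on ball 0 R" "\<And>z. z \<in> ball 0 R \<Longrightarrow> F z \<noteq> 0"
      "\<And>z. z \<in> ball 0 R \<Longrightarrow> poly \<psi> z = B z * F z" "\<And>z. norm z = 1 \<Longrightarrow> norm (B z) = 1"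
      by blast
    \<comment> \<open>\<open>1 / cnj \<alpha>\<close>, the pole of the Blaschke factor, must stay outside the disc.\<close>
    define R' where "R' = (if \<alpha> = 0 then R else min R (1 / norm \<alpha>))"
    have R': "R' > 1" "R' \<le> R" using IH(1) \<alpha> by (auto simp: R'_def)
    have sub: "ball 0 R' \<subseteq> ball (0::complex) R" using R' by auto
    have den: "1 - cnj \<alpha> * z \<noteq> 0" if z: "z \<in> ball 0 R'" for z
    proof (cases "\<alpha> = 0")
      case False
      then have "norm z < 1 / norm \<alpha>" using z by (simp add: R'_def)
      then have "norm (cnj \<alpha> * z) < 1" using False by (simp add: norm_mult field_simps)
      then show ?thesis by auto
    qed simp
    define B' where "B' = (\<lambda>z. B z * ((z - \<alpha>) / (1 - cnj \<alpha> * z)))"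
    define F' where "F' = (\<lambda>z. F z * (1 - cnj \<alpha> * z))"
    have "B' holomorphic_on ball 0 R'"
      unfolding B'_def using den by (intro holomorphic_intros holomorphic_on_subset[OF IH(2) sub]) auto
    moreover have "F' holomorphic_on ball 0 R'"
      unfolding F'_def by (intro holomorphic_intros holomorphic_on_subset[OF IH(3) sub])
    moreover have "F' z \<noteq> 0 \<and> poly \<phi> z = B' z * F' z" if z: "z \<in> ball 0 R'" for z
    proof -
      have zR: "z \<in> ball 0 R" using z sub by auto
      have "poly \<phi> z = (z - \<alpha>) * poly \<psi> z" by (simp add: \<psi> algebra_simps)
      then have "poly \<phi> z = (z - \<alpha>) * (B z * F z)" by (simp only: IH(5)[OF zR])
      moreover have "B' z * F' z = (z - \<alpha>) * (B z * F z)"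
        using den[OF z] by (simp add: F'_def B'_def)
      ultimately show ?thesis using den[OF z] IH(4)[OF zR] by (simp add: F'_def)
    qed
    moreover have "norm (B' z) = 1" if z: "norm z = 1" for z
    proof -
      have "cnj z * z = 1" using z by (simp add: mult.commute complex_norm_square[symmetric])
      then have "norm (1 - cnj \<alpha> * z) = norm (cnj z * z - cnj \<alpha> * z)" by simp
      also have "\<dots> = norm (cnj (z - \<alpha>)) * norm z" by (simp flip: left_diff_distrib norm_mult)
      also have "\<dots> = norm (z - \<alpha>)" using z by (simp only: complex_mod_cnj)
      finally have "norm (1 - cnj \<alpha> * z) = norm (z - \<alpha>)" .
      moreover have "1 - cnj \<alpha> * z \<noteq> 0" using den[of z] z R' by simp
      ultimately show ?thesis using IH(6)[OF z] by (auto simp: B'_def norm_mult norm_divide)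
    qed
    ultimately show ?thesis using R' by blast
  qed
qed

text \<open>The nonvanishing factor \<open>F\<close> has a holomorphic logarithm, hence powers with
  exponents \<open>1 / p\<close> and \<open>1 / q\<close>, and multiplication by \<open>B\<close> does not
  affect moduli on the circle. Both factors converge beyond the closed disc, so that their Taylor
  coefficients are summable.\<close>

lemma dual_exponent_factorization:
  fixes \<phi> :: "complex poly"
  assumes nz: "\<And>z. norm z = 1 \<Longrightarrow> poly \<phi> z \<noteq> 0" and pq: "1 < p" "1 < q" "1 / p + 1 / q = 1"
  obtains R f g where "R > 1" "f holomorphic_on ball 0 R" "g holomorphic_on ball 0 R"
    "\<And>z. z \<in> ball 0 R \<Longrightarrow> f z * g z = poly \<phi> z"
    "\<And>z. norm z = 1 \<Longrightarrow> norm (f z) powr p = norm (poly \<phi> z)"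
    "\<And>z. norm z = 1 \<Longrightarrow> norm (g z) powr q = norm (poly \<phi> z)"
proof -
  obtain R B F where RBF: "R > 1" "B holomorphic_on ball 0 R" "F holomorphic_on ball 0 R"
    "\<And>z. z \<in> ball 0 R \<Longrightarrow> F z \<noteq> 0" "\<And>z. z \<in> ball 0 R \<Longrightarrow> poly \<phi> z = B z * F z"
    "\<And>z. norm z = 1 \<Longrightarrow> norm (B z) = 1"
    using blaschke_factorization[of \<phi>] nz by blast
  obtain L where L: "L holomorphic_on ball 0 R" "\<And>z. z \<in> ball 0 R \<Longrightarrow> F z = exp (L z)"
    using contractible_imp_holomorphic_log[OF RBF(3) convex_imp_contractible[OF convex_ball] RBF(4)]
    by metis
  define f where "f = (\<lambda>z. B z * exp (L z / of_real p))"
  define g where "g = (\<lambda>z. exp (L z / of_real q))"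
  have ball: "z \<in> ball 0 R" if "norm z = 1" for z using that RBF(1) by simp
  have norm_\<phi>: "norm (poly \<phi> z) = exp (Re (L z))" if z: "norm z = 1" for z
    using RBF(5)[OF ball[OF z]] RBF(6)[OF z] L(2)[OF ball[OF z]] by (simp add: norm_mult)
  show ?thesis
  proof
    show "R > 1" by (rule RBF)
    show "f holomorphic_on ball 0 R" "g holomorphic_on ball 0 R"
      unfolding f_def g_def using pq by (auto intro!: holomorphic_intros RBF L)
    show "f z * g z = poly \<phi> z" if z: "z \<in> ball 0 R" for z
    proof -
      have "L z / of_real p + L z / of_real q = L z * of_real (1 / p + 1 / q)"
        by (simp add: algebra_simps)
      then have "exp (L z / of_real p) * exp (L z / of_real q) = exp (L z)"
        unfolding pq(3) by (simp flip: exp_add)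
      then show ?thesis by (simp add: f_def g_def RBF(5)[OF z] L(2)[OF z] mult.assoc)
    qed
    show "norm (f z) powr p = norm (poly \<phi> z)" if z: "norm z = 1" for z
      using pq RBF(6)[OF z] by (simp add: f_def norm_\<phi>[OF z] norm_mult exp_powr_real)
    show "norm (g z) powr q = norm (poly \<phi> z)" if z: "norm z = 1" for z
      using pq by (simp add: g_def norm_\<phi>[OF z] exp_powr_real)
  qed
qed

definition truncate_series :: "(nat \<Rightarrow> complex) \<Rightarrow> nat \<Rightarrow> complex poly" where
  "truncate_series c N = (\<Sum>i<N. monom (c i) i)"

lemma coeff_truncate_series: "coeff (truncate_series c N) k = (if k < N then c k else 0)"
  by (simp add: truncate_series_def coeff_sum)

lemma Lp_norm_truncate_series_tendsto:
  assumes c: "summable (\<lambda>n. norm (c n))" and f: "\<And>z. norm z = 1 \<Longrightarrow> (\<lambda>n. c n * z ^ n) sums f z"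
    and p: "p > 0" and \<phi>: "\<And>z. norm z = 1 \<Longrightarrow> norm (f z) powr p = norm (poly \<phi> z)"
  shows "(\<lambda>N. Lp_norm p (poly (truncate_series c N))) \<longlonglongrightarrow> L1_norm \<phi> powr (1 / p)"
proof -
  have poly: "poly (truncate_series c N) z = (\<Sum>n<N. c n * z ^ n)" for N z
    by (simp add: truncate_series_def poly_sum poly_monom)
  have "(\<lambda>N. LINT z|circle. norm (poly (truncate_series c N) z) powr p) \<longlonglongrightarrow> L1_norm \<phi>"
  proof (rule integral_dominated_convergence)
    show "integrable circle (\<lambda>_. (\<Sum>n. norm (c n)) powr p)"
      by (rule integrable_circle_continuous_real) simp
    show "AE z in circle. (\<lambda>N. norm (poly (truncate_series c N) z) powr p) \<longlonglongrightarrow> norm (poly \<phi> z)"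
    proof (rule AE_I2)
      fix z assume "z \<in> space circle"
      then have z: "norm z = 1" by simp
      have "(\<lambda>N. norm (poly (truncate_series c N) z) powr p) \<longlonglongrightarrow> norm (f z) powr p"
        unfolding poly using f[OF z] p
        by (intro tendsto_powr2 tendsto_norm) (auto simp: sums_def)
      then show "(\<lambda>N. norm (poly (truncate_series c N) z) powr p) \<longlonglongrightarrow> norm (poly \<phi> z)"
        by (simp add: \<phi>[OF z])
    qed
    show "AE z in circle. norm (norm (poly (truncate_series c N) z) powr p) \<le> (\<Sum>n. norm (c n)) powr p" for N
    proof (rule AE_I2)
      fix z assume "z \<in> space circle"
      then have z: "norm z = 1" by simp
      have "norm (poly (truncate_series c N) z) \<le> (\<Sum>n<N. norm (c n * z ^ n))"
        unfolding poly by (rule norm_sum)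
      also have "\<dots> \<le> (\<Sum>n. norm (c n))"
        using z c by (simp add: norm_mult norm_power sum_le_suminf)
      finally show "norm (norm (poly (truncate_series c N) z) powr p) \<le> (\<Sum>n. norm (c n)) powr p"
        using p by (simp add: powr_mono2)
    qed
    show "(\<lambda>z. norm (poly (truncate_series c N) z) powr p) \<in> borel_measurable circle" for N
      using p by (intro borel_measurable_circle_continuous_real continuous_on_powr' continuous_intros) auto
    show "(\<lambda>z. norm (poly \<phi> z)) \<in> borel_measurable circle"
      by (intro borel_measurable_circle_continuous_real continuous_intros)
  qed
  then show ?thesis
    unfolding Lp_norm_def using p by (intro tendsto_powr2) (auto simp: integral_nonneg_AE)
qed

text \<open>Below index \<open>N\<close> the truncated product has the same coefficients as
  \<open>\<phi>\<close>; above it they are dominated by the terms of the convergent Cauchy product of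
  \<open>\<Sum>n. norm (c n)\<close> and \<open>\<Sum>n. norm (d n)\<close>.\<close>

lemma moment_functional_truncated_product_tendsto:
  assumes c: "summable (\<lambda>n. norm (c n))" and d: "summable (\<lambda>n. norm (d n))"
    and prod: "\<And>n. (\<Sum>i\<le>n. c i * d (n - i)) = coeff \<phi> n"
    and H: "\<And>n. norm (h n) \<le> H"
  shows "(\<lambda>N. moment_functional h (truncate_series c N * truncate_series d N)) \<longlonglongrightarrow> moment_functional h \<phi>"
proof -
  define e where "e = (\<lambda>n. \<Sum>i\<le>n. norm (c i) * norm (d (n - i)))"
  have e: "summable e"
    unfolding e_def by (rule summable_Cauchy_product) (use c d in simp_all)
  have e_nonneg: "e n \<ge> 0" for n by (simp add: e_def sum_nonneg)
  have H0: "H \<ge> 0" using H[of 0] norm_ge_zero order_trans by blast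
  have bound: "norm (moment_functional h (truncate_series c N * truncate_series d N) - moment_functional h \<phi>)
      \<le> H * (suminf e - (\<Sum>n<N. e n))" if N: "N > degree \<phi>" for N
  proof -
    define r where "r = truncate_series c N * truncate_series d N - \<phi>"
    have low: "coeff r n = 0" if "n < N" for n
      using that by (auto simp: r_def coeff_mult coeff_truncate_series prod[symmetric] intro!: sum.cong)
    have high: "norm (coeff r n) \<le> e n" for n
    proof (cases "n < N")
      case False
      then have "coeff r n = (\<Sum>i\<le>n. coeff (truncate_series c N) i * coeff (truncate_series d N) (n - i))"
        using N by (simp add: r_def coeff_mult coeff_eq_0)
      then have "norm (coeff r n) \<le> (\<Sum>i\<le>n. norm (coeff (truncate_series c N) i * coeff (truncate_series d N) (n - i)))"
        using norm_sum by metis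
      also have "\<dots> \<le> e n"
        unfolding e_def by (intro sum_mono) (auto simp: coeff_truncate_series norm_mult)
      finally show ?thesis .
    qed (simp add: low e_nonneg)
    define M where "M = N + Suc (degree r)"
    have "moment_functional h r = (\<Sum>n<M. coeff r n * h n)"
      by (rule moment_functional_eq_sum) (simp add: M_def coeff_eq_0)
    also have "\<dots> = (\<Sum>n\<in>{..<M} - {..<N}. coeff r n * h n)"
      by (rule sum.mono_neutral_right) (auto simp: low)
    also have "norm \<dots> \<le> (\<Sum>n\<in>{..<M} - {..<N}. e n * H)"
      using high H e_nonneg by (intro sum_norm_le) (auto simp: norm_mult intro!: mult_mono)
    also have "\<dots> = (\<Sum>n\<in>{..<M} - {..<N}. e n) * H"
      by (rule sum_distrib_right[symmetric])
    also have "(\<Sum>n\<in>{..<M} - {..<N}. e n) = (\<Sum>n<M. e n) - (\<Sum>n<N. e n)"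
      by (rule sum_diff) (auto simp: M_def)
    also have "\<dots> * H = H * ((\<Sum>n<M. e n) - (\<Sum>n<N. e n))" by (rule mult.commute)
    also have "\<dots> \<le> H * (suminf e - (\<Sum>n<N. e n))"
      using H0 sum_le_suminf[OF e, of "{..<M}"] e_nonneg by (intro mult_left_mono) auto
    finally show ?thesis by (simp add: r_def moment_functional_diff)
  qed
  have "(\<lambda>N. H * (suminf e - (\<Sum>n<N. e n))) \<longlonglongrightarrow> H * (suminf e - suminf e)"
    by (intro tendsto_intros summable_LIMSEQ e)
  then have lim: "(\<lambda>N. H * (suminf e - (\<Sum>n<N. e n))) \<longlonglongrightarrow> 0" by simp
  have "(\<lambda>N. moment_functional h (truncate_series c N * truncate_series d N) - moment_functional h \<phi>) \<longlonglongrightarrow> 0"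
    by (rule Lim_null_comparison[OF eventually_mono[OF eventually_gt_at_top[of "degree \<phi>"]] lim])
       (rule bound)
  then show ?thesis by (rule LIM_zero_cancel)
qed

lemma holomorphic_taylor_coefficients:
  assumes R: "R > 1" and f: "f holomorphic_on ball 0 R"
  shows "f has_fps_expansion fps_expansion f 0"
    and "summable (\<lambda>n. norm (fps_nth (fps_expansion f 0) n))"
    and "\<And>z. norm z = 1 \<Longrightarrow> (\<lambda>n. fps_nth (fps_expansion f 0) n * z ^ n) sums f z"
proof -
  have f': "f holomorphic_on eball 0 (ereal R)" using f by simp
  show exp: "f has_fps_expansion fps_expansion f 0"
    using R f by (intro analytic_at_imp_has_fps_expansion_0) (auto simp: analytic_at intro!: exI[of _ "ball 0 R"])
  have "ereal R \<le> fps_conv_radius (fps_expansion f 0)"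
    by (rule holomorphic_on_imp_fps_conv_radius_ge[OF exp f'])
  then have "ereal (norm (1::complex)) < fps_conv_radius (fps_expansion f 0)"
    using R by (simp add: less_le_trans[of _ "ereal R"])
  from norm_summable_fps[OF this] show "summable (\<lambda>n. norm (fps_nth (fps_expansion f 0) n))"
    by simp
  show "(\<lambda>n. fps_nth (fps_expansion f 0) n * z ^ n) sums f z" if "norm z = 1" for z
    by (rule has_fps_expansion_imp_sums_complex[OF exp f']) (use that R in simp)
qed

text \<open>With \<open>\<phi> = f * g\<close> as above, the norms of \<open>f\<close> and \<open>g\<close>
  multiply to the \<open>L1\<close> norm of \<open>\<phi>\<close>. The hypothesis speaks of polynomials only
  and is applied to Taylor polynomials of \<open>f\<close> and \<open>g\<close>.\<close>

lemma moment_functional_le_L1_of_nonvanishing: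
  fixes \<phi> :: "complex poly"
  assumes nz: "\<And>z. norm z = 1 \<Longrightarrow> poly \<phi> z \<noteq> 0" and pq: "1 < p" "1 < q" "1 / p + 1 / q = 1"
    and bound: "\<And>f g. norm (moment_functional h (f * g)) \<le> C * (Lp_norm p (poly f) * Lp_norm q (poly g))"
  shows "norm (moment_functional h \<phi>) \<le> C * L1_norm \<phi>"
proof -
  obtain R f g where fg: "R > 1" "f holomorphic_on ball 0 R" "g holomorphic_on ball 0 R"
    "\<And>z. z \<in> ball 0 R \<Longrightarrow> f z * g z = poly \<phi> z"
    "\<And>z. norm z = 1 \<Longrightarrow> norm (f z) powr p = norm (poly \<phi> z)"
    "\<And>z. norm z = 1 \<Longrightarrow> norm (g z) powr q = norm (poly \<phi> z)"
    by (rule dual_exponent_factorization[OF nz pq]) auto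
  define c d where "c = fps_nth (fps_expansion f 0)" and "d = fps_nth (fps_expansion g 0)"
  note taylor_f = holomorphic_taylor_coefficients[OF fg(1,2)]
  note taylor_g = holomorphic_taylor_coefficients[OF fg(1,3)]
  have "eventually (\<lambda>z. f z * g z = poly \<phi> z) (nhds 0)"
    using fg(1,4) by (intro eventually_nhds_in_open[THEN eventually_mono, of "ball 0 R"]) auto
  then have "poly \<phi> has_fps_expansion fps_expansion f 0 * fps_expansion g 0"
    using has_fps_expansion_mult[OF taylor_f(1) taylor_g(1)] by (simp add: has_fps_expansion_cong)
  moreover have "poly \<phi> has_fps_expansion fps_of_poly \<phi>"
  proof (rule has_fps_expansionI[OF always_eventually], intro allI)
    fix u
    have "(\<lambda>n. coeff \<phi> n * u ^ n) sums (\<Sum>n\<le>degree \<phi>. coeff \<phi> n * u ^ n)"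
      by (rule sums_finite) (auto simp: coeff_eq_0)
    then show "(\<lambda>n. fps_nth (fps_of_poly \<phi>) n * u ^ n) sums poly \<phi> u"
      by (simp add: poly_altdef)
  qed
  ultimately have "fps_expansion f 0 * fps_expansion g 0 = fps_of_poly \<phi>"
    by (rule fps_expansion_unique_complex)
  then have prod: "(\<Sum>i\<le>n. c i * d (n - i)) = coeff \<phi> n" for n
    unfolding c_def d_def by (metis fps_mult_nth fps_of_poly_nth atMost_atLeast0)
  have H: "norm (h n) \<le> C" for n
  proof -
    have "norm (moment_functional h (monom 1 n * 1)) \<le> C * (Lp_norm p (poly (monom 1 n)) * Lp_norm q (poly 1))"
      by (rule bound)
    moreover have "Lp_norm p (poly (monom 1 n)) = 1" "Lp_norm q (poly 1) = 1"
    proof -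
      interpret prob_space circle by (rule prob_space_circle)
      have "Lp_norm p (poly (monom 1 n)) = Lp_norm p (\<lambda>_. 1)"
        by (rule Lp_norm_cong) (simp add: poly_monom norm_power)
      then show "Lp_norm p (poly (monom 1 n)) = 1" using prob_space by (simp add: Lp_norm_def)
      show "Lp_norm q (poly 1) = 1" using prob_space by (simp add: Lp_norm_def)
    qed
    ultimately show ?thesis by (simp add: moment_functional_monom)
  qed
  have A: "(\<lambda>N. moment_functional h (truncate_series c N * truncate_series d N)) \<longlonglongrightarrow> moment_functional h \<phi>"
    by (rule moment_functional_truncated_product_tendsto[OF _ _ prod H])
       (use taylor_f(2) taylor_g(2) in \<open>simp_all add: c_def d_def\<close>)
  have F: "(\<lambda>N. Lp_norm p (poly (truncate_series c N))) \<longlonglongrightarrow> L1_norm \<phi> powr (1 / p)"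
    by (rule Lp_norm_truncate_series_tendsto[where f = f])
       (use taylor_f(2,3) fg(5) pq in \<open>simp_all add: c_def\<close>)
  have G: "(\<lambda>N. Lp_norm q (poly (truncate_series d N))) \<longlonglongrightarrow> L1_norm \<phi> powr (1 / q)"
    by (rule Lp_norm_truncate_series_tendsto[where f = g])
       (use taylor_g(2,3) fg(6) pq in \<open>simp_all add: d_def\<close>)
  have "norm (moment_functional h \<phi>) \<le> C * (L1_norm \<phi> powr (1 / p) * L1_norm \<phi> powr (1 / q))"
    by (rule LIMSEQ_le[OF tendsto_norm[OF A] tendsto_mult[OF tendsto_const tendsto_mult[OF F G]]])
       (use bound in blast)
  also have "L1_norm \<phi> powr (1 / p) * L1_norm \<phi> powr (1 / q) = L1_norm \<phi>"
    using pq by (simp add: integral_nonneg_AE flip: powr_add)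
  finally show ?thesis .
qed

text \<open>Zeros on the circle are removed by a dilation \<open>z \<mapsto> r * z\<close> with \<open>r <
  1\<close>, for which both sides are continuous as \<open>r\<close> tends to 1.\<close>

theorem moment_functional_le_L1_of_products:
  assumes pq: "1 < p" "1 < q" "1 / p + 1 / q = 1"
    and bound: "\<And>f g. norm (moment_functional h (f * g)) \<le> C * (Lp_norm p (poly f) * Lp_norm q (poly g))"
  shows "norm (moment_functional h \<phi>) \<le> C * L1_norm \<phi>"
proof (cases "\<phi> = 0")
  case False
  define r where "r = (\<lambda>n. 1 - 1 / real (Suc (Suc n)))"
  have r01: "0 < r n" "r n < 1" for n by (auto simp: r_def field_simps)
  have r_lim: "r \<longlonglongrightarrow> 1"
  proof -
    have "(\<lambda>n. 1 / real (Suc n)) \<longlonglongrightarrow> 0"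
      using LIMSEQ_inverse_real_of_nat by (simp only: inverse_eq_divide)
    from tendsto_diff[OF tendsto_const[of 1] LIMSEQ_Suc[OF this]] show ?thesis
      by (simp add: r_def)
  qed
  define \<phi>r where "\<phi>r = (\<lambda>n. pcompose \<phi> [:0, complex_of_real (r n):])"
  have poly_\<phi>r: "poly (\<phi>r n) z = poly \<phi> (of_real (r n) * z)" for n z
    by (simp add: \<phi>r_def poly_pcompose mult.commute)
  define S where "S = norm ` {z. poly \<phi> z = 0} \<inter> {..<1}"
  have "finite S" using poly_roots_finite[OF False] by (simp add: S_def)
  then have "eventually (\<lambda>n. \<forall>s\<in>S. s < r n) sequentially"
    by (rule eventually_ball_finite) (auto simp: S_def intro!: order_tendstoD(1)[OF r_lim])
  then have ev: "eventually (\<lambda>n. norm (moment_functional h (\<phi>r n)) \<le> C * L1_norm (\<phi>r n)) sequentially"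
  proof eventually_elim
    case (elim n)
    show ?case
    proof (rule moment_functional_le_L1_of_nonvanishing[OF _ pq bound])
      fix z :: complex assume z: "norm z = 1"
      have n: "norm (of_real (r n) * z) = r n" using z r01[of n] by (simp add: norm_mult)
      show "poly (\<phi>r n) z \<noteq> 0"
      proof
        assume "poly (\<phi>r n) z = 0"
        then have "r n \<in> norm ` {z. poly \<phi> z = 0}"
          using n by (intro image_eqI[where x = "of_real (r n) * z"]) (simp_all add: poly_\<phi>r)
        then show False using elim r01[of n] by (auto simp: S_def)
      qed
    qed
  qed
  have A: "(\<lambda>n. moment_functional h (\<phi>r n)) \<longlonglongrightarrow> moment_functional h \<phi>"
  proof -
    have c: "coeff (\<phi>r n) k = of_real (r n) ^ k * coeff \<phi> k" for n k
      unfolding \<phi>r_def by (rule coeff_pcompose_linear)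
    have "moment_functional h (\<phi>r n) = (\<Sum>k<Suc (degree \<phi>). of_real (r n) ^ k * coeff \<phi> k * h k)" for n
      by (subst moment_functional_eq_sum[of "Suc (degree \<phi>)"]) (auto simp: c coeff_eq_0)
    moreover have "(\<lambda>n. \<Sum>k<Suc (degree \<phi>). of_real (r n) ^ k * coeff \<phi> k * h k)
        \<longlonglongrightarrow> (\<Sum>k<Suc (degree \<phi>). of_real 1 ^ k * coeff \<phi> k * h k)"
      by (intro tendsto_intros r_lim)
    moreover have "(\<Sum>k<Suc (degree \<phi>). of_real 1 ^ k * coeff \<phi> k * h k) = moment_functional h \<phi>"
      by (simp add: moment_functional_def lessThan_Suc_atMost)
    ultimately show ?thesis by simp
  qed
  have B: "(\<lambda>n. L1_norm (\<phi>r n)) \<longlonglongrightarrow> L1_norm \<phi>"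
  proof -
    have "compact (poly \<phi> ` cball 0 1)"
      by (intro compact_continuous_image continuous_intros compact_cball)
    then obtain M where M: "\<forall>y\<in>poly \<phi> ` cball 0 1. norm y \<le> M"
      using compact_imp_bounded bounded_iff by metis
    show ?thesis
    proof (rule integral_dominated_convergence)
      show "integrable circle (\<lambda>_. M)" by (rule integrable_circle_continuous_real) simp
      show "AE z in circle. (\<lambda>n. norm (poly (\<phi>r n) z)) \<longlonglongrightarrow> norm (poly \<phi> z)"
      proof (rule AE_I2)
        fix z
        have "(\<lambda>n. complex_of_real (r n) * z) \<longlonglongrightarrow> complex_of_real 1 * z"
          by (rule tendsto_mult_right[OF tendsto_of_real[OF r_lim]])
        then have "(\<lambda>n. complex_of_real (r n) * z) \<longlonglongrightarrow> z" by simp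
        then show "(\<lambda>n. norm (poly (\<phi>r n) z)) \<longlonglongrightarrow> norm (poly \<phi> z)"
          unfolding poly_\<phi>r by (intro tendsto_norm tendsto_poly)
      qed
      show "AE z in circle. norm (norm (poly (\<phi>r n) z)) \<le> M" for n
        using M r01[of n] by (intro AE_I2) (simp add: poly_\<phi>r norm_mult)
    qed (intro borel_measurable_circle_continuous_real continuous_intros)+
  qed
  show ?thesis
    by (rule tendsto_le[OF sequentially_bot tendsto_mult[OF tendsto_const B] tendsto_norm[OF A] ev])
qed simp

section \<open>Forms on polynomials\<close>

lemma poly_eq_chi_sum: "poly q = (\<lambda>z. \<Sum>k<Suc (degree q). coeff q k * chi (int k) z)"
  by (simp add: fun_eq_iff poly_altdef chi_of_nat lessThan_Suc_atMost)

lemma poly_in_D_plus: "poly q \<in> D_plus"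
  unfolding D_plus_def using poly_eq_chi_sum by blast

lemma D_plus_obtain_poly:
  assumes "f \<in> D_plus" obtains q where "f = poly q"
proof -
  obtain n :: nat and c where f: "f = (\<lambda>z. \<Sum>k<n. c k * chi (int k) z)"
    using assms by (auto simp: D_plus_def)
  have "f = poly (truncate_series c n)"
    by (simp add: f fun_eq_iff truncate_series_def poly_sum poly_monom chi_of_nat)
  then show ?thesis by (rule that)
qed

lemma fourier_poly: "fourier (poly q) (int k) = coeff q k"
  unfolding poly_eq_chi_sum by (subst fourier_D_plus) (auto simp: coeff_eq_0)

lemma poly_in_Lp: "0 < p \<Longrightarrow> poly q \<in> Lp p"
  by (intro continuous_in_Lp continuous_intros)

lemma poly_in_Hp:
  assumes "0 < p" shows "poly q \<in> Hp p"
proof -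
  have "fourier (poly q) n = 0" if n: "n < 0" for n
  proof -
    have "fourier (poly q) n = (LINT z|circle. poly (monom 1 (nat (- n)) * q) z)"
      unfolding pairing_def
    proof (rule integral_circle_cong)
      fix z :: complex assume "norm z = 1"
      then have "cnj (chi n z) = z ^ nat (- n)"
        using n by (simp add: cnj_chi_on_circle flip: chi_of_nat)
      then show "poly q z * cnj (chi n z) = poly (monom 1 (nat (- n)) * q) z"
        by (simp add: poly_monom)
    qed
    also have "\<dots> = 0"
      using n by (simp only: integral_poly) (simp add: coeff_mult coeff_monom)
    finally show ?thesis .
  qed
  then show ?thesis using poly_in_Lp[OF assms] by (simp add: Hp_def)
qed

lemma Lp_norm_poly_pos:
  assumes "0 < p" "f \<noteq> 0" shows "0 < Lp_norm p (poly f)"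
proof (rule ccontr)
  assume "\<not> 0 < Lp_norm p (poly f)"
  then have "Lp_norm p (poly f) = 0" using Lp_norm_nonneg[of p "poly f"] by linarith
  then have AE: "AE z in circle. poly f z = 0"
    by (rule Lp_norm_zero_AE[OF assms(1) poly_in_Lp[OF assms(1)]])
  have "coeff f k = 0" for k
  proof -
    have "AE z in circle. poly f z * cnj (chi (int k) z) = 0" using AE by eventually_elim simp
    then have "fourier (poly f) (int k) = 0" unfolding pairing_def by (rule integral_eq_zero_AE)
    then show ?thesis by (simp add: fourier_poly)
  qed
  then show False using assms(2) by (simp add: poly_eq_iff)
qed

lemma Lp_norm_smult:
  assumes "0 < p" shows "Lp_norm p (poly (smult c f)) = norm c * Lp_norm p (poly f)"
proof -
  have "poly (smult c f) = (\<lambda>z. c * poly f z)" by (simp add: fun_eq_iff)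
  then show ?thesis by (simp only: Lp_norm_scale[OF assms])
qed

lemma Lp_norm_shift: "Lp_norm p (poly (monom 1 n * f)) = Lp_norm p (poly f)"
  by (rule Lp_norm_cong) (simp add: poly_monom norm_mult norm_power)

lemma Lp_norm_map_poly_cnj:
  assumes "0 < p" shows "Lp_norm p (poly (map_poly cnj f)) = Lp_norm p (poly f)"
proof -
  have "(LINT z|circle. norm (poly f (cnj z)) powr p) = (LINT z|circle. norm (poly f z) powr p)"
    using assms
    by (intro integral_circle_cnj_real[of "\<lambda>z. norm (poly f z) powr p"]
        continuous_on_powr' continuous_intros) auto
  then show ?thesis by (simp add: Lp_norm_def)
qed

lemma chi_in_D_plus: "chi (int k) \<in> D_plus"
proof -
  have "chi (int k) = poly (monom 1 k)" by (simp add: fun_eq_iff poly_monom chi_of_nat)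
  then show ?thesis using poly_in_D_plus by metis
qed

lemma sesquilinear_form_poly:
  assumes B: "sesquilinear_form B"
  shows "B (poly f) (poly g) = moment_functional
    (\<lambda>k. cnj (moment_functional (\<lambda>j. cnj (B (chi (int k)) (chi (int j)))) g)) f"
proof -
  note B' = B[unfolded sesquilinear_form_def]
  note add_left = B'[THEN conjunct1, rule_format]
    and scale_left = B'[THEN conjunct2, THEN conjunct1, rule_format]
    and add_right = B'[THEN conjunct2, THEN conjunct2, THEN conjunct1, rule_format]
    and scale_right = B'[THEN conjunct2, THEN conjunct2, THEN conjunct2, rule_format]
  have in_D: "(\<lambda>z. \<Sum>k<n. c k * chi (int k) z) \<in> D_plus" for n :: nat and c
    unfolding D_plus_def by blast
  have scaled: "(\<lambda>z. c * chi (int k) z) \<in> D_plus" for c k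
  proof -
    have "(\<lambda>z. c * chi (int k) z) = poly (monom c k)" by (simp add: fun_eq_iff poly_monom chi_of_nat)
    then show ?thesis using poly_in_D_plus by metis
  qed
  have left: "B (\<lambda>z. \<Sum>k<n. c k * chi (int k) z) u = (\<Sum>k<n. c k * B (chi (int k)) u)"
    if u: "u \<in> D_plus" for n :: nat and c u
  proof (induction n)
    case 0
    have "B (\<lambda>z. 0 * chi (int 0) z) u = 0 * B (chi (int 0)) u"
      by (rule scale_left[OF chi_in_D_plus u])
    then show ?case by simp
  next
    case (Suc n)
    have "B (\<lambda>z. (\<Sum>k<n. c k * chi (int k) z) + c n * chi (int n) z) u
        = B (\<lambda>z. \<Sum>k<n. c k * chi (int k) z) u + B (\<lambda>z. c n * chi (int n) z) u"
      by (rule add_left[OF in_D scaled u])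
    moreover have "B (\<lambda>z. c n * chi (int n) z) u = c n * B (chi (int n)) u"
      by (rule scale_left[OF chi_in_D_plus u])
    ultimately show ?case using Suc.IH by simp
  qed
  have right: "B u (\<lambda>z. \<Sum>k<n. c k * chi (int k) z) = (\<Sum>k<n. cnj (c k) * B u (chi (int k)))"
    if u: "u \<in> D_plus" for n :: nat and c u
  proof (induction n)
    case 0
    have "B u (\<lambda>z. 0 * chi (int 0) z) = cnj 0 * B u (chi (int 0))"
      by (rule scale_right[OF u chi_in_D_plus])
    then show ?case by simp
  next
    case (Suc n)
    have "B u (\<lambda>z. (\<Sum>k<n. c k * chi (int k) z) + c n * chi (int n) z)
        = B u (\<lambda>z. \<Sum>k<n. c k * chi (int k) z) + B u (\<lambda>z. c n * chi (int n) z)"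
      by (rule add_right[OF u in_D scaled])
    moreover have "B u (\<lambda>z. c n * chi (int n) z) = cnj (c n) * B u (chi (int n))"
      by (rule scale_right[OF u chi_in_D_plus])
    ultimately show ?case using Suc.IH by simp
  qed
  have inner: "B (chi (int k)) (poly g)
      = (\<Sum>j<Suc (degree g). cnj (coeff g j) * B (chi (int k)) (chi (int j)))" for k
    unfolding poly_eq_chi_sum[of g] by (rule right[OF chi_in_D_plus])
  have "B (poly f) (poly g) = (\<Sum>k<Suc (degree f). coeff f k * B (chi (int k)) (poly g))"
    unfolding poly_eq_chi_sum[of f] by (rule left[OF poly_in_D_plus])
  then show ?thesis
    unfolding inner moment_functional_def lessThan_Suc_atMost
    by (simp only: cnj_sum complex_cnj_mult complex_cnj_cnj)
qed

lemma toeplitz_of_poly: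
  assumes a: "integrable circle a"
  shows "toeplitz_of a (poly f) (poly g) = (LINT z|circle. a z * poly f z * cnj (poly g z))"
proof -
  have ag: "integrable circle (\<lambda>z. a z * cnj (poly g z))"
    by (intro integrable_mult_continuous a continuous_intros)
  have inner: "(LINT z|circle. a z * cnj (poly g z) * z ^ k)
      = cnj (moment_functional (\<lambda>j. cnj (pairing a (chi (int j - int k)))) g)" for k
  proof -
    have ak: "integrable circle (\<lambda>z. cnj (a z * z ^ k))"
      by (intro Bochner_Integration.integrable_cnj integrable_mult_continuous a continuous_intros)
    have "(LINT z|circle. a z * cnj (poly g z) * z ^ k) = (LINT z|circle. cnj (cnj (a z * z ^ k) * poly g z))"
      by (simp add: mult_ac)
    also have "\<dots> = cnj (LINT z|circle. cnj (a z * z ^ k) * poly g z)"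
      by (rule Bochner_Integration.integral_cnj)
    also have "(LINT z|circle. cnj (a z * z ^ k) * poly g z)
        = moment_functional (\<lambda>j. LINT z|circle. cnj (a z * z ^ k) * z ^ j) g"
      by (rule moment_functional_integral[OF ak, symmetric])
    also have "(\<lambda>j. LINT z|circle. cnj (a z * z ^ k) * z ^ j) = (\<lambda>j. cnj (pairing a (chi (int j - int k))))"
    proof
      fix j
      have "(LINT z|circle. cnj (a z * z ^ k) * z ^ j) = (LINT z|circle. cnj (a z * cnj (chi (int j - int k) z)))"
      proof (rule integral_circle_cong)
        fix z :: complex assume z: "norm z = 1"
        have "cnj (z ^ k) * z ^ j = chi (int j - int k) z"
          using cnj_chi_on_circle[OF z, of "int k"] chi_mult_on_circle[OF z, of "- int k" "int j"]
          by (simp add: chi_of_nat)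
        then show "cnj (a z * z ^ k) * z ^ j = cnj (a z * cnj (chi (int j - int k) z))"
          by (simp add: mult.assoc)
      qed
      also have "\<dots> = cnj (pairing a (chi (int j - int k)))"
        unfolding pairing_def by (rule Bochner_Integration.integral_cnj)
      finally show "(LINT z|circle. cnj (a z * z ^ k) * z ^ j) = cnj (pairing a (chi (int j - int k)))" .
    qed
    finally show ?thesis .
  qed
  have "toeplitz_of a (poly f) (poly g)
      = moment_functional (\<lambda>k. LINT z|circle. a z * cnj (poly g z) * z ^ k) f"
    unfolding inner
    by (subst sesquilinear_form_poly) (simp_all add: toeplitz_of_chi, simp add: toeplitz_of_def sesquilinear_matrix_form)
  also have "\<dots> = (LINT z|circle. a z * cnj (poly g z) * poly f z)"
    by (rule moment_functional_integral[OF ag])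
  finally show ?thesis by (simp add: mult_ac)
qed

lemma hankel_form_chi:
  assumes "hankel_form H"
  shows "H (chi (int k)) (chi (int j)) = H (chi (int (j + k))) (chi 0)"
proof (induction j arbitrary: k)
  case (Suc j)
  have "H (chi (int k)) (chi (int (j + 1))) = H (chi (int (k + 1))) (chi (int j))"
    using assms unfolding hankel_form_def by metis
  then show ?case using Suc.IH[of "k + 1"] by (simp add: add_ac)
qed simp

text \<open>The conjugation is there because a form \<open>H f g\<close> is conjugate-linear in
  \<open>g\<close>, whereas moment functionals are linear.\<close>

definition hankel_moments :: "form \<Rightarrow> nat \<Rightarrow> complex" where
  "hankel_moments H m = cnj (H (chi (int m)) (chi 0))"

lemma hankel_form_poly:
  assumes "hankel_form H"
  shows "H (poly f) (poly g) = cnj (moment_functional (hankel_moments H) (map_poly cnj f * g))"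
proof -
  have sum: "cnj (moment_functional h f) = moment_functional (\<lambda>k. cnj (h k)) (map_poly cnj f)" for h f
    by (simp add: moment_functional_def coeff_map_poly degree_map_poly)
  have cnj_cnj: "map_poly cnj (map_poly cnj f) = f"
    by (simp add: poly_eq_iff coeff_map_poly)
  have "H (poly f) (poly g) = moment_functional
      (\<lambda>k. cnj (moment_functional (\<lambda>j. hankel_moments H (k + j)) g)) f"
    using assms unfolding hankel_moments_def
    by (subst sesquilinear_form_poly) (auto simp: hankel_form_def hankel_form_chi[OF assms] add_ac)
  also have "\<dots> = cnj (moment_functional
      (\<lambda>k. moment_functional (\<lambda>j. hankel_moments H (k + j)) g) (map_poly cnj f))"
    by (simp add: sum cnj_cnj)
  finally show ?thesis by (simp add: moment_functional_mult)
qed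

text \<open>Conjugation undoes the one in \<open>hankel_moments\<close>, and the factor \<open>z\<close>
  accounts for the entries of \<open>hankel_of b\<close> being the Fourier coefficients with index \<open>1
  + j + k\<close>.\<close>

lemma hankel_of_symbol:
  assumes H: "hankel_form H" and \<beta>: "\<And>k. (LINT z|circle. \<beta> z * z ^ k) = hankel_moments H k"
  shows "form_eq H (hankel_of (\<lambda>z. z * cnj (\<beta> z)))"
proof -
  let ?b = "\<lambda>z. z * cnj (\<beta> z)"
  have "hankel_moments (hankel_of ?b) m = hankel_moments H m" for m
  proof -
    have "hankel_of ?b (chi (int m)) (chi 0) = pairing ?b (chi (1 + int m))"
      using hankel_of_chi[of ?b m 0] by simp
    also have "\<dots> = (LINT z|circle. cnj (\<beta> z * z ^ m))"
      unfolding pairing_def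
    proof (rule integral_circle_cong)
      fix z :: complex assume z: "norm z = 1"
      have "chi (1 + int m) z = z ^ Suc m" using chi_of_nat[of "Suc m" z] by simp
      moreover have "z * cnj z = 1" using z by (simp add: complex_norm_square[symmetric])
      ultimately show "?b z * cnj (chi (1 + int m) z) = cnj (\<beta> z * z ^ m)"
        by (simp add: algebra_simps)
    qed
    also have "\<dots> = cnj (hankel_moments H m)"
      by (subst Bochner_Integration.integral_cnj) (simp only: \<beta>)
    finally show ?thesis by (simp add: hankel_moments_def)
  qed
  then have "hankel_moments (hankel_of ?b) = hankel_moments H" by (rule ext)
  then have "H (poly f) (poly g) = hankel_of ?b (poly f) (poly g)" for f g
    by (simp only: hankel_form_poly[OF H] hankel_form_poly[OF hankel_form_hankel_of])
  then show ?thesis unfolding form_eq_def using D_plus_obtain_poly by metis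
qed

lemma moment_functional_shift:
  "moment_functional h (monom 1 n * q) = moment_functional (\<lambda>k. h (n + k)) q"
  by (simp add: moment_functional_mult moment_functional_monom)

lemma hankel_form_poly_shift:
  assumes "hankel_form H"
  shows "H (poly (monom 1 m * f)) (poly (monom 1 n * g))
    = cnj (moment_functional (\<lambda>k. hankel_moments H (m + n + k)) (map_poly cnj f * g))"
proof -
  have "map_poly cnj (monom 1 m * f) = monom 1 m * map_poly cnj f"
    by (simp add: poly_eq_iff coeff_map_poly coeff_monom_mult)
  then have "map_poly cnj (monom 1 m * f) * (monom 1 n * g) = monom 1 m * (monom 1 n * (map_poly cnj f * g))"
    by (simp add: mult_ac)
  then show ?thesis
    by (simp only: hankel_form_poly[OF assms] moment_functional_shift add.assoc)
qed

section \<open>Separating the Toeplitz part from the Hankel part\<close>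

text \<open>The first column of the matrix of \<open>A\<close> and the Fourier coefficients of
  \<open>a\<close> both tend to 0 by the Riemann--Lebesgue lemma.\<close>

lemma hankel_moments_tendsto_0:
  assumes p: "1 \<le> p" and a: "integrable circle a" and L: "linear_operator_Hp p L"
    and A: "form_eq (\<lambda>f g. toeplitz_of a f g + H f g) (operator_form L)" and H: "hankel_form H"
  shows "hankel_moments H \<longlonglongrightarrow> 0"
proof -
  have one: "poly 1 \<in> Hp p" by (rule poly_in_Hp) (use p in simp)
  have chi0: "chi 0 = poly 1" by (simp add: fun_eq_iff chi_def)
  have "L (poly 1) \<in> Lp p" using L one by (auto simp: linear_operator_Hp_def Hp_def)
  then have i: "integrable circle (L (poly 1))" by (rule Lp_integrable[OF p])
  have "H (chi (int m)) (chi 0) = fourier (L (poly 1)) (int m) - fourier a (int m)" for m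
  proof -
    have "toeplitz_of a (chi 0) (chi (int m)) + H (chi 0) (chi (int m)) = pairing (L (chi 0)) (chi (int m))"
      using A chi_in_D_plus[of 0] chi_in_D_plus[of m] unfolding form_eq_def operator_form_def by simp
    moreover have "toeplitz_of a (chi 0) (chi (int m)) = fourier a (int m)"
      using toeplitz_of_chi[of a 0 m] by simp
    moreover have "H (chi 0) (chi (int m)) = H (chi (int m)) (chi 0)"
      using hankel_form_chi[OF H, of 0 m] by simp
    ultimately show ?thesis by (simp add: chi0 algebra_simps)
  qed
  then have "hankel_moments H = (\<lambda>m. cnj (fourier (L (poly 1)) (int m) - fourier a (int m)))"
    by (simp add: hankel_moments_def fun_eq_iff)
  moreover have "(\<lambda>m. cnj (fourier (L (poly 1)) (int m) - fourier a (int m))) \<longlonglongrightarrow> cnj (0 - 0)"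
    by (intro tendsto_cnj tendsto_diff Riemann_Lebesgue i a)
  ultimately show ?thesis by simp
qed

text \<open>In the integral for the Toeplitz part the two factors \<open>z ^ n\<close> and \<open>cnj (z ^
  n)\<close> cancel, while in the Hankel part they add \<open>2 * n\<close> to the index of every
  moment.\<close>

lemma toeplitz_as_shift_limit:
  assumes a: "integrable circle a" and H: "hankel_form H" and lim: "hankel_moments H \<longlonglongrightarrow> 0"
  shows "(\<lambda>n. toeplitz_of a (poly (monom 1 n * f)) (poly (monom 1 n * g))
      + H (poly (monom 1 n * f)) (poly (monom 1 n * g)))
    \<longlonglongrightarrow> (LINT z|circle. a z * poly f z * cnj (poly g z))"
proof -
  have T: "toeplitz_of a (poly (monom 1 n * f)) (poly (monom 1 n * g))
      = (LINT z|circle. a z * poly f z * cnj (poly g z))" for n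
    unfolding toeplitz_of_poly[OF a]
  proof (rule integral_circle_cong)
    fix z :: complex assume "norm z = 1"
    then have "z ^ n * cnj (z ^ n) = 1"
      by (simp add: complex_norm_square[symmetric] norm_power del: complex_cnj_power)
    then show "a z * poly (monom 1 n * f) z * cnj (poly (monom 1 n * g) z) = a z * poly f z * cnj (poly g z)"
      by (simp add: poly_monom mult_ac del: complex_cnj_power)
  qed
  have "(\<lambda>n. moment_functional (\<lambda>k. hankel_moments H (n + n + k)) (map_poly cnj f * g))
      \<longlonglongrightarrow> (\<Sum>k\<le>degree (map_poly cnj f * g). coeff (map_poly cnj f * g) k * 0)"
    unfolding moment_functional_def
  proof (intro tendsto_sum tendsto_mult tendsto_const)
    fix k
    have "filterlim (\<lambda>n::nat. n + n + k) at_top sequentially"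
      by (rule filterlim_at_top_mono[OF filterlim_ident]) (auto intro: always_eventually)
    then show "(\<lambda>n. hankel_moments H (n + n + k)) \<longlonglongrightarrow> 0" by (rule filterlim_compose[OF lim])
  qed
  then have "(\<lambda>n. H (poly (monom 1 n * f)) (poly (monom 1 n * g))) \<longlonglongrightarrow> 0"
    unfolding hankel_form_poly_shift[OF H] using tendsto_cnj by fastforce
  from tendsto_add[OF tendsto_const this] show ?thesis unfolding T by simp
qed

text \<open>A norm-convergent subsequence of the images has a limit to which high powers of \<open>z\<close>
  are almost orthogonal.\<close>

lemma compact_operator_pairing_shift:
  assumes pq: "1 < p" "1 < q" "1 / p + 1 / q = 1" and L: "compact_operator_Hp p L"
    and f: "\<And>n. Lp_norm p (poly (f n)) \<le> C" and g: "\<And>n. Lp_norm q (poly (g n)) \<le> C'"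
  obtains r where "strict_mono r"
    "(\<lambda>n. pairing (L (poly (f (r n)))) (poly (monom 1 (r n) * g (r n)))) \<longlonglongrightarrow> 0"
proof -
  have lin: "linear_operator_Hp p L" using L by (simp add: compact_operator_Hp_def)
  have p: "0 < p" using pq by simp
  have "(\<forall>n. poly (f n) \<in> Hp p)" using poly_in_Hp[OF p] by blast
  moreover have "\<exists>C. \<forall>n. Lp_norm p (poly (f n)) \<le> C" using f by blast
  ultimately have "\<exists>r G. strict_mono r \<and> G \<in> Hp p \<and>
      (\<lambda>n. Lp_norm p (\<lambda>z. L (poly (f (r n))) z - G z)) \<longlonglongrightarrow> 0"
    using L unfolding compact_operator_Hp_def by (elim conjE allE[of _ "\<lambda>n. poly (f n)"]) simp
  then obtain r G where r: "strict_mono (r :: nat \<Rightarrow> nat)" and G: "G \<in> Hp p"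
    and lim: "(\<lambda>n. Lp_norm p (\<lambda>z. L (poly (f (r n))) z - G z)) \<longlonglongrightarrow> 0" by blast
  have G': "G \<in> Lp p" using G by (simp add: Hp_def)
  have Lf: "L (poly (f n)) \<in> Lp p" for n
    using lin poly_in_Hp[OF p] by (auto simp: linear_operator_Hp_def Hp_def)
  define C'' where "C'' = max C' 1"
  have C'': "C'' > 0" "Lp_norm q (poly (g n)) \<le> C''" for n
    using g[of n] by (auto simp: C''_def)
  have "(\<lambda>n. pairing (L (poly (f (r n)))) (poly (monom 1 (r n) * g (r n)))) \<longlonglongrightarrow> 0"
  proof (rule LIMSEQ_I)
    fix e :: real assume e: "e > 0"
    define d where "d = e / (2 * C'')"
    have d: "d > 0" using e C''(1) by (simp add: d_def)
    obtain n0 where n0: "\<And>n g. n \<ge> n0 \<Longrightarrow> norm (pairing G (poly (monom 1 n * g))) \<le> d * Lp_norm q (poly g)"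
      using pairing_shift_small[OF pq G' d] by blast
    obtain n1 where n1: "\<And>n. n \<ge> n1 \<Longrightarrow> Lp_norm p (\<lambda>z. L (poly (f (r n))) z - G z) < d"
      using order_tendstoD(2)[OF lim d] by (auto simp: eventually_sequentially)
    have "norm (pairing (L (poly (f (r n)))) (poly (monom 1 (r n) * g (r n))) - 0) < e"
      if n: "n \<ge> max n0 n1" for n
    proof -
      let ?F = "L (poly (f (r n)))" and ?g = "poly (monom 1 (r n) * g (r n))"
      have rn: "r n \<ge> n0" using seq_suble[OF r, of n] n by simp
      have D: "(\<lambda>z. ?F z - G z) \<in> Lp p" by (intro Lp_diff p Lf G')
      have c: "continuous_on (sphere 0 1) (\<lambda>z. cnj (?g z))" by (intro continuous_intros)
      have "pairing ?F ?g = (LINT z|circle. (?F z - G z) * cnj (?g z) + G z * cnj (?g z))"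
        unfolding pairing_def by (simp add: algebra_simps)
      also have "\<dots> = pairing (\<lambda>z. ?F z - G z) ?g + pairing G ?g"
        unfolding pairing_def
        by (intro Bochner_Integration.integral_add integrable_mult_continuous c
            Lp_integrable[OF less_imp_le[OF pq(1)]] D G')
      finally have "norm (pairing ?F ?g) \<le> norm (pairing (\<lambda>z. ?F z - G z) ?g) + norm (pairing G ?g)"
        by (simp only: norm_triangle_ineq)
      also have "norm (pairing (\<lambda>z. ?F z - G z) ?g) \<le> Lp_norm p (\<lambda>z. ?F z - G z) * Lp_norm q ?g"
        by (rule norm_pairing_le[OF pq D poly_in_Lp]) (use pq in simp)
      also have "\<dots> = Lp_norm p (\<lambda>z. ?F z - G z) * Lp_norm q (poly (g (r n)))"
        by (simp only: Lp_norm_shift)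
      also have "\<dots> \<le> Lp_norm p (\<lambda>z. ?F z - G z) * C''"
        by (intro mult_left_mono C'' Lp_norm_nonneg)
      also have "\<dots> < d * C''"
        using n1[of n] n C''(1) by simp
      also have "norm (pairing G ?g) \<le> d * Lp_norm q (poly (g (r n)))"
        by (rule n0[OF rn])
      also have "\<dots> \<le> d * C''" using d by (intro mult_left_mono C'') simp
      finally show ?thesis using C''(1) by (simp add: d_def del: poly_mult)
    qed
    then show "\<exists>no. \<forall>n\<ge>no. norm (pairing (L (poly (f (r n)))) (poly (monom 1 (r n) * g (r n))) - 0) < e"
      by blast
  qed
  with r show ?thesis by (rule that)
qed

lemma conjugate_exponent:
  assumes "1 < p" obtains q :: real where "1 < q" "1 / p + 1 / q = 1"
proof
  show "1 < p / (p - 1)" using assms by (simp add: field_simps)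
  show "1 / p + 1 / (p / (p - 1)) = 1" using assms by (simp add: field_simps)
qed

text \<open>The duality estimate for \<open>A\<close> passes to the shift limit \<open>T(a)\<close>, and
  hence to \<open>H = A - T(a)\<close>.\<close>

lemma bounded_toeplitz_plus_hankel:
  assumes p: "1 < p" and a: "integrable circle a" and H: "hankel_form H"
    and A: "bounded_form_Hp p (\<lambda>f g. toeplitz_of a f g + H f g)"
  shows "a \<in> Linf" and "\<exists>b\<in>Linf. form_eq H (hankel_of b)"
proof -
  obtain q where q: "1 < q" "1 / p + 1 / q = 1" by (rule conjugate_exponent[OF p])
  note pq = p q
  obtain L C0 where L: "linear_operator_Hp p L"
    and C0: "\<And>f. f \<in> Hp p \<Longrightarrow> Lp_norm p (L f) \<le> C0 * Lp_norm p f"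
    and form: "form_eq (\<lambda>f g. toeplitz_of a f g + H f g) (operator_form L)"
    using A unfolding bounded_form_Hp_def bounded_operator_Hp_def by blast
  define C where "C = \<bar>C0\<bar>"
  have C: "0 \<le> C" by (simp add: C_def)
  have p0: "0 < p" "0 < q" using pq by simp_all
  have A_le: "norm (toeplitz_of a (poly f) (poly g) + H (poly f) (poly g))
      \<le> C * (Lp_norm p (poly f) * Lp_norm q (poly g))" for f g
  proof -
    have f: "poly f \<in> Hp p" by (rule poly_in_Hp[OF p0(1)])
    have "toeplitz_of a (poly f) (poly g) + H (poly f) (poly g) = pairing (L (poly f)) (poly g)"
      using form poly_in_D_plus unfolding form_eq_def operator_form_def by blast
    moreover have "norm (pairing (L (poly f)) (poly g)) \<le> Lp_norm p (L (poly f)) * Lp_norm q (poly g)"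
      using L f by (intro norm_pairing_le[OF pq] poly_in_Lp p0) (auto simp: linear_operator_Hp_def Hp_def)
    moreover have "Lp_norm p (L (poly f)) \<le> C * Lp_norm p (poly f)"
      using C0[OF f] mult_right_mono[OF abs_ge_self[of C0] Lp_norm_nonneg[of p "poly f"]]
      by (simp add: C_def)
    then have "Lp_norm p (L (poly f)) * Lp_norm q (poly g) \<le> C * Lp_norm p (poly f) * Lp_norm q (poly g)"
      by (intro mult_right_mono Lp_norm_nonneg)
    ultimately show ?thesis by (simp add: mult.assoc)
  qed
  have moments: "hankel_moments H \<longlonglongrightarrow> 0"
    by (rule hankel_moments_tendsto_0[OF less_imp_le[OF p] a L form H])
  have T_le: "norm (LINT z|circle. a z * poly f z * cnj (poly g z))
      \<le> C * (Lp_norm p (poly f) * Lp_norm q (poly g))" for f g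
  proof (rule LIMSEQ_le_const2[OF tendsto_norm[OF toeplitz_as_shift_limit[OF a H moments]]])
    show "\<exists>N. \<forall>n\<ge>N. norm (toeplitz_of a (poly (monom 1 n * f)) (poly (monom 1 n * g))
        + H (poly (monom 1 n * f)) (poly (monom 1 n * g))) \<le> C * (Lp_norm p (poly f) * Lp_norm q (poly g))"
      using A_le[of "monom 1 _ * f" "monom 1 _ * g"] unfolding Lp_norm_shift by blast
  qed
  have "AE z in circle. norm (a z) \<le> C"
  proof (rule AE_norm_le_of_quadratic[OF pq a])
    fix f
    have "(LINT z|circle. a z * complex_of_real ((norm (poly f z))\<^sup>2))
        = (LINT z|circle. a z * poly f z * cnj (poly f z))"
      unfolding complex_norm_square by (simp add: mult.assoc)
    then show "norm (LINT z|circle. a z * complex_of_real ((norm (poly f z))\<^sup>2))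
        \<le> C * (Lp_norm p (poly f) * Lp_norm q (poly f))"
      using T_le[of f f] by simp
  qed
  then show "a \<in> Linf" using a by (auto simp: Linf_def)
  have H_le: "norm (H (poly f) (poly g)) \<le> 2 * C * (Lp_norm p (poly f) * Lp_norm q (poly g))" for f g
  proof -
    have "norm (H (poly f) (poly g)) \<le> norm (toeplitz_of a (poly f) (poly g) + H (poly f) (poly g))
        + norm (toeplitz_of a (poly f) (poly g))"
      by (metis add_diff_cancel_left' norm_triangle_ineq4)
    then show ?thesis using A_le[of f g] T_le[of f g] by (simp add: toeplitz_of_poly[OF a])
  qed
  have "norm (moment_functional (hankel_moments H) (f * g))
      \<le> 2 * C * (Lp_norm p (poly f) * Lp_norm q (poly g))" for f g
  proof -
    have "map_poly cnj (map_poly cnj f) = f" by (simp add: poly_eq_iff coeff_map_poly)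
    then show ?thesis
      using H_le[of "map_poly cnj f" g]
      by (simp add: hankel_form_poly[OF H] Lp_norm_map_poly_cnj[OF p0(1)])
  qed
  then have "norm (moment_functional (hankel_moments H) \<phi>) \<le> 2 * C * L1_norm \<phi>" for \<phi>
    by (rule moment_functional_le_L1_of_products[OF pq])
  then obtain \<beta> where \<beta>: "integrable circle \<beta>" "AE z in circle. norm (\<beta> z) \<le> 2 * C"
    "\<And>k. (LINT z|circle. \<beta> z * z ^ k) = hankel_moments H k"
    by (rule bounded_moment_functional_symbol) (use C in auto)
  have "(\<lambda>z. z * cnj (\<beta> z)) \<in> Linf"
    unfolding Linf_def
  proof (intro CollectI conjI exI)
    have "(\<lambda>z. cnj (\<beta> z)) \<in> borel_measurable circle"
      by (intro borel_measurable_integrable Bochner_Integration.integrable_cnj \<beta>(1))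
    then show "(\<lambda>z. z * cnj (\<beta> z)) \<in> borel_measurable circle"
      using borel_measurable_circle_continuous[OF continuous_on_id] by (intro borel_measurable_times)
    show "AE z in circle. norm (z * cnj (\<beta> z)) \<le> 2 * C"
      using \<beta>(2) AE_space by eventually_elim (simp add: norm_mult)
  qed
  with hankel_of_symbol[OF H \<beta>(3)] show "\<exists>b\<in>Linf. form_eq H (hankel_of b)" by blast
qed

text \<open>Compactness improves the limit \<open>T(a)\<close> to 0. It also makes the norms of the forms
  \<open>H(f, z ^ n * g)\<close> tend to 0: otherwise normalised \<open>f n\<close>, \<open>g n\<close> with
  \<open>\<bar>H(f n, z ^ n * g n)\<bar>\<close> bounded below would exist.\<close>

lemma compact_toeplitz_plus_hankel:
  assumes p: "1 < p" and a: "integrable circle a" and H: "hankel_form H"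
    and A: "compact_form_Hp p (\<lambda>f g. toeplitz_of a f g + H f g)"
  shows "AE z in circle. a z = 0" and "\<exists>b\<in>C_circle. form_eq H (hankel_of b)"
proof -
  obtain q where q: "1 < q" "1 / p + 1 / q = 1" by (rule conjugate_exponent[OF p])
  note pq = p q
  have p0: "0 < p" "0 < q" using pq by simp_all
  obtain L where L: "compact_operator_Hp p L"
    and form: "form_eq (\<lambda>f g. toeplitz_of a f g + H f g) (operator_form L)"
    using A unfolding compact_form_Hp_def by blast
  have lin: "linear_operator_Hp p L" using L by (simp add: compact_operator_Hp_def)
  have A_eq: "toeplitz_of a (poly f) (poly g) + H (poly f) (poly g) = pairing (L (poly f)) (poly g)" for f g
    using form poly_in_D_plus unfolding form_eq_def operator_form_def by blast
  have moments: "hankel_moments H \<longlonglongrightarrow> 0"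
    by (rule hankel_moments_tendsto_0[OF less_imp_le[OF p] a lin form H])
  have "AE z in circle. norm (a z) \<le> 0"
  proof (rule AE_norm_le_of_quadratic[OF pq a])
    fix f
    obtain r where r: "strict_mono r"
      "(\<lambda>n. pairing (L (poly (monom 1 (r n) * f))) (poly (monom 1 (r n) * f))) \<longlonglongrightarrow> 0"
      by (rule compact_operator_pairing_shift[OF pq L,
            of "\<lambda>n. monom 1 n * f" "Lp_norm p (poly f)" "\<lambda>_. f" "Lp_norm q (poly f)"])
         (simp_all only: Lp_norm_shift order_refl)
    have "(\<lambda>n. pairing (L (poly (monom 1 (r n) * f))) (poly (monom 1 (r n) * f)))
        \<longlonglongrightarrow> (LINT z|circle. a z * poly f z * cnj (poly f z))"
      using LIMSEQ_subseq_LIMSEQ[OF toeplitz_as_shift_limit[OF a H moments, of f f] r(1)]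
      unfolding A_eq o_def .
    then have "(LINT z|circle. a z * poly f z * cnj (poly f z)) = 0"
      using r(2) LIMSEQ_unique by blast
    moreover have "(LINT z|circle. a z * complex_of_real ((norm (poly f z))\<^sup>2))
        = (LINT z|circle. a z * poly f z * cnj (poly f z))"
      unfolding complex_norm_square by (simp add: mult.assoc)
    ultimately show "norm (LINT z|circle. a z * complex_of_real ((norm (poly f z))\<^sup>2))
        \<le> 0 * (Lp_norm p (poly f) * Lp_norm q (poly f))" by simp
  qed
  then show a0: "AE z in circle. a z = 0" by simp
  have H_eq: "H (poly f) (poly g) = pairing (L (poly f)) (poly g)" for f g
  proof -
    have "toeplitz_of a (poly f) (poly g) = 0"
      unfolding toeplitz_of_poly[OF a] using a0 by (intro integral_eq_zero_AE) (auto elim: eventually_mono)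
    then show ?thesis using A_eq[of f g] by simp
  qed
  have small: "\<exists>n. \<forall>f g. norm (H (poly f) (poly (monom 1 n * g)))
      \<le> e * (Lp_norm p (poly f) * Lp_norm q (poly g))" if e: "e > 0" for e
  proof (rule ccontr)
    assume "\<not> ?thesis"
    then have "\<forall>n. \<exists>f g. norm (H (poly f) (poly (monom 1 n * g)))
        > e * (Lp_norm p (poly f) * Lp_norm q (poly g))"
      by (auto simp: not_le)
    then obtain f g where fg: "\<And>n. norm (H (poly (f n)) (poly (monom 1 n * g n)))
        > e * (Lp_norm p (poly (f n)) * Lp_norm q (poly (g n)))"
      by metis
    have nz: "f n \<noteq> 0" "g n \<noteq> 0" for n
    proof -
      have "norm (H (poly (f n)) (poly (monom 1 n * g n))) > 0"
        by (rule order.strict_trans1[OF _ fg]) (use e in \<open>simp add: Lp_norm_nonneg\<close>)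
      then show "f n \<noteq> 0" "g n \<noteq> 0" by (auto simp: hankel_form_poly[OF H] simp del: poly_mult)
    qed
    define s t where "s = (\<lambda>n. Lp_norm p (poly (f n)))" and "t = (\<lambda>n. Lp_norm q (poly (g n)))"
    have st: "s n > 0" "t n > 0" for n
      unfolding s_def t_def by (intro Lp_norm_poly_pos p0 nz)+
    define f' g' where "f' = (\<lambda>n. smult (complex_of_real (1 / s n)) (f n))"
      and "g' = (\<lambda>n. smult (complex_of_real (1 / t n)) (g n))"
    have f': "Lp_norm p (poly (f' n)) = 1" and g': "Lp_norm q (poly (g' n)) = 1" for n
      using st[of n] unfolding f'_def g'_def Lp_norm_smult[OF p0(1)] Lp_norm_smult[OF p0(2)]
      by (simp_all add: s_def t_def norm_divide)
    have big: "norm (H (poly (f' n)) (poly (monom 1 n * g' n))) > e" for n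
    proof -
      have "map_poly cnj (f' n) * (monom 1 n * g' n)
          = smult (complex_of_real (1 / s n)) (smult (complex_of_real (1 / t n))
              (map_poly cnj (f n) * (monom 1 n * g n)))"
        by (simp add: f'_def g'_def map_poly_smult mult.commute)
      then have "norm (H (poly (f' n)) (poly (monom 1 n * g' n)))
          = norm (H (poly (f n)) (poly (monom 1 n * g n))) / (s n * t n)"
        using st[of n] unfolding hankel_form_poly[OF H]
        by (simp only: moment_functional_smult complex_mod_cnj norm_mult norm_of_real) simp
      moreover have "e < norm (H (poly (f n)) (poly (monom 1 n * g n))) / (s n * t n)"
        using fg[of n] st[of n] by (simp add: s_def t_def pos_less_divide_eq mult.assoc)
      ultimately show ?thesis by simp
    qed
    obtain r where r: "strict_mono r"
      "(\<lambda>n. pairing (L (poly (f' (r n)))) (poly (monom 1 (r n) * g' (r n)))) \<longlonglongrightarrow> 0"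
      by (rule compact_operator_pairing_shift[OF pq L, of f' 1 g' 1]) (simp_all add: f' g')
    obtain n where "norm (pairing (L (poly (f' (r n)))) (poly (monom 1 (r n) * g' (r n)))) < e"
      using LIMSEQ_D[OF r(2) e] by auto
    with big[of "r n"] show False unfolding H_eq by simp
  qed
  have tail: "\<exists>n. \<forall>\<phi>. norm (moment_functional (\<lambda>k. hankel_moments H (n + k)) \<phi>) \<le> e * L1_norm \<phi>"
    if e: "e > 0" for e
  proof -
    obtain n where n: "\<And>f g. norm (H (poly f) (poly (monom 1 n * g)))
        \<le> e * (Lp_norm p (poly f) * Lp_norm q (poly g))"
      using small[OF e] by blast
    have "norm (moment_functional (\<lambda>k. hankel_moments H (n + k)) (f * g))
        \<le> e * (Lp_norm p (poly f) * Lp_norm q (poly g))" for f g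
    proof -
      have "map_poly cnj (map_poly cnj f) = f" by (simp add: poly_eq_iff coeff_map_poly)
      then have "norm (H (poly (map_poly cnj f)) (poly (monom 1 n * g)))
          = norm (moment_functional (\<lambda>k. hankel_moments H (n + k)) (f * g))"
        using hankel_form_poly_shift[OF H, of 0 "map_poly cnj f" n g] by (simp add: monom_0 flip: one_pCons)
      then show ?thesis
        using n[of "map_poly cnj f" g] by (simp only: Lp_norm_map_poly_cnj[OF p0(1)])
    qed
    then have "norm (moment_functional (\<lambda>k. hankel_moments H (n + k)) \<phi>) \<le> e * L1_norm \<phi>" for \<phi>
      by (rule moment_functional_le_L1_of_products[OF pq])
    then show ?thesis by blast
  qed
  obtain \<beta> where \<beta>: "continuous_on (sphere 0 1) \<beta>" "\<And>k. (LINT z|circle. \<beta> z * z ^ k) = hankel_moments H k"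
    by (rule vanishing_tail_continuous_symbol[OF tail]) auto
  have "(\<lambda>z. z * cnj (\<beta> z)) \<in> C_circle"
    unfolding C_circle_def by (intro CollectI continuous_intros \<beta>)
  with hankel_of_symbol[OF H \<beta>(2)] show "\<exists>b\<in>C_circle. form_eq H (hankel_of b)" by blast
qed

theorem corollary19:
  fixes p :: real and a :: "complex \<Rightarrow> complex" and A H :: form
  assumes "1 < p" and "a \<in> Lp 1" and "hankel_form H"
    and "A = (\<lambda>f g. toeplitz_of a f g + H f g)"
  shows "(bounded_form_Hp p A \<longrightarrow>
            a \<in> Linf \<and> (\<exists>b\<in>Linf. form_eq H (hankel_of b))) \<and>
         (compact_form_Hp p A \<longrightarrow>
            (AE z in circle. a z = 0) \<and> (\<exists>b\<in>C_circle. form_eq H (hankel_of b)))"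
proof -
  have a: "integrable circle a" by (rule Lp_integrable[OF _ assms(2)]) simp
  show ?thesis
    unfolding assms(4)
    using bounded_toeplitz_plus_hankel[OF assms(1) a assms(3)]
      compact_toeplitz_plus_hankel[OF assms(1) a assms(3)]
    by blast
qed

end
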